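(* Let $n\ge1$, and let $v_D$ ($D\in T_{n,3}$) be the $\binom{n+1}{2}$ path vectors in $\mathbb{C}^n$ obtained from algebraically independent complex edge weights on the directed graph $G_n$. These path vectors are Schubert-generic: if $E^1_\bullet,E^2_\bullet,E^3_\bullet$ are the three complete flags in $\mathbb{C}^n$ determined by the line arrangement $\{\mathbb{C}v_D\}$, namely $E^k_i=\mathrm{span}\{v_D: D=(x_1,x_2,x_3)\in T_{n,3},\ x_k\ge n-i\}$ for $0\le i\le n$, then for all $u,v,w\in S_n$ with $\ell(u)+\ell(v)+\ell(w)=\binom n2$ the intersection $X_u(E^1_\bullet)\cap X_v(E^2_\bullet)\cap X_w(E^3_\bullet)$ consists of exactly $c_{uvw}$ points.
   Context: Path vectors. $T_{n,3}=\{x\in\mathbb{Z}_{\ge0}^3: x_1+x_2+x_3=n-1\}$. $G_n$ is the directed graph with vertex set $T_{n,3}$ and edges $x\to x-e_1+e_2$ and $x\to x-e_1+e_3$ for every $x$ with $x_1\ge1$ ($e_i$ standard basis vectors). The dots on the bottom row $\{x_1=0\}$ are labelled $1,\dots,n$ in order from left to right. The edges are given complex weights algebraically independent over $\mathbb{Q}$; the weight of a directed path is the product of the weights of its edges (empty path: weight $1$). The path vector is $v_D=(v_{D,1},\dots,v_{D,n})$, where $v_{D,i}$ is the sum of the weights of all directed paths from $D$ to dot $i$ of the bottom row. Schubert calculus. A complete flag $E_\bullet$ in $\mathbb{C}^n$ is a chain $\{0\}=E_0\subset E_1\subset\cdots\subset E_n=\mathbb{C}^n$ with $\dim E_i=i$;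 $\mathcal{F}\ell_n$ is the variety of complete flags. To $w\in S_n$ associate the $n\times n$ matrix with a $1$ in row $w(i)$ of column $n-i+1$ for $1\le i\le n$ and $0$ elsewhere; $\mathrm{rk}\,w[i,j]$ is the rank of the submatrix formed by rows $1,\dots,i$ and columns $1,\dots,j$. The Schubert variety is $X_w(E_\bullet)=\{F_\bullet\in\mathcal{F}\ell_n:\dim(E_i\cap F_j)\ge\mathrm{rk}\,w[i,j]\text{ for all }1\le i,j\le n\}$. $\ell(w)$ is the number of inversions of $w$. For $\ell(u)+\ell(v)+\ell(w)=\binom n2$, $c_{uvw}$ denotes the number of points of $X_u(A_\bullet)\cap X_v(B_\bullet)\cap X_w(C_\bullet)$ for all triples of flags $(A_\bullet,B_\bullet,C_\bullet)$ in some nonempty Zariski-open subset of $(\mathcal{F}\ell_n)^3$. Flags (or a line arrangement determining them) are Schubert-generic if they give the number $c_{uvw}$ for every such Schubert problem. *)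

theory Defs
  imports
    "HOL-Analysis.Analysis"
    "HOL-Library.Poly_Mapping"
    "HOL-Combinatorics.Permutations"
    "Graph_Theory.Graph_Theory"
begin

text \<open>
  Throughout, the complex vector space of dimension \<open>n\<close> is \<open>complex ^ 'n\<close> with \<open>n = CARD('n)\<close>;
  its linear algebra is the library's \<open>vec.\<close> theory, i.e. complex and not real linear algebra.
  The linear order on \<open>'n\<close> only serves to number the coordinates by \<open>1, \<dots>, n\<close>.
\<close>

type_synonym 'n cvec = "(complex, 'n) vec"
type_synonym 'n cmat = "((complex, 'n) vec, 'n) vec"
type_synonym 'n flag = "nat \<Rightarrow> (complex, 'n) vec set"

definition pos :: "'n::{finite,linorder} \<Rightarrow> nat" where
  "pos i = card {..i}"


section \<open>Polynomials, Zariski open sets, algebraic independence\<close>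

text \<open>
  Polynomials with variables from \<open>'v\<close>: finitely supported maps from monomials (finitely
  supported exponent maps) to coefficients.
\<close>

type_synonym 'v cpoly = "('v \<Rightarrow>\<^sub>0 nat) \<Rightarrow>\<^sub>0 complex"

definition cpoly_value :: "'v cpoly \<Rightarrow> ('v \<Rightarrow> complex) \<Rightarrow> complex" where
  "cpoly_value p x =
    (\<Sum>m\<in>Poly_Mapping.keys p. Poly_Mapping.lookup p m *
       (\<Prod>v\<in>Poly_Mapping.keys m. x v ^ Poly_Mapping.lookup m v))"

text \<open>Independence of the family \<open>x\<close> indexed by \<open>S\<close>; in particular \<open>x\<close> is injective on \<open>S\<close>.\<close>

definition alg_independent_over_rats :: "('v \<Rightarrow> complex) \<Rightarrow> 'v set \<Rightarrow> bool" where
  "alg_independent_over_rats x S \<longleftrightarrow>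
    (\<forall>p :: 'v cpoly.
       (\<forall>m. Poly_Mapping.lookup p m \<in> \<rat>) \<and> (\<forall>m\<in>Poly_Mapping.keys p. Poly_Mapping.keys m \<subseteq> S) \<and>
       cpoly_value p x = 0 \<longrightarrow> p = 0)"

text \<open>Relatively Zariski open subsets of a set \<open>X\<close> in an affine space with coordinates \<open>'v\<close>.\<close>

definition zariski_open_in :: "('v \<Rightarrow> complex) set \<Rightarrow> ('v \<Rightarrow> complex) set \<Rightarrow> bool" where
  "zariski_open_in X W \<longleftrightarrow> W \<subseteq> X \<and>
    (\<forall>x\<in>W. \<exists>p. cpoly_value p x \<noteq> 0 \<and> (\<forall>y\<in>X. cpoly_value p y \<noteq> 0 \<longrightarrow> y \<in> W))"


section \<open>Complete flags\<close>

text \<open>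
  A flag is a sequence of subspaces indexed by all natural numbers. The conditions force
  \<open>E 0 = {0}\<close> and \<open>E i = UNIV\<close> for all \<open>i \<ge> n\<close>, so that a complete flag is determined by its
  members with index at most \<open>n\<close>, and counting these sequences means counting flags.
\<close>

definition complete_flag :: "'n::finite flag \<Rightarrow> bool" where
  "complete_flag E \<longleftrightarrow> (\<forall>i. vec.subspace (E i) \<and> E i \<subseteq> E (Suc i)) \<and>
    (\<forall>i\<le>CARD('n). vec.dim (E i) = i)"

definition matrix_flag :: "'n::{finite,linorder} cmat \<Rightarrow> 'n flag" where
  "matrix_flag g j = vec.span {column c g | c. pos c \<le> j}"

text \<open>
  Triples are indexed by the three-element type \<open>3\<close>. The flag variety is the quotient of the
  general linear group by its upper triangular subgroup, via \<open>matrix_flag\<close>, and it carries the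
  quotient of the Zariski topology; likewise for triples of flags. The variable \<open>(k, r, c)\<close>
  is the entry in row \<open>r\<close> and column \<open>c\<close> of the \<open>k\<close>-th matrix.
\<close>

definition entry_matrix :: "(3 \<times> 'n::finite \<times> 'n \<Rightarrow> complex) \<Rightarrow> 3 \<Rightarrow> 'n cmat" where
  "entry_matrix x k = (\<chi> r c. x (k, r, c))"

definition GL_triples :: "(3 \<times> 'n::finite \<times> 'n \<Rightarrow> complex) set" where
  "GL_triples = {x. \<forall>k. invertible (entry_matrix x k)}"

definition zariski_open_flag_triples ::
    "(3 \<Rightarrow> 'n::{finite,linorder} flag) set \<Rightarrow> bool" where
  "zariski_open_flag_triples U \<longleftrightarrow>
    U \<subseteq> {E. \<forall>k. complete_flag (E k)} \<and>
    zariski_open_in GL_triples {x \<in> GL_triples. (\<lambda>k. matrix_flag (entry_matrix x k)) \<in> U}"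


section \<open>Schubert varieties and Schubert problems\<close>

text \<open>
  Elements of the symmetric group are functions \<open>w\<close> with \<open>w permutes {1..n}\<close>.
\<close>

definition perm_length :: "nat \<Rightarrow> (nat \<Rightarrow> nat) \<Rightarrow> nat" where
  "perm_length n w = card {(i, j). 1 \<le> i \<and> i < j \<and> j \<le> n \<and> w i > w j}"

text \<open>Column \<open>n - i + 1\<close> has its \<open>1\<close> in row \<open>w i\<close>, so column \<open>c\<close> has it in row \<open>w (n - c + 1)\<close>.\<close>

definition schubert_matrix :: "(nat \<Rightarrow> nat) \<Rightarrow> 'n::{finite,linorder} cmat" where
  "schubert_matrix w = (\<chi> r c. if pos r = w (CARD('n) - pos c + 1) then 1 else 0)"

text \<open>
  The rank of the upper left \<open>i\<close> by \<open>j\<close> block of \<open>M\<close>, computed after padding the block with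
  zeros to the size of \<open>M\<close>, which does not change the rank.
\<close>

definition block_rank :: "'n::{finite,linorder} cmat \<Rightarrow> nat \<Rightarrow> nat \<Rightarrow> nat" where
  "block_rank M i j = rank (\<chi> r c. if pos r \<le> i \<and> pos c \<le> j then M $ r $ c else 0)"

definition schubert_variety :: "(nat \<Rightarrow> nat) \<Rightarrow> 'n::{finite,linorder} flag \<Rightarrow> 'n flag set" where
  "schubert_variety w E = {F. complete_flag F \<and>
    (\<forall>i\<in>{1..CARD('n)}. \<forall>j\<in>{1..CARD('n)}.
       vec.dim (E i \<inter> F j) \<ge> block_rank (schubert_matrix w :: 'n cmat) i j)}"

definition schubert_intersection :: "(nat \<Rightarrow> nat) \<Rightarrow> (nat \<Rightarrow> nat) \<Rightarrow> (nat \<Rightarrow> nat) \<Rightarrow>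
    (3 \<Rightarrow> 'n::{finite,linorder} flag) \<Rightarrow> 'n flag set" where
  "schubert_intersection u v w E =
    schubert_variety u (E 1) \<inter> schubert_variety v (E 2) \<inter> schubert_variety w (E 3)"

text \<open>
  The number \<open>c\<^sub>u\<^sub>v\<^sub>w\<close>. Finiteness is required explicitly because \<open>card\<close> is \<open>0\<close> on infinite sets.
  The type argument fixes the dimension.
\<close>

definition schubert_number ::
    "'n::{finite,linorder} itself \<Rightarrow> (nat \<Rightarrow> nat) \<Rightarrow> (nat \<Rightarrow> nat) \<Rightarrow> (nat \<Rightarrow> nat) \<Rightarrow> nat" where
  "schubert_number _ u v w =
    (THE c. \<exists>U :: (3 \<Rightarrow> 'n flag) set.
       U \<noteq> {} \<and> zariski_open_flag_triples U \<and>
       (\<forall>E\<in>U. finite (schubert_intersection u v w E) \<and>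
               card (schubert_intersection u v w E) = c))"

definition schubert_generic :: "(3 \<Rightarrow> 'n::{finite,linorder} flag) \<Rightarrow> bool" where
  "schubert_generic E \<longleftrightarrow> (\<forall>k. complete_flag (E k)) \<and>
    (\<forall>u v w. u permutes {1..CARD('n)} \<and> v permutes {1..CARD('n)} \<and> w permutes {1..CARD('n)} \<and>
       perm_length CARD('n) u + perm_length CARD('n) v + perm_length CARD('n) w = CARD('n) choose 2
       \<longrightarrow> finite (schubert_intersection u v w E) \<and>
           card (schubert_intersection u v w E) = schubert_number TYPE('n) u v w)"


section \<open>Path vectors\<close>

text \<open>The condition \<open>x\<^sub>1 + x\<^sub>2 + x\<^sub>3 = n - 1\<close> is only meant for \<open>n \<ge> 1\<close>.\<close>

definition triangle :: "nat \<Rightarrow> (nat ^ 3) set" where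
  "triangle n = {x. x $ 1 + x $ 2 + x $ 3 = n - 1}"

text \<open>The subtraction on the natural numbers is not truncated here, as \<open>x $ 1 \<ge> 1\<close>.\<close>

definition triangle_graph :: "nat \<Rightarrow> (nat ^ 3) pair_pre_digraph" where
  "triangle_graph n = \<lparr> pverts = triangle n,
     parcs = {(x, y). x \<in> triangle n \<and> x $ 1 \<ge> 1 \<and>
       (y = x - axis 1 1 + axis 2 1 \<or> y = x - axis 1 1 + axis 3 1)} \<rparr>"

text \<open>The dots with first coordinate \<open>0\<close>; the leftmost one, dot \<open>1\<close>, is the corner \<open>(0, n - 1, 0)\<close>.\<close>

definition bottom_dot :: "nat \<Rightarrow> nat \<Rightarrow> nat ^ 3" where
  "bottom_dot n i = vector [0, n - i, i - 1]"

definition path_vector ::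
    "((nat ^ 3) \<times> (nat ^ 3) \<Rightarrow> complex) \<Rightarrow> nat ^ 3 \<Rightarrow> 'n::{finite,linorder} cvec" where
  "path_vector wt D =
    (\<chi> i. \<Sum>p | pre_digraph.apath (with_proj (triangle_graph CARD('n))) D p
                  (bottom_dot CARD('n) (pos i)).
       prod_list (map wt p))"

definition path_flag ::
    "((nat ^ 3) \<times> (nat ^ 3) \<Rightarrow> complex) \<Rightarrow> 3 \<Rightarrow> 'n::{finite,linorder} flag" where
  "path_flag wt k i =
    vec.span {path_vector wt D | D. D \<in> triangle CARD('n) \<and> D $ k \<ge> CARD('n) - i}"

end

theory Submission
  imports Defs "HOL-Computational_Algebra.Fundamental_Theorem_Algebra"
begin

text \<open>
  The number of flags in a triple intersection of Schubert varieties is a first-order property of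
  the entries of three matrices, so by quantifier elimination over \<open>\<complex>\<close> it is constant where a
  suitable rational polynomial \<open>q\<close> does not vanish, and \<open>q\<close> can be chosen nonzero at a given triple
  with algebraically independent entries. At such a triple the number is finite by counting
  parameters: an infinite definable set of flags contains one with an entry transcendental over the
  triple, but a flag together with three flags in prescribed positions relative to it depends on at
  most \<open>3 n\<^sup>2\<close> parameters when the lengths add up to \<open>n choose 2\<close>. Finally, in a generic triple
  of flags the lines \<open>A\<^sub>i \<inter> B\<^sub>j \<inter> C\<^sub>k\<close> with \<open>i + j + k = 2 n + 1\<close> satisfy the relations of path
  vectors, so up to the action of the general linear group the triple consists of path flags. Hence
  \<open>q\<close>, evaluated at translates of the path flags, is not identically zero in the weights, and it
  does not vanish at algebraically independent ones.
\<close>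

section \<open>Polynomial functions\<close>

text \<open>The coefficients have to stay rational, because algebraic independence over
  \<open>\<rat>\<close> says nothing about polynomials with arbitrary complex coefficients. Hence
  definability is built from rational polynomials, and the matrices that move path flags to another
  triple are made rational before the weights enter. No transversality theory is used: only points
  are counted, so a count of parameters suffices. It takes place in the ring generated by the
  parameters: if few numbers generated many independent ones, monomials of bounded exponent would be
  rationally dependent for reasons of dimension. Inverses that are needed are listed among the
  parameters. Finiteness is not a first-order condition, whereas having exactly c members is one for
  each fixed c. So finiteness is shown at one generic triple, and the number found there spreads to
  a Zariski open set; this also yields that the number in the definition exists. An infinite
  definable set of values of one variable is cofinite, so it meets the complement of every countable
  set; this supplies the transcendental entry.\<close>

inductive_set polyfun :: "complex set \<Rightarrow> 'v set \<Rightarrow> (('v \<Rightarrow> complex) \<Rightarrow> complex) set"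
  for K S where
  const: "c \<in> K \<Longrightarrow> (\<lambda>e. c) \<in> polyfun K S"
| var: "v \<in> S \<Longrightarrow> (\<lambda>e. e v) \<in> polyfun K S"
| add: "f \<in> polyfun K S \<Longrightarrow> g \<in> polyfun K S \<Longrightarrow> (\<lambda>e. f e + g e) \<in> polyfun K S"
| mult: "f \<in> polyfun K S \<Longrightarrow> g \<in> polyfun K S \<Longrightarrow> (\<lambda>e. f e * g e) \<in> polyfun K S"

lemma polyfun_mono:
  assumes "f \<in> polyfun K S" "K \<subseteq> K'" "S \<subseteq> S'"
  shows "f \<in> polyfun K' S'"
  using assms(1) by induction (use assms(2,3) in \<open>auto intro: polyfun.intros\<close>)

lemma polyfun_cong:
  assumes "f \<in> polyfun K S" "\<And>v. v \<in> S \<Longrightarrow> e v = e' v"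
  shows "f e = f e'"
  using assms(1) by induction (use assms(2) in auto)

lemma polyfun_compose:
  assumes "f \<in> polyfun K S" "\<And>v. v \<in> S \<Longrightarrow> (\<lambda>e. \<Phi> e v) \<in> polyfun K T"
  shows "(\<lambda>e. f (\<Phi> e)) \<in> polyfun K T"
  using assms(1) by induction (use assms(2) in \<open>auto intro: polyfun.intros\<close>)

lemma polyfun_rat: "\<rat> \<subseteq> K \<Longrightarrow> c \<in> \<rat> \<Longrightarrow> (\<lambda>e. c) \<in> polyfun K S"
  by (auto intro: polyfun.const)

lemma polyfun_uminus: "\<rat> \<subseteq> K \<Longrightarrow> f \<in> polyfun K S \<Longrightarrow> (\<lambda>e. - f e) \<in> polyfun K S"
  using polyfun.mult[OF polyfun_rat[of K "-1", where S = S], of f] by simp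

lemma polyfun_diff:
  "\<rat> \<subseteq> K \<Longrightarrow> f \<in> polyfun K S \<Longrightarrow> g \<in> polyfun K S \<Longrightarrow> (\<lambda>e. f e - g e) \<in> polyfun K S"
  using polyfun.add[OF _ polyfun_uminus[of K g S], of f] by simp

lemma polyfun_sum:
  "\<rat> \<subseteq> K \<Longrightarrow> (\<And>i. i \<in> I \<Longrightarrow> f i \<in> polyfun K S) \<Longrightarrow> (\<lambda>e. \<Sum>i\<in>I. f i e) \<in> polyfun K S"
  by (induction I rule: infinite_finite_induct) (auto intro: polyfun.add polyfun_rat)

lemma polyfun_prod:
  "\<rat> \<subseteq> K \<Longrightarrow> (\<And>i. i \<in> I \<Longrightarrow> f i \<in> polyfun K S) \<Longrightarrow> (\<lambda>e. \<Prod>i\<in>I. f i e) \<in> polyfun K S"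
  by (induction I rule: infinite_finite_induct) (auto intro: polyfun.mult polyfun_rat)

lemma polyfun_power:
  "\<rat> \<subseteq> K \<Longrightarrow> f \<in> polyfun K S \<Longrightarrow> (\<lambda>e. f e ^ n) \<in> polyfun K S"
  by (induction n) (auto intro: polyfun.mult polyfun_rat)

lemma polyfun_det:
  assumes "\<rat> \<subseteq> K" "\<And>r c. (\<lambda>e. M e $ r $ c) \<in> polyfun K S"
  shows "(\<lambda>e. det (M e :: 'n::finite cmat)) \<in> polyfun K S"
  unfolding det_def using assms
  by (intro polyfun_sum polyfun.mult polyfun_prod polyfun_rat) auto

lemma polyfun_matrix_mult:
  assumes "\<rat> \<subseteq> K" "\<And>r c. (\<lambda>e. A e $ r $ c) \<in> polyfun K S" "\<And>r c. (\<lambda>e. B e $ r $ c) \<in> polyfun K S"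
  shows "(\<lambda>e. (A e ** B e :: 'n::finite cmat) $ r $ c) \<in> polyfun K S"
  unfolding matrix_matrix_mult_def using assms
  by (auto intro!: polyfun_sum polyfun.mult)

text \<open>Polynomials in one variable whose coefficients are polynomial functions of parameters.
  The bound \<open>n\<close> on the number of coefficients is formal and uniform in the parameters;
  the actual degree may drop at special parameters, which forces the case distinctions in the
  elimination below.\<close>

definition upoly :: "complex set \<Rightarrow> 'v set \<Rightarrow> nat \<Rightarrow> (('v \<Rightarrow> complex) \<Rightarrow> complex poly) set" where
  "upoly K S n = {F. (\<forall>i. (\<lambda>e. coeff (F e) i) \<in> polyfun K S) \<and> (\<forall>e. \<forall>i\<ge>n. coeff (F e) i = 0)}"

lemma upoly_coeff: "F \<in> upoly K S n \<Longrightarrow> (\<lambda>e. coeff (F e) i) \<in> polyfun K S"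
  by (simp add: upoly_def)

lemma upoly_coeff_0: "F \<in> upoly K S n \<Longrightarrow> i \<ge> n \<Longrightarrow> coeff (F e) i = 0"
  by (simp add: upoly_def)

lemma upoly_zero_iff: "F \<in> upoly K S n \<Longrightarrow> F e = 0 \<longleftrightarrow> (\<forall>i<n. coeff (F e) i = 0)"
  by (metis coeff_0 leI poly_eqI upoly_coeff_0)

lemma upoly_mult:
  assumes "\<rat> \<subseteq> K" "F \<in> upoly K S n" "G \<in> upoly K S m"
  shows "(\<lambda>e. F e * G e) \<in> upoly K S (n + m)"
proof -
  have "coeff (F e) j * coeff (G e) (i - j) = 0" if "i \<ge> n + m" for e i j
  proof (cases "j \<ge> n")
    case True
    then show ?thesis using upoly_coeff_0[OF assms(2)] by simp
  next
    case False
    then have "i - j \<ge> m" using that by simp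
    then show ?thesis using upoly_coeff_0[OF assms(3)] by simp
  qed
  then show ?thesis
    using assms by (auto simp: upoly_def coeff_mult intro!: polyfun_sum polyfun.mult sum.neutral)
qed

lemma upoly_power:
  assumes "\<rat> \<subseteq> K" "F \<in> upoly K S n"
  shows "\<exists>m. (\<lambda>e. F e ^ k) \<in> upoly K S m"
proof (induction k)
  case 0
  have "(\<lambda>e. 1) \<in> upoly K S 1"
    using assms(1) by (auto simp: upoly_def intro!: polyfun_rat)
  then show ?case by auto
next
  case (Suc k)
  then show ?case using upoly_mult[OF assms] by auto
qed

text \<open>Isolates one variable. That the coefficients live on \<open>S - {v}\<close> is what
  permits induction on the variables.\<close>

lemma polyfun_upoly:
  assumes "\<rat> \<subseteq> K" "f \<in> polyfun K S"
  shows "\<exists>n. \<exists>F\<in>upoly K (S - {v}) n. \<forall>e t. f (e(v := t)) = poly (F e) t"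
  using assms(2)
proof induction
  case (const c)
  have "(\<lambda>e. [:c:]) \<in> upoly K (S - {v}) 1"
    using assms(1) const by (auto simp: upoly_def coeff_pCons intro!: polyfun.const split: nat.splits)
  then show ?case by (intro exI[of _ 1] bexI[of _ "\<lambda>e. [:c:]"]) auto
next
  case (var w)
  show ?case
  proof (cases "w = v")
    case True
    have "(\<lambda>e. [:0, 1:]) \<in> upoly K (S - {v}) 2"
      using assms(1) by (auto simp: upoly_def coeff_pCons intro!: polyfun_rat split: nat.splits)
    then show ?thesis using True by (intro exI[of _ 2] bexI[of _ "\<lambda>e. [:0, 1:]"]) auto
  next
    case False
    have "(\<lambda>e. coeff [:e w:] i) \<in> polyfun K (S - {v})" for i
      using assms(1) False var by (cases i) (auto simp: coeff_pCons intro!: polyfun_rat polyfun.var)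
    then have "(\<lambda>e. [:e w:]) \<in> upoly K (S - {v}) 1"
      by (auto simp: upoly_def coeff_pCons split: nat.splits)
    then show ?thesis using False by (intro exI[of _ 1] bexI[of _ "\<lambda>e. [:e w:]"]) auto
  qed
next
  case (add f g)
  then obtain n F m G where
    F: "F \<in> upoly K (S - {v}) n" "\<forall>e t. f (e(v := t)) = poly (F e) t" and
    G: "G \<in> upoly K (S - {v}) m" "\<forall>e t. g (e(v := t)) = poly (G e) t" by blast
  have "(\<lambda>e. F e + G e) \<in> upoly K (S - {v}) (max n m)"
    using F(1) G(1) by (auto simp: upoly_def intro!: polyfun.add)
  then show ?case using F(2) G(2) by (intro exI bexI[of _ "\<lambda>e. F e + G e"] allI) (simp only: poly_add)
next
  case (mult f g)
  then obtain n F m G where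
    F: "F \<in> upoly K (S - {v}) n" "\<forall>e t. f (e(v := t)) = poly (F e) t" and
    G: "G \<in> upoly K (S - {v}) m" "\<forall>e t. g (e(v := t)) = poly (G e) t" by blast
  show ?case using upoly_mult[OF assms(1) F(1) G(1)] F(2) G(2)
    by (intro exI bexI[of _ "\<lambda>e. F e * G e"] allI) (simp only: poly_mult)
qed

lemma polyfun_finite_zeros:
  assumes "\<rat> \<subseteq> K" "f \<in> polyfun K S" "f (e(v := s)) \<noteq> 0"
  shows "finite {t. f (e(v := t)) = 0}"
proof -
  obtain n F where F: "\<forall>e t. f (e(v := t)) = poly (F e) t"
    using polyfun_upoly[OF assms(1,2), of v] by blast
  then have "F e \<noteq> 0" using assms(3) by auto
  then show ?thesis using F poly_roots_finite[of "F e"] by simp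
qed

lemma polyfun_line:
  assumes "f \<in> polyfun K S"
  shows "\<exists>p. \<forall>t. f (\<lambda>v. x v + t * (y v - x v)) = poly p t"
  using assms
proof induction
  case (const c)
  then show ?case by (intro exI[of _ "[:c:]"]) simp
next
  case (var v)
  then show ?case by (intro exI[of _ "[:x v, y v - x v:]"]) simp
next
  case (add f g)
  then show ?case by (metis poly_add)
next
  case (mult f g)
  then show ?case by (metis poly_mult)
qed

text \<open>On the line through \<open>x\<close> and \<open>y\<close> both functions become nonzero
  polynomials in one variable, and so does their product. This is the irreducibility of affine
  space.\<close>

lemma polyfun_prod_nonzero:
  assumes "f \<in> polyfun K S" "g \<in> polyfun K' S'" "f x \<noteq> 0" "g y \<noteq> 0"
  shows "\<exists>z. f z \<noteq> 0 \<and> g z \<noteq> 0"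
proof -
  obtain p q where p: "\<forall>t. f (\<lambda>v. x v + t * (y v - x v)) = poly p t"
    and q: "\<forall>t. g (\<lambda>v. x v + t * (y v - x v)) = poly q t"
    using polyfun_line[OF assms(1)] polyfun_line[OF assms(2)] by blast
  have "p \<noteq> 0" "q \<noteq> 0"
    using p[rule_format, of 0] q[rule_format, of 1] assms(3,4) by auto
  then have "p * q \<noteq> 0" by simp
  then obtain t where "poly (p * q) t \<noteq> 0"
    using poly_all_0_iff_0 by blast
  then show ?thesis
    using p q by (intro exI[of _ "\<lambda>v. x v + t * (y v - x v)"]) auto
qed

section \<open>Quantifier elimination\<close>

text \<open>These are the constructible sets over \<open>\<rat>\<close>. Quantifiers are absent from
  the definition; closure under them is the theorem of this section.\<close>

inductive definable :: "(('v \<Rightarrow> complex) \<Rightarrow> bool) \<Rightarrow> bool" where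
  zero: "f \<in> polyfun \<rat> UNIV \<Longrightarrow> definable (\<lambda>e. f e = 0)"
| neg: "definable P \<Longrightarrow> definable (\<lambda>e. \<not> P e)"
| conj: "definable P \<Longrightarrow> definable Q \<Longrightarrow> definable (\<lambda>e. P e \<and> Q e)"

lemma definable_disj: "definable P \<Longrightarrow> definable Q \<Longrightarrow> definable (\<lambda>e. P e \<or> Q e)"
  using definable.neg[OF definable.conj[OF definable.neg definable.neg], of P Q] by simp

lemma definable_const: "definable (\<lambda>e. b)"
proof (cases b)
  case True
  then show ?thesis using definable.zero[OF polyfun_rat[of \<rat> 0]] by simp
next
  case False
  then show ?thesis using definable.zero[OF polyfun_rat[of \<rat> 1]] by simp
qed

lemma definable_ball:
  "finite I \<Longrightarrow> (\<And>i. i \<in> I \<Longrightarrow> definable (P i)) \<Longrightarrow> definable (\<lambda>e. \<forall>i\<in>I. P i e)"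
  by (induction I rule: finite_induct) (auto intro: definable_const definable.conj)

lemma definable_bex:
  "finite I \<Longrightarrow> (\<And>i. i \<in> I \<Longrightarrow> definable (P i)) \<Longrightarrow> definable (\<lambda>e. \<exists>i\<in>I. P i e)"
  by (induction I rule: finite_induct) (auto intro: definable_const definable_disj)

lemma definable_eq:
  "f \<in> polyfun \<rat> UNIV \<Longrightarrow> g \<in> polyfun \<rat> UNIV \<Longrightarrow> definable (\<lambda>e. f e = g e)"
  using definable.zero[OF polyfun_diff, of f g] by simp

lemma definable_upoly_zero:
  assumes "F \<in> upoly \<rat> UNIV n"
  shows "definable (\<lambda>e. F e = 0)"
proof -
  have "definable (\<lambda>e. \<forall>i\<in>{..<n}. coeff (F e) i = 0)"
    by (intro definable_ball definable.zero upoly_coeff[OF assms]) auto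
  moreover have "(\<forall>i\<in>{..<n}. coeff (F e) i = 0) = (F e = 0)" for e
    using upoly_zero_iff[OF assms] by auto
  ultimately show ?thesis by simp
qed

text \<open>One step of pseudo-division: the formal leading terms cancel after cross-multiplication,
  so no coefficient is divided by another.\<close>

definition upoly_reduce ::
    "nat \<Rightarrow> nat \<Rightarrow> ('e \<Rightarrow> complex poly) \<Rightarrow> ('e \<Rightarrow> complex poly) \<Rightarrow> 'e \<Rightarrow> complex poly" where
  "upoly_reduce d m F G e =
    smult (coeff (F e) d) (G e) - smult (coeff (G e) m) (monom 1 (m - d) * F e)"

lemma upoly_reduce:
  assumes "F \<in> upoly \<rat> S (Suc d)" "G \<in> upoly \<rat> S (Suc m)" "d \<le> m"
  shows "upoly_reduce d m F G \<in> upoly \<rat> S m"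
proof -
  have "coeff (upoly_reduce d m F G e) i = 0" if "i \<ge> m" for e i
  proof (cases "i = m")
    case True
    then show ?thesis using assms(3)
      by (simp add: upoly_reduce_def coeff_monom_mult)
  next
    case False
    then have "i \<ge> Suc m" "i - (m - d) \<ge> Suc d" using that assms(3) by auto
    then show ?thesis
      using upoly_coeff_0[OF assms(1)] upoly_coeff_0[OF assms(2)]
      by (simp add: upoly_reduce_def coeff_monom_mult)
  qed
  moreover have "(\<lambda>e. coeff (upoly_reduce d m F G e) i) \<in> polyfun \<rat> S" for i
    using upoly_coeff[OF assms(1)] upoly_coeff[OF assms(2)]
    by (cases "i \<ge> m - d") (auto simp: upoly_reduce_def coeff_monom_mult
        intro!: polyfun_diff polyfun.mult polyfun_rat)
  ultimately show ?thesis by (simp add: upoly_def)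
qed

text \<open>Agrees with \<open>F e\<close> wherever the formal leading coefficient vanishes, but has
  a smaller formal size.\<close>

definition upoly_drop :: "nat \<Rightarrow> ('e \<Rightarrow> complex poly) \<Rightarrow> 'e \<Rightarrow> complex poly" where
  "upoly_drop d F e = F e - monom (coeff (F e) d) d"

lemma upoly_drop:
  assumes "F \<in> upoly \<rat> S (Suc d)"
  shows "upoly_drop d F \<in> upoly \<rat> S d"
proof -
  have "coeff (upoly_drop d F e) i = 0" if "i \<ge> d" for e i
    using that upoly_coeff_0[OF assms, of i] by (cases "i = d") (auto simp: upoly_drop_def)
  moreover have "(\<lambda>e. coeff (upoly_drop d F e) i) \<in> polyfun \<rat> S" for i
    using upoly_coeff[OF assms]
    by (cases "i = d") (auto simp: upoly_drop_def intro!: polyfun_rat)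
  ultimately show ?thesis by (simp add: upoly_def)
qed

lemma upoly_degree_eq:
  assumes "F \<in> upoly K S (Suc d)" "coeff (F e) d \<noteq> 0"
  shows "degree (F e) = d"
  by (metis Suc_leI assms le_degree leading_coeff_neq_0 le_antisym not_le upoly_coeff_0 coeff_0)

text \<open>Pseudo-division of \<open>G\<close> by \<open>F\<close> until its formal size is at most
  \<open>d\<close>; then divisibility means that \<open>G e\<close> is zero. The nonvanishing
  coefficient makes \<open>d\<close> the true degree of \<open>F e\<close>, and it makes
  multiplication by that coefficient harmless for divisibility.\<close>

lemma definable_dvd:
  assumes "F \<in> upoly \<rat> UNIV (Suc d)" "G \<in> upoly \<rat> UNIV m"
  shows "definable (\<lambda>e. coeff (F e) d \<noteq> 0 \<and> F e dvd G e)"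
  using assms(2)
proof (induction m arbitrary: G)
  case 0
  then have "G e = 0" for e using upoly_zero_iff[OF 0] by simp
  then show ?case using definable.neg[OF definable.zero[OF upoly_coeff[OF assms(1)]]] by simp
next
  case (Suc m)
  show ?case
  proof (cases "d \<le> m")
    case False
    have "(coeff (F e) d \<noteq> 0 \<and> F e dvd G e) = (coeff (F e) d \<noteq> 0 \<and> G e = 0)" for e
    proof -
      have "G e = 0" if "coeff (F e) d \<noteq> 0" "F e dvd G e"
      proof (rule ccontr)
        assume "G e \<noteq> 0"
        then have "d \<le> degree (G e)"
          using dvd_imp_degree_le[OF that(2)] upoly_degree_eq[OF assms(1) that(1)] by simp
        then have "coeff (G e) (degree (G e)) = 0"
          using False upoly_coeff_0[OF Suc.prems] by simp
        then show False using \<open>G e \<noteq> 0\<close> by simp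
      qed
      then show ?thesis by auto
    qed
    then show ?thesis
      using definable.conj[OF definable.neg[OF definable.zero[OF upoly_coeff[OF assms(1), of d]]]
          definable_upoly_zero[OF Suc.prems]] by simp
  next
    case True
    have "(coeff (F e) d \<noteq> 0 \<and> F e dvd G e) =
        (coeff (F e) d \<noteq> 0 \<and> F e dvd upoly_reduce d m F G e)" for e
    proof -
      have "F e dvd smult (coeff (G e) m) (monom 1 (m - d) * F e)"
        by (simp add: dvd_smult)
      then have "F e dvd upoly_reduce d m F G e \<longleftrightarrow> F e dvd smult (coeff (F e) d) (G e)"
        unfolding upoly_reduce_def
        by (metis diff_add_cancel dvd_add dvd_diff)
      then show ?thesis using dvd_smult_iff by auto
    qed
    then show ?thesis using Suc.IH[OF upoly_reduce[OF assms(1) Suc.prems True]] by simp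
  qed
qed

text \<open>The Euclidean algorithm with a case distinction on leading coefficients reduces the
  equations to at most one. In the measure each equation counts one more than its formal size, so
  that deleting an equation of size 0 is also progress.\<close>

lemma definable_elim:
  assumes "\<And>n F. (n, F) \<in> set ps \<Longrightarrow> F \<in> upoly \<rat> UNIV n" "G \<in> upoly \<rat> UNIV m"
  shows "definable (\<lambda>e. \<exists>t. (\<forall>(n, F)\<in>set ps. poly (F e) t = 0) \<and> poly (G e) t \<noteq> 0)"
  using assms(1)
proof (induction "\<Sum>(n, F)\<leftarrow>ps. Suc n" arbitrary: ps rule: less_induct)
  case less
  let ?Z = "\<lambda>ps e. \<exists>t. (\<forall>(n, F)\<in>set ps. poly (F e) t = 0) \<and> poly (G e) t \<noteq> 0"
  let ?def = "\<lambda>ps. definable (?Z ps)"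
  note split = definable_disj[OF definable.conj[OF definable.zero]
      definable.conj[OF definable.neg[OF definable.zero]]]
  \<comment> \<open>Of two equations the shorter one is either shortened, if its leading coefficient
    vanishes, or used to reduce the longer one. At common zeros the reduced polynomial is a nonzero
    multiple of the longer one.\<close>
  have two: "?def ((Suc d1, F1) # (Suc d2, F2) # rest)"
    if mem: "set ((Suc d1, F1) # (Suc d2, F2) # rest) \<subseteq> set ps"
      and sz: "(\<Sum>(n, F)\<leftarrow>(Suc d1, F1) # (Suc d2, F2) # rest. Suc n) \<le> (\<Sum>(n, F)\<leftarrow>ps. Suc n)"
      and le: "d1 \<le> d2" for d1 F1 d2 F2 rest
  proof -
    have F1: "F1 \<in> upoly \<rat> UNIV (Suc d1)" and F2: "F2 \<in> upoly \<rat> UNIV (Suc d2)"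
      and rest: "\<And>n F. (n, F) \<in> set rest \<Longrightarrow> F \<in> upoly \<rat> UNIV n"
      using less.prems mem by auto
    have A: "?def ((d1, upoly_drop d1 F1) # (Suc d2, F2) # rest)"
      using sz upoly_drop[OF F1] F2 rest by (intro less.hyps) auto
    have B: "?def ((Suc d1, F1) # (d2, upoly_reduce d1 d2 F1 F2) # rest)"
      using sz upoly_reduce[OF F1 F2 le] F1 rest by (intro less.hyps) auto
    have "?Z ((Suc d1, F1) # (Suc d2, F2) # rest) e =
      (coeff (F1 e) d1 = 0 \<and> ?Z ((d1, upoly_drop d1 F1) # (Suc d2, F2) # rest) e \<or>
       coeff (F1 e) d1 \<noteq> 0 \<and> ?Z ((Suc d1, F1) # (d2, upoly_reduce d1 d2 F1 F2) # rest) e)" for e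
    proof (cases "coeff (F1 e) d1 = 0")
      case True
      then show ?thesis by (simp add: upoly_drop_def)
    next
      case False
      have "poly (upoly_reduce d1 d2 F1 F2 e) t = coeff (F1 e) d1 * poly (F2 e) t"
        if "poly (F1 e) t = 0" for t
        using that by (simp add: upoly_reduce_def)
      then show ?thesis using False by auto
    qed
    then show ?thesis using split[OF upoly_coeff[OF F1] A upoly_coeff[OF F1] B] by simp
  qed
  show ?case
  proof (cases ps)
    case Nil
    have "(\<exists>t. poly (G e) t \<noteq> 0) = (\<not> G e = 0)" for e
      using poly_all_0_iff_0[of "G e"] by auto
    then show ?thesis using definable.neg[OF definable_upoly_zero[OF assms(2)]] Nil by simp
  next
    case (Cons p1 rest)
    obtain n1 F1 where p1: "p1 = (n1, F1)" by force
    have F1: "F1 \<in> upoly \<rat> UNIV n1" using less.prems Cons p1 by simp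
    show ?thesis
    proof (cases n1)
      case 0
      then have "F1 e = 0" for e using upoly_zero_iff[OF F1] by simp
      moreover have "?def rest" using less.prems Cons p1 by (intro less.hyps) auto
      ultimately show ?thesis using Cons p1 by simp
    next
      case d1: (Suc d1)
      show ?thesis
      proof (cases rest)
        case Nil
        \<comment> \<open>A single equation of degree \<open>d1\<close> remains. It has no zero
          outside the zeros of \<open>G e\<close> iff it divides the \<open>d1\<close>-th power of
          \<open>G e\<close>; this exponent does not depend on the parameters.\<close>
        obtain m' where m': "(\<lambda>e. G e ^ d1) \<in> upoly \<rat> UNIV m'"
          using upoly_power[OF _ assms(2)] by blast
        have A: "?def [(d1, upoly_drop d1 F1)]"
          using Cons p1 d1 Nil upoly_drop[of F1 UNIV d1] F1 by (intro less.hyps) auto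
        have "?Z ps e =
          (coeff (F1 e) d1 = 0 \<and> ?Z [(d1, upoly_drop d1 F1)] e \<or>
           coeff (F1 e) d1 \<noteq> 0 \<and> \<not> (coeff (F1 e) d1 \<noteq> 0 \<and> F1 e dvd G e ^ d1))" for e
        proof (cases "coeff (F1 e) d1 = 0")
          case True
          then show ?thesis using Cons p1 d1 Nil by (simp add: upoly_drop_def)
        next
          case False
          then have "degree (F1 e) = d1" "F1 e \<noteq> 0"
            using upoly_degree_eq[of F1] F1 d1 by auto
          then show ?thesis
            using nullstellensatz_univariate[of "F1 e" "G e"] False Cons p1 Nil by auto
        qed
        moreover have "definable (\<lambda>e. \<not> (coeff (F1 e) d1 \<noteq> 0 \<and> F1 e dvd G e ^ d1))"
          using definable.neg[OF definable_dvd[OF _ m']] F1 d1 by simp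
        ultimately show ?thesis
          using split[OF upoly_coeff[OF F1] A upoly_coeff[OF F1]] by simp
      next
        case rest: (Cons p2 rest2)
        obtain n2 F2 where p2: "p2 = (n2, F2)" by force
        have F2: "F2 \<in> upoly \<rat> UNIV n2" using less.prems Cons rest p2 by simp
        show ?thesis
        proof (cases n2)
          case 0
          then have "F2 e = 0" for e using upoly_zero_iff[OF F2] by simp
          moreover have "?def (p1 # rest2)" using less.prems Cons rest p1 p2 by (intro less.hyps) auto
          ultimately show ?thesis using Cons rest p1 p2 by simp
        next
          case d2: (Suc d2)
          show ?thesis
          proof (cases "d1 \<le> d2")
            case True
            then show ?thesis using two[of d1 F1 d2 F2 rest2] Cons rest p1 p2 d1 d2 by simp
          next
            case False
            then have "?def (p2 # p1 # rest2)"
              using two[of d2 F2 d1 F1 rest2] Cons rest p1 p2 d1 d2 by auto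
            moreover have "set ps = set (p2 # p1 # rest2)" using Cons rest by auto
            ultimately show ?thesis by simp
          qed
        qed
      qed
    qed
  qed
qed

text \<open>Disjunctive normal form with respect to one variable. One inequation per conjunction is
  enough, since several of them are equivalent to one for their product.\<close>

inductive dnf :: "(('v \<Rightarrow> complex) \<Rightarrow> complex \<Rightarrow> bool) \<Rightarrow> bool" where
  basic: "(\<And>n F. (n, F) \<in> set ps \<Longrightarrow> F \<in> upoly \<rat> UNIV n) \<Longrightarrow> G \<in> upoly \<rat> UNIV m \<Longrightarrow>
    dnf (\<lambda>e t. (\<forall>(n, F)\<in>set ps. poly (F e) t = 0) \<and> poly (G e) t \<noteq> 0)"
| disj: "dnf P \<Longrightarrow> dnf Q \<Longrightarrow> dnf (\<lambda>e t. P e t \<or> Q e t)"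

lemma dnf_ex: "dnf P \<Longrightarrow> definable (\<lambda>e. \<exists>t. P e t)"
proof (induction rule: dnf.induct)
  case (basic ps G m)
  then show ?case using definable_elim by blast
next
  case (disj P Q)
  then show ?case using definable_disj by (simp add: ex_disj_distrib)
qed

lemma dnf_conj:
  assumes "dnf P" "dnf Q"
  shows "dnf (\<lambda>e t. P e t \<and> Q e t)"
  using assms(1)
proof (induction rule: dnf.induct)
  case P: (basic ps G m)
  show ?case using assms(2)
  proof (induction rule: dnf.induct)
    case Q: (basic qs H k)
    have "dnf (\<lambda>e t. (\<forall>(n, F)\<in>set (ps @ qs). poly (F e) t = 0) \<and> poly (G e * H e) t \<noteq> 0)"
      using P Q by (intro dnf.basic[where m = "m + k"] upoly_mult) auto
    moreover have "((\<forall>(n, F)\<in>set (ps @ qs). poly (F e) t = 0) \<and> poly (G e * H e) t \<noteq> 0) =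
      (((\<forall>(n, F)\<in>set ps. poly (F e) t = 0) \<and> poly (G e) t \<noteq> 0) \<and>
       ((\<forall>(n, F)\<in>set qs. poly (F e) t = 0) \<and> poly (H e) t \<noteq> 0))" for e t
      by auto
    ultimately show ?case by simp
  next
    case (disj Q Q')
    then show ?case using dnf.disj by (simp add: conj_disj_distribL)
  qed
next
  case (disj P P')
  then show ?case using dnf.disj by (simp add: conj_disj_distribR)
qed

text \<open>Carrying the claim for \<open>P\<close> and its negation together makes the negation
  step of the induction trivial.\<close>

lemma definable_dnf:
  assumes "definable P"
  shows "dnf (\<lambda>e t. P (e(v := t))) \<and> dnf (\<lambda>e t. \<not> P (e(v := t)))"
  using assms
proof (induction rule: definable.induct)
  case (zero f)
  obtain n F where F: "F \<in> upoly \<rat> (UNIV - {v}) n" "\<forall>e t. f (e(v := t)) = poly (F e) t"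
    using polyfun_upoly[OF _ zero, of v] by blast
  have F': "F \<in> upoly \<rat> UNIV n"
    using F(1) polyfun_mono unfolding upoly_def by blast
  have one: "(\<lambda>e. 1) \<in> upoly \<rat> UNIV 1"
    by (auto simp: upoly_def intro!: polyfun_rat)
  show ?case
    using dnf.basic[of "[(n, F)]", OF _ one] dnf.basic[of "[]", OF _ F'] F' unfolding F(2)[rule_format] by simp
next
  case (neg P)
  then show ?case by simp
next
  case (conj P Q)
  show ?case
  proof
    show "dnf (\<lambda>e t. P (e(v := t)) \<and> Q (e(v := t)))" using conj.IH dnf_conj by blast
    show "dnf (\<lambda>e t. \<not> (P (e(v := t)) \<and> Q (e(v := t))))"
      unfolding de_Morgan_conj using conj.IH dnf.disj by blast
  qed
qed

lemma definable_ex_upd: "definable P \<Longrightarrow> definable (\<lambda>e. \<exists>t. P (e(v := t)))"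
  by (rule dnf_ex[OF conjunct1[OF definable_dnf]])

text \<open>A block of existential quantifiers over the variables in \<open>V\<close>: overriding
  changes the values there and nowhere else.\<close>

lemma definable_ex_override:
  assumes "finite V" "definable P"
  shows "definable (\<lambda>e. \<exists>e'. P (override_on e e' V))"
  using assms
proof (induction V arbitrary: P rule: finite_induct)
  case empty
  then show ?case by simp
next
  case (insert v V)
  have "definable (\<lambda>e. \<exists>e'. \<exists>t. P ((override_on e e' V)(v := t)))"
    by (rule insert.IH[OF definable_ex_upd[OF insert.prems]])
  moreover have "(\<exists>e'. \<exists>t. P ((override_on e e' V)(v := t))) = (\<exists>e'. P (override_on e e' (insert v V)))" for e
  proof -
    have "(override_on e e' V)(v := t) = override_on e (e'(v := t)) (insert v V)" for e' t
      using insert.hyps by (auto simp: override_on_def)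
    moreover have "override_on e e' (insert v V) = (override_on e e' V)(v := e' v)" for e'
      by (auto simp: override_on_def)
    ultimately show ?thesis by metis
  qed
  ultimately show ?case by simp
qed

text \<open>Strong minimality of the complex field: one polynomial in \<open>t\<close> has finitely
  many zeros or vanishes everywhere, and the dichotomy survives Boolean operations.\<close>

lemma definable_finite_or_cofinite:
  assumes "definable P"
  shows "finite {t. P (e(v := t))} \<or> finite {t. \<not> P (e(v := t))}"
  using assms
proof (induction rule: definable.induct)
  case (zero f)
  show ?case
  proof (cases "\<exists>t. f (e(v := t)) \<noteq> 0")
    case True
    then show ?thesis using polyfun_finite_zeros[OF _ zero] by blast
  next
    case False
    then have "{t. f (e(v := t)) \<noteq> 0} = {}" by blast
    then show ?thesis by (metis finite.emptyI)
  qed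
next
  case (conj P Q)
  have "{t. P (e(v := t)) \<and> Q (e(v := t))} \<subseteq> {t. P (e(v := t))}"
    "{t. P (e(v := t)) \<and> Q (e(v := t))} \<subseteq> {t. Q (e(v := t))}"
    "{t. \<not> (P (e(v := t)) \<and> Q (e(v := t)))} = {t. \<not> P (e(v := t))} \<union> {t. \<not> Q (e(v := t))}"
    by auto
  then show ?case using conj.IH by (metis finite_Un finite_subset)
qed auto

section \<open>Generic points\<close>

text \<open>Algebraic independence over \<open>\<rat>\<close> in terms of functions: a rational
  polynomial function that vanishes at \<open>x\<close> is the zero function.\<close>

definition generic_on :: "'v set \<Rightarrow> ('v \<Rightarrow> complex) \<Rightarrow> bool" where
  "generic_on S x \<longleftrightarrow> (\<forall>f\<in>polyfun \<rat> S. f x = 0 \<longrightarrow> (\<forall>y. f y = 0))"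

lemma generic_onD:
  "generic_on S x \<Longrightarrow> f \<in> polyfun \<rat> S \<Longrightarrow> f x = 0 \<Longrightarrow> f y = 0"
  unfolding generic_on_def by blast

text \<open>Syntax whose only purpose is to show that there are countably many rational polynomial
  functions in countably many variables.\<close>

datatype pexpr = PConst nat | PVar nat | PAdd pexpr pexpr | PMul pexpr pexpr

instance pexpr :: countable
  by countable_datatype

primrec pexpr_fun :: "complex set \<Rightarrow> 'v set \<Rightarrow> pexpr \<Rightarrow> ('v \<Rightarrow> complex) \<Rightarrow> complex" where
  "pexpr_fun K S (PConst i) = (\<lambda>e. from_nat_into K i)"
| "pexpr_fun K S (PVar i) = (\<lambda>e. e (from_nat_into S i))"
| "pexpr_fun K S (PAdd p q) = (\<lambda>e. pexpr_fun K S p e + pexpr_fun K S q e)"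
| "pexpr_fun K S (PMul p q) = (\<lambda>e. pexpr_fun K S p e * pexpr_fun K S q e)"

lemma countable_polyfun:
  assumes "countable K" "countable S"
  shows "countable (polyfun K S)"
proof -
  have "\<exists>p. f = pexpr_fun K S p" if "f \<in> polyfun K S" for f
    using that
  proof induction
    case (const c)
    then obtain i where "from_nat_into K i = c" using from_nat_into_surj[OF assms(1)] by blast
    then show ?case by (intro exI[of _ "PConst i"]) simp
  next
    case (var v)
    then obtain i where "from_nat_into S i = v" using from_nat_into_surj[OF assms(2)] by blast
    then show ?case by (intro exI[of _ "PVar i"]) simp
  qed (metis pexpr_fun.simps(3), metis pexpr_fun.simps(4))
  then have "polyfun K S \<subseteq> range (pexpr_fun K S)" by blast
  then show ?thesis by (rule countable_subset) simp
qed

lemma exists_notin_countable_Un_finite: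
  fixes C :: "complex set"
  assumes "countable C" "finite D"
  shows "\<exists>t. t \<notin> C \<and> t \<notin> D"
proof -
  have "countable (C \<union> D)" using assms countable_finite by simp
  then show ?thesis using uncountable_UNIV_complex by (metis UNIV_eq_I Un_iff)
qed

text \<open>The coordinates are chosen one after the other, each avoiding countably many finite sets
  of zeros. The coefficients are arbitrary because the values already chosen become
  coefficients.\<close>

lemma exists_common_nonzero:
  assumes "finite S" "countable \<F>" "\<And>f. f \<in> \<F> \<Longrightarrow> f \<in> polyfun UNIV S \<and> (\<exists>e. f e \<noteq> 0)"
  shows "\<exists>e. \<forall>f\<in>\<F>. f e \<noteq> 0"
  using assms
proof (induction S arbitrary: \<F> rule: finite_induct)
  case empty
  have "f e = f e'" if "f \<in> \<F>" for f e e'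
    using polyfun_cong[of f UNIV "{}"] empty.prems(2) that by blast
  then show ?case using empty.prems(2) by (metis (full_types))
next
  case (insert v S)
  obtain w where w: "\<And>f. f \<in> \<F> \<Longrightarrow> f (w f) \<noteq> 0" using insert.prems(2) by metis
  have "finite {t. f ((w f)(v := t)) = 0}" if "f \<in> \<F>" for f
    using polyfun_finite_zeros[of UNIV f "insert v S" "w f" v "w f v"] w insert.prems(2) that by auto
  then have "countable (\<Union>f\<in>\<F>. {t. f ((w f)(v := t)) = 0})"
    using insert.prems(1) by (auto intro: countable_finite)
  then obtain t where t: "t \<notin> (\<Union>f\<in>\<F>. {t. f ((w f)(v := t)) = 0})"
    using exists_notin_countable_Un_finite[of _ "{}"] by blast
  have "\<exists>e. \<forall>f\<in>(\<lambda>f e. f (e(v := t))) ` \<F>. f e \<noteq> 0"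
  proof (rule insert.IH)
    show "countable ((\<lambda>f e. f (e(v := t))) ` \<F>)" using insert.prems(1) by simp
    fix g assume "g \<in> (\<lambda>f e. f (e(v := t))) ` \<F>"
    then obtain f where f: "f \<in> \<F>" "g = (\<lambda>e. f (e(v := t)))" by blast
    have "g \<in> polyfun UNIV S" unfolding f(2)
    proof (rule polyfun_compose[where \<Phi> = "\<lambda>e. e(v := t)" and S = "insert v S"])
      show "f \<in> polyfun UNIV (insert v S)" using insert.prems(2)[OF f(1)] by blast
      show "(\<lambda>e. (e(v := t)) w) \<in> polyfun UNIV S" if "w \<in> insert v S" for w
        using that by (cases "w = v") (auto intro: polyfun.intros)
    qed
    then show "g \<in> polyfun UNIV S \<and> (\<exists>e. g e \<noteq> 0)" using t f by auto
  qed
  then show ?case by auto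
qed

lemma exists_generic_on:
  assumes "finite S"
  shows "\<exists>x. generic_on S x"
proof -
  have "\<exists>x. \<forall>f\<in>{f \<in> polyfun \<rat> S. \<exists>e. f e \<noteq> 0}. f x \<noteq> 0"
    using assms countable_rat
    by (intro exists_common_nonzero[of S])
      (auto intro: polyfun_mono countable_subset[OF _ countable_polyfun[of \<rat> S]] countable_finite)
  then show ?thesis unfolding generic_on_def by blast
qed

text \<open>\<open>P\<close> holds for all but finitely many \<open>t\<close>, whereas being
  algebraic over the given coordinates excludes only countably many.\<close>

lemma generic_on_extend:
  assumes "generic_on S x" "v \<notin> S" "countable S" "infinite {t. P t}"
    "finite {t. P t} \<or> finite {t. \<not> P t}"
  shows "\<exists>t. P t \<and> generic_on (insert v S) (x(v := t))"
proof -
  define \<F> where "\<F> = {f \<in> polyfun \<rat> (insert v S). \<exists>t. f (x(v := t)) \<noteq> 0}"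
  have "countable \<F>"
    using assms(3) countable_rat
    by (auto simp: \<F>_def intro: countable_subset[OF _ countable_polyfun[of \<rat> "insert v S"]])
  moreover have "finite {t. f (x(v := t)) = 0}" if "f \<in> \<F>" for f
    using that polyfun_finite_zeros[of \<rat> f] unfolding \<F>_def by blast
  ultimately have "countable (\<Union>f\<in>\<F>. {t. f (x(v := t)) = 0})"
    by (auto intro: countable_finite)
  then obtain t where t: "t \<notin> (\<Union>f\<in>\<F>. {t. f (x(v := t)) = 0})" "t \<notin> {t. \<not> P t}"
    using exists_notin_countable_Un_finite assms(4,5) by blast
  have "f y = 0" if f: "f \<in> polyfun \<rat> (insert v S)" "f (x(v := t)) = 0" for f y
  proof -
    obtain n F where F: "F \<in> upoly \<rat> (insert v S - {v}) n" "\<forall>e t. f (e(v := t)) = poly (F e) t"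
      using polyfun_upoly[OF _ f(1), of v] by blast
    \<comment> \<open>Otherwise \<open>f\<close> would belong to \<F>, whose zeros on this line
      \<open>t\<close> avoids. Thus all coefficients with respect to \<open>v\<close> vanish at
      \<open>x\<close>, and by genericity identically.\<close>
    have "\<forall>t. f (x(v := t)) = 0" using t(1) f unfolding \<F>_def by blast
    then have "\<forall>t. poly (F x) t = 0" using F(2) by simp
    then have "F x = 0" using poly_all_0_iff_0 by blast
    moreover have "(\<lambda>e. coeff (F e) i) \<in> polyfun \<rat> S" for i
      using upoly_coeff[OF F(1)] assms(2) by simp
    ultimately have "coeff (F y) i = 0" for i
      using generic_onD[OF assms(1)] by (metis coeff_0)
    then have "F y = 0" by (simp add: poly_eqI)
    then show ?thesis using F(2)[rule_format, of y "y v"] by simp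
  qed
  then show ?thesis using t(2) unfolding generic_on_def by blast
qed

text \<open>At a generic point a rational equation either is an identity or fails on an open set, so
  the truth value of every Boolean combination is locally constant. Points are taken to be 0 outside
  \<open>S\<close> because \<open>P\<close> may formally refer to auxiliary variables there.\<close>

lemma generic_definable_nbhd:
  assumes "definable P" "generic_on S x" "\<And>v. v \<notin> S \<Longrightarrow> x v = 0"
  shows "\<exists>q\<in>polyfun \<rat> S. q x \<noteq> 0 \<and> (\<forall>y. (\<forall>v. v \<notin> S \<longrightarrow> y v = 0) \<longrightarrow> q y \<noteq> 0 \<longrightarrow> P y = P x)"
  using assms(1)
proof (induction rule: definable.induct)
  case (zero f)
  \<comment> \<open>Substituting 0 for the variables outside \<open>S\<close> brings
    \<open>f\<close> into the class that genericity speaks about.\<close>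
  define g where "g = (\<lambda>e. f (\<lambda>v. if v \<in> S then e v else 0))"
  have g: "g \<in> polyfun \<rat> S" unfolding g_def
    using zero
  proof (rule polyfun_compose[where \<Phi> = "\<lambda>e v. if v \<in> S then e v else 0"])
    fix v show "(\<lambda>e. if v \<in> S then e v else 0) \<in> polyfun \<rat> S"
      by (cases "v \<in> S") (auto intro: polyfun.intros)
  qed
  have eq: "g y = f y" if "\<forall>v. v \<notin> S \<longrightarrow> y v = 0" for y
    unfolding g_def using that by (intro arg_cong[where f = f]) auto
  have gx: "g x = f x" using eq assms(3) by blast
  show ?case
  proof (cases "f x = 0")
    case True
    then have "g y = 0" for y using generic_onD[OF assms(2) g] gx by simp
    then have "f y = 0" if "\<forall>v. v \<notin> S \<longrightarrow> y v = 0" for y using eq[OF that] by simp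
    then show ?thesis using True polyfun_rat[of \<rat> 1] by (intro bexI[of _ "\<lambda>_. 1"]) auto
  next
    case False
    have "f y \<noteq> 0" if "\<forall>v. v \<notin> S \<longrightarrow> y v = 0" "g y \<noteq> 0" for y using eq that by simp
    then show ?thesis using False g gx by (intro bexI[of _ g]) auto
  qed
next
  case (neg P)
  then show ?case by simp
next
  case (conj P Q)
  then obtain p q where pq: "p \<in> polyfun \<rat> S" "q \<in> polyfun \<rat> S" "p x \<noteq> 0" "q x \<noteq> 0"
    and p: "\<forall>y. (\<forall>v. v \<notin> S \<longrightarrow> y v = 0) \<longrightarrow> p y \<noteq> 0 \<longrightarrow> P y = P x"
    and q: "\<forall>y. (\<forall>v. v \<notin> S \<longrightarrow> y v = 0) \<longrightarrow> q y \<noteq> 0 \<longrightarrow> Q y = Q x" by blast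
  have "p y \<noteq> 0 \<and> q y \<noteq> 0" if "p y * q y \<noteq> 0" for y using that by simp
  then show ?case using p q pq(3,4)
    by (intro bexI[OF _ polyfun.mult[OF pq(1,2)]] conjI allI impI) (simp, blast)
qed

text \<open>Each coordinate in \<open>V\<close> can be made rational, since only finitely many of
  its values are zeros. The coefficients may be irrational; this is used while irrational weights
  are still held fixed.\<close>

lemma polyfun_rational_nonzero:
  assumes "finite V" "\<rat> \<subseteq> K" "f \<in> polyfun K S" "f e \<noteq> 0"
  shows "\<exists>e'. f e' \<noteq> 0 \<and> (\<forall>v\<in>V. e' v \<in> \<rat>) \<and> (\<forall>v. v \<notin> V \<longrightarrow> e' v = e v)"
  using assms(1)
proof (induction V rule: finite_induct)
  case empty
  then show ?case using assms by auto
next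
  case (insert v V)
  then obtain e' where e': "f e' \<noteq> 0" "\<forall>v\<in>V. e' v \<in> \<rat>" "\<forall>v. v \<notin> V \<longrightarrow> e' v = e v" by blast
  have "finite {t. f (e'(v := t)) = 0}"
    using polyfun_finite_zeros[OF assms(2,3), of e' v "e' v"] e'(1) by simp
  moreover have "infinite (\<rat> :: complex set)"
    by (metis Nats_infinite Nats_subset_Rats finite_subset)
  ultimately obtain t where "t \<in> \<rat>" "f (e'(v := t)) \<noteq> 0"
    by (metis (mono_tags, lifting) finite_subset mem_Collect_eq subsetI)
  moreover have "\<forall>w\<in>insert v V. (e'(v := t)) w \<in> \<rat>" "\<forall>w. w \<notin> insert v V \<longrightarrow> (e'(v := t)) w = e w"
    using e' \<open>t \<in> \<rat>\<close> by auto
  ultimately show ?case by blast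
qed

section \<open>Counting parameters\<close>

text \<open>The subring generated by \<open>A\<close> over the rationals. It is a ring and not a
  field, which keeps the dimension estimate below to bounded exponents.\<close>

inductive_set ratring :: "complex set \<Rightarrow> complex set" for A where
  rat: "c \<in> \<rat> \<Longrightarrow> c \<in> ratring A"
| gen: "a \<in> A \<Longrightarrow> a \<in> ratring A"
| add: "x \<in> ratring A \<Longrightarrow> y \<in> ratring A \<Longrightarrow> x + y \<in> ratring A"
| mult: "x \<in> ratring A \<Longrightarrow> y \<in> ratring A \<Longrightarrow> x * y \<in> ratring A"

lemma ratring_sum: "(\<And>i. i \<in> I \<Longrightarrow> f i \<in> ratring A) \<Longrightarrow> sum f I \<in> ratring A"
  by (induction I rule: infinite_finite_induct) (auto intro: ratring.intros)

lemma ratring_diff: "x \<in> ratring A \<Longrightarrow> y \<in> ratring A \<Longrightarrow> x - y \<in> ratring A"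
  using ratring.add[of x A "-1 * y"] ratring.mult[OF ratring.rat[of "-1"], of y A] by simp

lemma ratring_matrix_mult:
  assumes "\<And>r c. A $ r $ c \<in> ratring X" "\<And>r c. B $ r $ c \<in> ratring X"
  shows "((A :: 'n::finite cmat) ** B) $ r $ c \<in> ratring X"
  unfolding matrix_matrix_mult_def using assms by (auto intro!: ratring_sum ratring.mult)

section \<open>Rational linear algebra in the complex numbers and a bound on transcendence
  degree\<close>

interpretation ratvs: vector_space "\<lambda>(q::rat) (z::complex). of_rat q * z"
  by unfold_locales (auto simp: algebra_simps of_rat_add of_rat_mult)

lemma ratvs_span_mult:
  assumes "z \<in> ratvs.span X" "w \<in> ratvs.span Y"
    and "\<And>x y. x \<in> X \<Longrightarrow> y \<in> Y \<Longrightarrow> x * y \<in> ratvs.span Z"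
  shows "z * w \<in> ratvs.span Z"
proof -
  have 1: "x * w \<in> ratvs.span Z" if "x \<in> X" for x
    using assms(2)
  proof (rule ratvs.span_induct)
    show "ratvs.subspace {w. x * w \<in> ratvs.span Z}"
      unfolding ratvs.subspace_def mem_Collect_eq distrib_left mult.left_commute[of x]
      by (simp add: ratvs.span_zero ratvs.span_add ratvs.span_scale)
  qed (use assms(3) that in auto)
  show ?thesis
    using assms(1)
  proof (rule ratvs.span_induct)
    show "ratvs.subspace {z. z * w \<in> ratvs.span Z}"
      unfolding ratvs.subspace_def mem_Collect_eq distrib_right mult.assoc
      by (simp add: ratvs.span_zero ratvs.span_add ratvs.span_scale)
  qed (use 1 in auto)
qed

text \<open>Dependence of a family rather than of a set: a repeated value counts as a relation,
  which matters because distinct exponents could give equal monomial values.\<close>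

lemma ratvs_dependent_family:
  assumes "finite I" "finite B" "card B < card I" "\<And>i. i \<in> I \<Longrightarrow> y i \<in> ratvs.span B"
  shows "\<exists>r. (\<exists>i\<in>I. r i \<noteq> 0) \<and> (\<Sum>i\<in>I. of_rat (r i) * y i) = 0"
proof (cases "inj_on y I")
  case True
  have "ratvs.dependent (y ` I)"
    using ratvs.independent_span_bound[of B "y ` I"] assms card_image[OF True] by force
  then obtain u where u: "\<exists>v\<in>y ` I. u v \<noteq> 0" "(\<Sum>v\<in>y ` I. of_rat (u v) * v) = 0"
    using ratvs.dependent_finite assms(1) by auto
  then show ?thesis
    using sum.reindex[OF True, of "\<lambda>v. of_rat (u v) * v"] by (intro exI[of _ "u \<circ> y"]) auto
next
  case False
  then obtain i j where ij: "i \<in> I" "j \<in> I" "i \<noteq> j" "y i = y j" unfolding inj_on_def by blast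
  define r :: "'a \<Rightarrow> rat" where "r = (\<lambda>k. if k = i then 1 else if k = j then -1 else 0)"
  have "(\<Sum>k\<in>I. of_rat (r k) * y k) = (\<Sum>k\<in>{i, j}. of_rat (r k) * y k)"
    using assms(1) ij by (intro sum.mono_neutral_right) (auto simp: r_def)
  also have "\<dots> = 0" using ij by (simp add: r_def)
  finally show ?thesis using ij(1) by (intro exI[of _ r]) (auto simp: r_def)
qed

text \<open>Each exponent is bounded separately by \<open>d\<close>; this gives at most
  \<open>(d + 1) ^ card A\<close> values.\<close>

definition monomials :: "complex set \<Rightarrow> nat \<Rightarrow> complex set" where
  "monomials A d = (\<lambda>b. \<Prod>a\<in>A. a ^ b a) ` (A \<rightarrow>\<^sub>E {..d})"

lemma monomialsI: "x = (\<Prod>a\<in>A. a ^ b a) \<Longrightarrow> b \<in> A \<rightarrow>\<^sub>E {..d} \<Longrightarrow> x \<in> monomials A d"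
  unfolding monomials_def by simp

lemma monomials_mono: "d \<le> e \<Longrightarrow> monomials A d \<subseteq> monomials A e"
  unfolding monomials_def by (intro image_mono PiE_mono) auto

lemma monomials_mult:
  assumes "x \<in> monomials A d" "y \<in> monomials A e"
  shows "x * y \<in> monomials A (d + e)"
proof -
  obtain b c where b: "b \<in> A \<rightarrow>\<^sub>E {..d}" "x = (\<Prod>a\<in>A. a ^ b a)"
    and c: "c \<in> A \<rightarrow>\<^sub>E {..e}" "y = (\<Prod>a\<in>A. a ^ c a)"
    using assms unfolding monomials_def by blast
  have "x * y = (\<Prod>a\<in>A. a ^ (restrict (\<lambda>a. b a + c a) A) a)"
    unfolding b c prod.distrib[symmetric] by (intro prod.cong) (auto simp: power_add)
  moreover have "restrict (\<lambda>a. b a + c a) A \<in> A \<rightarrow>\<^sub>E {..d + e}"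
    using b(1) c(1) by (auto simp: PiE_iff intro: add_mono)
  ultimately show ?thesis by (rule monomialsI)
qed

lemma one_in_monomials: "1 \<in> monomials A d"
proof -
  have "1 = (\<Prod>a\<in>A. a ^ (restrict (\<lambda>_. 0) A) a)" by (simp cong: prod.cong)
  moreover have "restrict (\<lambda>_. 0) A \<in> A \<rightarrow>\<^sub>E {..d}" by auto
  ultimately show ?thesis by (rule monomialsI)
qed

lemma finite_monomials: "finite A \<Longrightarrow> finite (monomials A d)"
  unfolding monomials_def by (simp add: finite_PiE)

lemma card_monomials: "finite A \<Longrightarrow> card (monomials A d) \<le> (d + 1) ^ card A"
  unfolding monomials_def
  by (rule order_trans[OF card_image_le]) (simp_all add: card_PiE finite_PiE)

lemma span_monomials_mult:
  "z \<in> ratvs.span (monomials A d) \<Longrightarrow> w \<in> ratvs.span (monomials A e) \<Longrightarrow>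
    z * w \<in> ratvs.span (monomials A (d + e))"
  by (rule ratvs_span_mult) (auto intro: ratvs.span_base monomials_mult)

lemma span_monomials_mono: "d \<le> e \<Longrightarrow> ratvs.span (monomials A d) \<subseteq> ratvs.span (monomials A e)"
  by (intro ratvs.span_mono monomials_mono)

lemma span_monomials_power:
  "z \<in> ratvs.span (monomials A d) \<Longrightarrow> z ^ k \<in> ratvs.span (monomials A (d * k))"
  by (induction k) (auto intro: ratvs.span_base one_in_monomials span_monomials_mult)

lemma span_monomials_prod:
  assumes "finite S" "\<And>v. v \<in> S \<Longrightarrow> f v \<in> ratvs.span (monomials A d)"
  shows "prod f S \<in> ratvs.span (monomials A (d * card S))"
  using assms
  by (induction S rule: finite_induct)
    (auto intro: ratvs.span_base one_in_monomials span_monomials_mult)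

lemma ratring_span_monomials:
  assumes "finite A" "z \<in> ratring A"
  shows "\<exists>d. z \<in> ratvs.span (monomials A d)"
  using assms(2)
proof induction
  case (rat c)
  then obtain q where "c = of_rat q" by (auto elim: Rats_cases)
  then have "c = of_rat q * 1" by simp
  then show ?case using ratvs.span_scale[OF ratvs.span_base[OF one_in_monomials]] by metis
next
  case (gen a)
  have "(\<Prod>x\<in>A. x ^ (restrict (\<lambda>x. if x = a then 1 else 0) A) x) = (\<Prod>x\<in>A. if x = a then x else 1)"
    by (intro prod.cong) auto
  also have "\<dots> = a" using gen assms(1) by simp
  finally have "a = (\<Prod>x\<in>A. x ^ (restrict (\<lambda>x. if x = a then 1 else 0) A) x)" ..
  then have "a \<in> monomials A 1"
    by (rule monomialsI) (auto simp: PiE_iff extensional_def)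
  then show ?case using ratvs.span_base by blast
next
  case (add x y)
  then obtain d e where "x \<in> ratvs.span (monomials A d)" "y \<in> ratvs.span (monomials A e)" by blast
  then have "x \<in> ratvs.span (monomials A (max d e))" "y \<in> ratvs.span (monomials A (max d e))"
    using span_monomials_mono[of d "max d e" A] span_monomials_mono[of e "max d e" A] by auto
  then show ?case using ratvs.span_add by blast
next
  case (mult x y)
  then show ?case using span_monomials_mult by blast
qed

text \<open>With all variables but one fixed, the sum is a polynomial in the last variable that
  vanishes everywhere. Its coefficients are sums of the same kind in fewer variables.\<close>

lemma monomial_functions_independent:
  fixes r :: "('v \<Rightarrow> nat) \<Rightarrow> complex"
  assumes "finite S" "\<And>y. (\<Sum>a\<in>S \<rightarrow>\<^sub>E {..<k}. r a * (\<Prod>v\<in>S. y v ^ a v)) = 0"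
    and "a \<in> S \<rightarrow>\<^sub>E {..<k}"
  shows "r a = 0"
  using assms
proof (induction S arbitrary: r a rule: finite_induct)
  case empty
  then show ?case by simp
next
  case (insert v S)
  have fin: "finite (S \<rightarrow>\<^sub>E {..<k})" using insert.hyps by (simp add: finite_PiE)
  have coef: "(\<Sum>g\<in>S \<rightarrow>\<^sub>E {..<k}. r (g(v := i)) * (\<Prod>w\<in>S. y w ^ g w)) = 0" if "i < k" for i y
  proof -
    define c where "c = (\<lambda>i. \<Sum>g\<in>S \<rightarrow>\<^sub>E {..<k}. r (g(v := i)) * (\<Prod>w\<in>S. y w ^ g w))"
    define p where "p = (\<Sum>i<k. monom (c i) i)"
    have "poly p t = 0" for t
    proof -
      have mono: "(\<Prod>w\<in>insert v S. (y(v := t)) w ^ (g(v := i)) w) = t ^ i * (\<Prod>w\<in>S. y w ^ g w)" for g i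
      proof -
        have "(\<Prod>w\<in>S. (y(v := t)) w ^ (g(v := i)) w) = (\<Prod>w\<in>S. y w ^ g w)"
          using insert.hyps by (intro prod.cong) auto
        then show ?thesis using insert.hyps by simp
      qed
      have "0 = (\<Sum>a\<in>insert v S \<rightarrow>\<^sub>E {..<k}. r a * (\<Prod>w\<in>insert v S. (y(v := t)) w ^ a w))"
        using insert.prems(1)[of "y(v := t)"] by simp
      also have "\<dots> = (\<Sum>(i, g)\<in>{..<k} \<times> (S \<rightarrow>\<^sub>E {..<k}).
          r (g(v := i)) * (\<Prod>w\<in>insert v S. (y(v := t)) w ^ (g(v := i)) w))"
        unfolding PiE_insert_eq using inj_combinator[OF insert.hyps(2), of "\<lambda>_. {..<k}"]
        by (subst sum.reindex) (auto intro!: sum.cong)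
      also have "\<dots> = (\<Sum>(i, g)\<in>{..<k} \<times> (S \<rightarrow>\<^sub>E {..<k}).
          r (g(v := i)) * (t ^ i * (\<Prod>w\<in>S. y w ^ g w)))"
        unfolding mono ..
      also have "\<dots> = (\<Sum>i<k. c i * t ^ i)"
        unfolding c_def sum_distrib_right by (simp add: sum.cartesian_product mult_ac)
      also have "\<dots> = poly p t" by (simp add: p_def poly_sum poly_monom)
      finally show ?thesis by simp
    qed
    then have "p = 0" using poly_all_0_iff_0 by blast
    then have "coeff p i = 0" by simp
    then show ?thesis using that by (simp add: p_def coeff_sum c_def)
  qed
  obtain i g where g: "i < k" "g \<in> S \<rightarrow>\<^sub>E {..<k}" "a = g(v := i)"
    using insert.prems(2) unfolding PiE_insert_eq by auto
  show ?case unfolding g(3)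
    by (rule insert.IH[of "\<lambda>g. r (g(v := i))", OF coef[OF g(1)] g(2)])
qed

text \<open>The transcendence degree of a finitely generated ring, bounded by growth: there are
  \<open>k ^ card S\<close> monomials in the coordinates with exponents below \<open>k\<close>, and
  they lie in a space whose dimension is at most a constant times \<open>k ^ card A\<close>. For
  large \<open>k\<close> a larger \<open>card S\<close> would force a rational relation.\<close>

lemma generic_on_card_le:
  assumes "finite S" "generic_on S x" "finite A" "\<And>v. v \<in> S \<Longrightarrow> x v \<in> ratring A"
  shows "card S \<le> card A"
proof (rule ccontr)
  assume "\<not> card S \<le> card A"
  then have less: "card A < card S" by simp
  have "\<forall>v\<in>S. \<exists>d. x v \<in> ratvs.span (monomials A d)"
    using assms(3,4) ratring_span_monomials by blast
  then obtain D where D: "\<And>v. v \<in> S \<Longrightarrow> x v \<in> ratvs.span (monomials A (D v))" by metis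
  define d where "d = Max (D ` S)"
  have d: "x v \<in> ratvs.span (monomials A d)" if "v \<in> S" for v
    using D[OF that] span_monomials_mono[of "D v" d A] that assms(1) by (auto simp: d_def)
  \<comment> \<open>The constant of the growth estimate: the number of monomials in \<open>A\<close>
    that are needed is at most \<open>c * k ^ card A\<close>. Then \<open>k = c + 1\<close> is large
    enough.\<close>
  define c where "c = (d * card S + 1) ^ card A"
  define k where "k = c + 1"
  define I where "I = S \<rightarrow>\<^sub>E {..<k}"
  define y where "y = (\<lambda>a. \<Prod>v\<in>S. x v ^ a v)"
  have I: "finite I" "card I = k ^ card S"
    using assms(1) by (simp_all add: I_def card_PiE finite_PiE)
  have "y a \<in> ratvs.span (monomials A (d * k * card S))" if "a \<in> I" for a
    unfolding y_def
  proof (rule span_monomials_prod[OF assms(1)])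
    fix v assume v: "v \<in> S"
    then have "d * a v \<le> d * k" using that by (auto simp: I_def PiE_iff intro: less_imp_le)
    then show "x v ^ a v \<in> ratvs.span (monomials A (d * k))"
      using span_monomials_power[OF d[OF v]] span_monomials_mono by blast
  qed
  moreover have "card (monomials A (d * k * card S)) < card I"
  proof -
    have "card (monomials A (d * k * card S)) \<le> (d * k * card S + 1) ^ card A"
      by (rule card_monomials[OF assms(3)])
    also have "\<dots> \<le> ((d * card S + 1) * k) ^ card A"
      by (intro power_mono) (auto simp: k_def algebra_simps)
    also have "\<dots> = c * k ^ card A" unfolding c_def power_mult_distrib ..
    also have "\<dots> < k * k ^ card A" by (simp add: k_def)
    also have "\<dots> = k ^ Suc (card A)" by simp
    also have "\<dots> \<le> k ^ card S" using less by (intro power_increasing) (auto simp: k_def)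
    finally show ?thesis using I(2) by simp
  qed
  ultimately obtain r :: "('a \<Rightarrow> nat) \<Rightarrow> rat"
    where r: "\<exists>a\<in>I. r a \<noteq> 0" "(\<Sum>a\<in>I. of_rat (r a) * y a) = 0"
    using ratvs_dependent_family[OF I(1) finite_monomials[OF assms(3)]] by blast
  define f where "f = (\<lambda>e :: 'a \<Rightarrow> complex. \<Sum>a\<in>I. of_rat (r a) * (\<Prod>v\<in>S. e v ^ a v))"
  have "f \<in> polyfun \<rat> S"
    unfolding f_def by (intro polyfun_sum polyfun.mult polyfun_prod polyfun_power polyfun_rat polyfun.var) auto
  moreover have "f x = 0" using r(2) by (simp add: f_def y_def)
  ultimately have "f e = 0" for e using generic_onD[OF assms(2)] by blast
  then have "of_rat (r a) = (0 :: complex)" if "a \<in> I" for a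
    using monomial_functions_independent[OF assms(1), where k = k and r = "\<lambda>a. of_rat (r a)" and a = a] that
    by (simp add: f_def I_def)
  then show False using r(1) by simp
qed

section \<open>Flags and matrices\<close>

lemma pos_less_iff [simp]: "pos a < pos b \<longleftrightarrow> a < (b :: 'n::{finite,linorder})"
proof
  show "a < b" if "pos a < pos b"
  proof (rule ccontr)
    assume "\<not> a < b"
    then have "{..b} \<subseteq> {..a}" by auto
    then show False using that card_mono[of "{..a}" "{..b}"] by (simp add: pos_def)
  qed
  show "pos a < pos b" if "a < b"
    unfolding pos_def using that by (intro psubset_card_mono) (auto simp: psubset_eq)
qed

lemma pos_le_iff [simp]: "pos a \<le> pos b \<longleftrightarrow> a \<le> (b :: 'n::{finite,linorder})"
  using pos_less_iff[of b a] by (simp add: not_less[symmetric] del: pos_less_iff)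

lemma pos_eq_iff [simp]: "pos a = pos b \<longleftrightarrow> a = (b :: 'n::{finite,linorder})"
  by (auto simp: order_eq_iff)

lemma pos_ge_1: "1 \<le> pos (a :: 'n::{finite,linorder})"
  unfolding pos_def by (simp add: Suc_le_eq card_gt_0_iff)

lemma pos_le_card: "pos (a :: 'n::{finite,linorder}) \<le> CARD('n)"
  unfolding pos_def by (intro card_mono) auto

lemma range_pos: "range (pos :: 'n::{finite,linorder} \<Rightarrow> nat) = {1..CARD('n)}"
proof (rule card_subset_eq)
  show "range (pos :: 'n \<Rightarrow> nat) \<subseteq> {1..CARD('n)}"
    using pos_ge_1 pos_le_card by auto
  show "card (range (pos :: 'n \<Rightarrow> nat)) = card {1..CARD('n)}"
    by (subst card_image) (auto simp: inj_on_def)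
qed simp

lemma pos_surj: "1 \<le> i \<Longrightarrow> i \<le> CARD('n) \<Longrightarrow> \<exists>a :: 'n::{finite,linorder}. pos a = i"
  using range_pos[where 'n = 'n] by (metis atLeastAtMost_iff imageE)

lemma card_pos_le: "card {c :: 'n::{finite,linorder}. pos c \<le> j} = min j CARD('n)"
proof -
  have "pos ` {c :: 'n. pos c \<le> j} = {1..min j CARD('n)}"
    using range_pos[where 'n = 'n] pos_ge_1[where 'n = 'n] pos_le_card[where 'n = 'n]
    by (auto simp: image_iff) (metis atLeastAtMost_iff rangeE)
  moreover have "card (pos ` {c :: 'n. pos c \<le> j}) = card {c :: 'n. pos c \<le> j}"
    by (intro card_image) (auto simp: inj_on_def)
  ultimately show ?thesis by simp
qed

text \<open>The flag of coordinate subspaces, given by equations. Every \<open>matrix_flag g\<close>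
  is its image under \<open>g\<close>, so relative positions can be computed in coordinates.\<close>

definition std_flag :: "'n::{finite,linorder} flag" where
  "std_flag j = {a. \<forall>c. j < pos c \<longrightarrow> a $ c = 0}"

lemma subspace_std_flag: "vec.subspace (std_flag j)"
  by (auto simp: std_flag_def vec.subspace_def)

lemma std_flag_pred_iff:
  assumes "a \<in> std_flag (pos c)"
  shows "a \<in> std_flag (pos c - 1) \<longleftrightarrow> a $ c = 0"
proof -
  have "pos c - 1 < pos d \<longleftrightarrow> pos d = pos c \<or> pos c < pos d" for d
    using pos_ge_1[of c] by linarith
  then show ?thesis using assms by (auto simp: std_flag_def simp del: pos_less_iff)
qed

lemma dim_std_flag: "vec.dim (std_flag j :: 'n::{finite,linorder} cvec set) = min j CARD('n)"
proof -
  have "std_flag j = {a :: 'n cvec. \<forall>c. c \<notin> {c. pos c \<le> j} \<longrightarrow> a $ c = 0}"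
    by (auto simp: std_flag_def not_le)
  then show ?thesis using dim_substandard_cart[of "{c :: 'n. pos c \<le> j}"] by (simp add: card_pos_le)
qed

lemma linear_matrix: "Vector_Spaces.linear (*s) (*s) ((*v) (A :: 'n::finite cmat))"
  by (rule matrix_vector_mul_linear_gen)

lemma column_eq_mult: "column c (A :: 'n::finite cmat) = A *v axis c 1"
  by (simp add: column_def matrix_vector_mult_def axis_def vec_eq_iff if_distrib[of "(*) _"] cong: if_cong)

lemma column_mult: "column c (A ** B) = A *v column c B" for A B :: "'n::finite cmat"
  unfolding column_eq_mult matrix_vector_mul_assoc ..

lemma matrix_eqI: "(\<And>c. column c A = column c B) \<Longrightarrow> A = B"
  by (simp add: column_def vec_eq_iff)

lemma subspace_matrix_flag: "vec.subspace (matrix_flag g j)"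
  by (simp add: matrix_flag_def)

lemma matrix_flag_eq: "matrix_flag g j = (*v) g ` std_flag j"
proof (rule antisym)
  show "matrix_flag g j \<subseteq> (*v) g ` std_flag j"
    unfolding matrix_flag_def
  proof (rule vec.span_minimal)
    show "{column c g |c. pos c \<le> j} \<subseteq> (*v) g ` std_flag j"
      unfolding column_eq_mult by (auto simp: std_flag_def axis_def)
    show "vec.subspace ((*v) g ` std_flag j)"
      by (rule vec.linear_subspace_image[OF linear_matrix subspace_std_flag])
  qed
  show "(*v) g ` std_flag j \<subseteq> matrix_flag g j"
  proof clarify
    fix a :: "'a cvec" assume a: "a \<in> std_flag j"
    have "a $ c *s column c g \<in> matrix_flag g j" for c
    proof (cases "pos c \<le> j")
      case True
      then show ?thesis unfolding matrix_flag_def by (intro vec.span_scale vec.span_base) auto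
    next
      case False
      then have "a $ c = 0" using a by (simp add: std_flag_def)
      then show ?thesis unfolding matrix_flag_def by (simp add: vec.span_zero)
    qed
    then show "g *v a \<in> matrix_flag g j"
      unfolding matrix_mult_sum by (intro vec.subspace_sum[OF subspace_matrix_flag])
  qed
qed

lemma matrix_flag_mult: "matrix_flag (h ** m) j = (*v) h ` matrix_flag m j"
  for h m :: "'n::{finite,linorder} cmat"
  unfolding matrix_flag_eq by (auto simp: image_image matrix_vector_mul_assoc)

lemma invertible_inj: "invertible (A :: 'n::finite cmat) \<Longrightarrow> inj ((*v) A)"
  by (meson invertible_def matrix_left_invertible_injective)

lemma dim_image_invertible:
  "invertible (A :: 'n::finite cmat) \<Longrightarrow> vec.dim ((*v) A ` X) = vec.dim X"
  by (rule vec.dim_image_eq[OF linear_matrix]) (meson invertible_inj inj_on_subset subset_UNIV)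

lemma dim_matrix_flag:
  "invertible g \<Longrightarrow> vec.dim (matrix_flag g j) = min j CARD('n)" for g :: "'n::{finite,linorder} cmat"
  by (simp add: matrix_flag_eq dim_image_invertible dim_std_flag)

lemma matrix_flag_mono: "i \<le> j \<Longrightarrow> matrix_flag g i \<subseteq> matrix_flag g j"
  unfolding matrix_flag_def by (intro vec.span_mono) auto

lemma complete_flag_matrix_flag: "invertible g \<Longrightarrow> complete_flag (matrix_flag g)"
  unfolding complete_flag_def
  by (auto simp: dim_matrix_flag subspace_matrix_flag intro: matrix_flag_mono[THEN subsetD, rotated])

lemma complete_flag_mono: "complete_flag F \<Longrightarrow> i \<le> j \<Longrightarrow> F i \<subseteq> F j"
  by (rule lift_Suc_mono_le) (auto simp: complete_flag_def)

lemma invertible_if_kernel_trivial: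
  "(\<And>a. A *v a = 0 \<Longrightarrow> a = 0) \<Longrightarrow> invertible (A :: 'n::finite cmat)"
  using matrix_left_invertible_ker[of A] invertible_left_inverse by blast

text \<open>In a linear relation between the columns, the last column that occurs would lie in the
  preceding member of the flag.\<close>

lemma invertible_if_adapted:
  fixes h :: "'n::{finite,linorder} cmat"
  assumes "\<And>j. vec.subspace (F j)" "\<And>i j. i \<le> j \<Longrightarrow> F i \<subseteq> F j"
    and "\<And>c. column c h \<in> F (pos c)" "\<And>c. column c h \<notin> F (pos c - 1)"
  shows "invertible h"
proof (rule invertible_if_kernel_trivial)
  fix a assume ha: "h *v a = 0"
  show "a = 0"
  proof (rule ccontr)
    assume "a \<noteq> 0"
    then have ne: "{c. a $ c \<noteq> 0} \<noteq> {}" by (auto simp: vec_eq_iff)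
    define c where "c = Max {c. a $ c \<noteq> 0}"
    have c: "a $ c \<noteq> 0" using Max_in[OF _ ne] by (simp add: c_def)
    have le: "k \<le> c" if "a $ k \<noteq> 0" for k using that by (simp add: c_def)
    have "a $ k *s column k h \<in> F (pos c - 1)" if "k \<noteq> c" for k
    proof (cases "a $ k = 0")
      case True
      then show ?thesis using vec.subspace_0[OF assms(1)] by simp
    next
      case False
      then have "k < c" using le that by (simp add: order.not_eq_order_implies_strict)
      then have "pos k < pos c" by simp
      then have "pos k \<le> pos c - 1" by linarith
      then show ?thesis using assms(1,2,3) vec.subspace_scale by blast
    qed
    then have "(\<Sum>k\<in>UNIV - {c}. a $ k *s column k h) \<in> F (pos c - 1)"
      by (intro vec.subspace_sum[OF assms(1)]) auto
    moreover have "h *v a = a $ c *s column c h + (\<Sum>k\<in>UNIV - {c}. a $ k *s column k h)"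
      unfolding matrix_mult_sum by (simp add: sum.remove[of UNIV c])
    ultimately have "a $ c *s column c h \<in> F (pos c - 1)"
      using ha vec.subspace_neg[OF assms(1)] by (metis add_eq_0_iff minus_minus)
    then have "inverse (a $ c) *s (a $ c *s column c h) \<in> F (pos c - 1)"
      by (rule vec.subspace_scale[OF assms(1)])
    then show False using assms(4)[of c] c by (simp add: vector_smult_assoc)
  qed
qed

lemma complete_flag_eqI:
  fixes E F :: "'n::finite flag"
  assumes "complete_flag E" "complete_flag F" "\<And>j. E j \<subseteq> F j"
  shows "E = F"
proof
  fix j
  \<comment> \<open>Indices beyond the dimension have to be covered as well, since a flag is a
    function on all natural numbers.\<close>
  have top: "G j = UNIV" if "complete_flag G" "j \<ge> CARD('n)" for G :: "'n flag"
  proof -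
    have "G CARD('n) = UNIV"
      using that(1) by (intro vec.subspace_dim_equal) (auto simp: complete_flag_def card_cart_basis)
    then show ?thesis using complete_flag_mono[OF that] by auto
  qed
  show "E j = F j"
  proof (cases "j \<le> CARD('n)")
    case True
    then show ?thesis
      using assms by (intro vec.subspace_dim_equal) (auto simp: complete_flag_def)
  next
    case False
    then have "E j = UNIV" "F j = UNIV" using top[OF assms(1)] top[OF assms(2)] by simp_all
    then show ?thesis by simp
  qed
qed

lemma adapted_matrix_flag:
  fixes h :: "'n::{finite,linorder} cmat"
  assumes "complete_flag F"
    and "\<And>c. column c h \<in> F (pos c)" "\<And>c. column c h \<notin> F (pos c - 1)"
  shows "invertible h" "F = matrix_flag h"
proof -
  note F = assms(1)[unfolded complete_flag_def] complete_flag_mono[OF assms(1)]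
  show inv: "invertible h"
    by (rule invertible_if_adapted[of F]) (use F assms in auto)
  have "matrix_flag h j \<subseteq> F j" for j
    unfolding matrix_flag_def using assms(2) F by (intro vec.span_minimal) auto
  then show "F = matrix_flag h"
    using complete_flag_eqI[OF complete_flag_matrix_flag[OF inv] assms(1)] by auto
qed

lemma complete_flag_exists_matrix:
  assumes "complete_flag (F :: 'n::{finite,linorder} flag)"
  shows "\<exists>h. invertible h \<and> F = matrix_flag h"
proof -
  have "\<exists>v. v \<in> F (pos c) \<and> v \<notin> F (pos c - 1)" for c :: 'n
  proof (rule ccontr)
    assume "\<not> ?thesis"
    then have "vec.dim (F (pos c)) \<le> vec.dim (F (pos c - 1))" by (intro vec.dim_subset) auto
    moreover have "vec.dim (F i) = i" if "i \<le> CARD('n)" for i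
      using that assms by (auto simp: complete_flag_def)
    ultimately show False using pos_ge_1[of c] pos_le_card[of c] by simp
  qed
  then obtain v where v: "\<And>c :: 'n. v c \<in> F (pos c) \<and> v c \<notin> F (pos c - 1)" by metis
  have "column c (\<chi> r c. v c $ r) = v c" for c by (simp add: column_def vec_eq_iff)
  then show ?thesis using adapted_matrix_flag[OF assms, of "\<chi> r c. v c $ r"] v by auto
qed

text \<open>Invertible upper triangular matrices form the stabilizer of \<open>std_flag\<close>;
  right multiplication by them is exactly the ambiguity in representing a flag by a matrix.\<close>

definition upper_tri :: "'n::{finite,linorder} cmat \<Rightarrow> bool" where
  "upper_tri b \<longleftrightarrow> (\<forall>r c. c < r \<longrightarrow> b $ r $ c = 0)"

lemma upper_tri_iff: "upper_tri b \<longleftrightarrow> (\<forall>c. column c b \<in> std_flag (pos c))"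
  by (auto simp: upper_tri_def std_flag_def column_def)

lemma invertible_multD:
  fixes A B :: "'n::finite cmat"
  assumes "invertible (A ** B)"
  shows "invertible A" "invertible B"
  using assms unfolding invertible_det_nz det_mul by auto

lemma matrix_flag_upper_tri_subset:
  fixes h b :: "'n::{finite,linorder} cmat"
  assumes "upper_tri b"
  shows "matrix_flag (h ** b) j \<subseteq> matrix_flag h j"
proof -
  have "column c (h ** b) \<in> matrix_flag h j" if "pos c \<le> j" for c
  proof -
    have "column c b \<in> std_flag j"
      unfolding std_flag_def mem_Collect_eq
    proof (intro allI impI)
      fix r :: 'n assume "j < pos r"
      then have "c < r" using that pos_less_iff[of c r] by linarith
      then show "column c b $ r = 0" using assms by (simp add: upper_tri_def column_def)
    qed
    then show ?thesis by (simp add: column_mult matrix_flag_eq)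
  qed
  then show ?thesis
    unfolding matrix_flag_def[of "h ** b"]
    by (intro vec.span_minimal subspace_matrix_flag) auto
qed

lemma matrix_flag_upper_tri:
  fixes h b :: "'n::{finite,linorder} cmat"
  assumes "upper_tri b" "invertible (h ** b)"
  shows "matrix_flag (h ** b) = matrix_flag h"
  using assms invertible_multD[OF assms(2)]
  by (intro complete_flag_eqI complete_flag_matrix_flag matrix_flag_upper_tri_subset)

text \<open>Column \<open>c\<close> of \<open>x\<close> lies in the member \<open>pos c\<close> of
  the flag of \<open>h\<close>, and its coordinates with respect to \<open>h\<close> form column
  \<open>c\<close> of the triangular factor. Equality of flags thus becomes a matrix equation with
  an existential quantifier.\<close>

lemma matrix_flag_eq_imp:
  fixes h x :: "'n::{finite,linorder} cmat"
  assumes "invertible h" "matrix_flag x = matrix_flag h"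
  shows "\<exists>b. upper_tri b \<and> x = h ** b"
proof -
  have "column c x \<in> (*v) h ` std_flag (pos c)" for c
  proof -
    have "column c x \<in> matrix_flag x (pos c)"
      unfolding matrix_flag_def by (intro vec.span_base) auto
    then show ?thesis using assms(2) by (simp add: matrix_flag_eq)
  qed
  then have "\<forall>c. \<exists>a. a \<in> std_flag (pos c) \<and> column c x = h *v a" by blast
  from choice[OF this] obtain a where a: "\<And>c. a c \<in> std_flag (pos c) \<and> column c x = h *v a c"
    by blast
  define b where "b = (\<chi> r c. a c $ r)"
  have b: "column c b = a c" for c by (simp add: b_def column_def vec_eq_iff)
  have "x = h ** b" by (rule matrix_eqI) (simp add: column_mult b a)
  moreover have "upper_tri b" by (simp add: upper_tri_iff b a)
  ultimately show ?thesis by blast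
qed

section \<open>Relative position of two flags\<close>

text \<open>Reduced column echelon matrices; the pivot of column \<open>c\<close> is in row \<open>\<pi> c\<close>.\<close>

definition normal_form :: "('n \<Rightarrow> 'n) \<Rightarrow> 'n::{finite,linorder} cmat \<Rightarrow> bool" where
  "normal_form \<pi> m \<longleftrightarrow> (\<forall>c. m $ \<pi> c $ c = 1 \<and> (\<forall>r. \<pi> c < r \<longrightarrow> m $ r $ c = 0) \<and>
     (\<forall>k<c. m $ \<pi> k $ c = 0))"

text \<open>The entries that the normal form leaves undetermined, that is, the coordinates of a
  Bruhat cell; their number is its dimension.\<close>

definition free_entries :: "('n \<Rightarrow> 'n) \<Rightarrow> ('n::{finite,linorder} \<times> 'n) set" where
  "free_entries \<pi> = {(r, c). r < \<pi> c \<and> (\<forall>k<c. r \<noteq> \<pi> k)}"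

lemma normal_form_entry:
  assumes "normal_form \<pi> m"
  shows "m $ r $ c = 0 \<or> m $ r $ c = 1 \<or> (r, c) \<in> free_entries \<pi>"
  using assms unfolding normal_form_def free_entries_def
  by (cases r "\<pi> c" rule: linorder_cases) auto

text \<open>Pivots are cleared in increasing order of their columns: the vector of a later column is
  0 at all earlier pivots, so subtracting it does not spoil what is already cleared.\<close>

lemma eliminate_pivots:
  fixes \<pi> :: "'n::{finite,linorder} \<Rightarrow> 'n" and v :: "'n \<Rightarrow> 'n cvec"
  assumes "finite A"
    and "\<And>c. c \<in> A \<Longrightarrow> v c $ \<pi> c = 1" "\<And>c k. c \<in> A \<Longrightarrow> k \<in> A \<Longrightarrow> k < c \<Longrightarrow> v c $ \<pi> k = 0"
  shows "\<exists>\<gamma>. \<forall>k\<in>A. (u - (\<Sum>j\<in>A. \<gamma> j *s v j)) $ \<pi> k = 0"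
  using assms
proof (induction A rule: finite_linorder_max_induct)
  case empty
  then show ?case by simp
next
  case (insert b A)
  then obtain \<gamma> where \<gamma>: "\<forall>k\<in>A. (u - (\<Sum>j\<in>A. \<gamma> j *s v j)) $ \<pi> k = 0" by auto
  have b: "b \<notin> A" using insert.hyps by auto
  define w where "w = u - (\<Sum>j\<in>A. \<gamma> j *s v j)"
  define \<gamma>' where "\<gamma>' = \<gamma>(b := w $ \<pi> b)"
  have "(\<Sum>j\<in>A. \<gamma>' j *s v j) = (\<Sum>j\<in>A. \<gamma> j *s v j)"
    using b by (intro sum.cong) (auto simp: \<gamma>'_def)
  then have eq: "u - (\<Sum>j\<in>insert b A. \<gamma>' j *s v j) = w - w $ \<pi> b *s v b"
    using b insert.hyps by (simp add: w_def \<gamma>'_def)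
  have "(w - w $ \<pi> b *s v b) $ \<pi> k = 0" if "k \<in> insert b A" for k
  proof (cases "k = b")
    case True
    then show ?thesis using insert.prems(1)[of b] by simp
  next
    case False
    then have "k \<in> A" "k < b" using that insert.hyps by auto
    then show ?thesis using \<gamma> insert.prems(2)[of b k] by (simp add: w_def)
  qed
  then show ?case unfolding eq[symmetric] by blast
qed

text \<open>The invariant of column reduction on the columns in \<open>A\<close>: \<open>v\<close>
  holds the reduced columns, and \<beta> is the triangular matrix that recovers the original ones
  from them.\<close>

definition echelon_columns ::
    "'n::{finite,linorder} cmat \<Rightarrow> 'n set \<Rightarrow> ('n \<Rightarrow> 'n) \<Rightarrow> ('n \<Rightarrow> 'n cvec) \<Rightarrow> ('n \<Rightarrow> 'n \<Rightarrow> complex) \<Rightarrow> bool" where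
  "echelon_columns m A \<pi> v \<beta> \<longleftrightarrow> inj_on \<pi> A \<and> (\<forall>c\<in>A. v c $ \<pi> c = 1 \<and> (\<forall>r. \<pi> c < r \<longrightarrow> v c $ r = 0) \<and>
      (\<forall>k\<in>A. k < c \<longrightarrow> v c $ \<pi> k = 0) \<and> v c \<in> vec.span ((\<lambda>k. column k m) ` A) \<and>
      column c m = (\<Sum>k\<in>A. \<beta> k c *s v k) \<and> (\<forall>k. c < k \<longrightarrow> \<beta> k c = 0))"

text \<open>Gaussian elimination from left to right. A new column is cleared at the earlier pivots
  and scaled; the columns already reduced are not touched again.\<close>

lemma normal_form_columns:
  fixes m :: "'n::{finite,linorder} cmat"
  assumes inv: "invertible m" and "finite A"
  shows "\<exists>\<pi> v \<beta>. echelon_columns m A \<pi> v \<beta>"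
  using assms(2)
proof (induction A rule: finite_linorder_max_induct)
  case empty
  then show ?case by (simp add: echelon_columns_def)
next
  case (insert b A)
  let ?col = "\<lambda>k. column k m"
  obtain \<pi> v \<beta> where IH: "echelon_columns m A \<pi> v \<beta>" using insert.IH by (elim exE)
  then have inj: "inj_on \<pi> A" by (simp add: echelon_columns_def)
  have v1: "\<And>c. c \<in> A \<Longrightarrow> v c $ \<pi> c = 1"
    and v2: "\<And>c r. c \<in> A \<Longrightarrow> \<pi> c < r \<Longrightarrow> v c $ r = 0"
    and v3: "\<And>c k. c \<in> A \<Longrightarrow> k \<in> A \<Longrightarrow> k < c \<Longrightarrow> v c $ \<pi> k = 0"
    and v4: "\<And>c. c \<in> A \<Longrightarrow> v c \<in> vec.span (?col ` A)"
    and v5: "\<And>c. c \<in> A \<Longrightarrow> ?col c = (\<Sum>k\<in>A. \<beta> k c *s v k)"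
    and v6: "\<And>c k. c \<in> A \<Longrightarrow> c < k \<Longrightarrow> \<beta> k c = 0"
    using IH unfolding echelon_columns_def by blast+
  have b: "b \<notin> A" using insert.hyps by auto
  obtain \<gamma> where \<gamma>: "\<forall>k\<in>A. (?col b - (\<Sum>j\<in>A. \<gamma> j *s v j)) $ \<pi> k = 0"
    using eliminate_pivots[OF insert.hyps(1), of v \<pi> "?col b"] v1 v3 by blast
  define w where "w = ?col b - (\<Sum>j\<in>A. \<gamma> j *s v j)"
  have sumspan: "(\<Sum>j\<in>A. \<gamma> j *s v j) \<in> vec.span (?col ` A)"
    using v4 by (intro vec.span_sum vec.span_scale) auto
  have "w \<noteq> 0"
  proof
    assume "w = 0"
    then have "?col b \<in> vec.span (?col ` A)" using sumspan by (simp add: w_def)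
    \<comment> \<open>After multiplication by the inverse, coordinate \<open>b\<close> is 1 on
      column \<open>b\<close> and 0 on all other columns, hence 0 on their span.\<close>
    moreover obtain B where B: "B ** m = mat 1" using inv invertible_left_inverse by blast
    have Bcol: "(B *v ?col k) $ b = (if k = b then 1 else 0)" for k
      unfolding column_mult[symmetric] B by (simp add: column_def mat_def)
    have "vec.span (?col ` A) \<subseteq> {x. (B *v x) $ b = 0}"
    proof (rule vec.span_minimal)
      show "vec.subspace {x. (B *v x) $ b = 0}"
        by (auto simp: vec.subspace_def matrix_vector_right_distrib vector_scalar_commute)
    qed (use b Bcol in auto)
    ultimately show False using Bcol[of b] by auto
  qed
  then have ne: "{r. w $ r \<noteq> 0} \<noteq> {}" by (auto simp: vec_eq_iff)
  \<comment> \<open>The pivot is the nonzero entry with the largest row index. It is a new row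
    because \<open>w\<close> vanishes at the earlier pivots.\<close>
  define p where "p = Max {r. w $ r \<noteq> 0}"
  have p: "w $ p \<noteq> 0" using Max_in[OF _ ne] by (simp add: p_def)
  have pmax: "w $ r = 0" if "p < r" for r
  proof (rule ccontr)
    assume "w $ r \<noteq> 0"
    then have "r \<le> p" by (simp add: p_def)
    then show False using that by simp
  qed
  have wA: "w $ \<pi> k = 0" if "k \<in> A" for k using \<gamma> that by (simp add: w_def)
  then have pA: "p \<notin> \<pi> ` A" using p by auto
  define u where "u = inverse (w $ p) *s w"
  have colb: "?col b = (w $ p) *s u + (\<Sum>j\<in>A. \<gamma> j *s v j)"
    using p by (simp add: u_def w_def vector_smult_assoc)
  define \<pi>' where "\<pi>' = \<pi>(b := p)"
  define v' where "v' = v(b := u)"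
  define \<beta>' where "\<beta>' = (\<lambda>k c. if c = b then (if k = b then w $ p else if k \<in> A then \<gamma> k else 0)
      else if k = b then 0 else \<beta> k c)"
  have onA: "\<pi>' c = \<pi> c" "v' c = v c" "c \<noteq> b" if "c \<in> A" for c
    using that b by (auto simp: \<pi>'_def v'_def)
  have onb: "\<pi>' b = p" "v' b = u" by (auto simp: \<pi>'_def v'_def)
  have less: "c < b" if "c \<in> A" for c using that insert.hyps by auto
  have nless: "\<not> b < c" if "c \<in> A" for c using less[OF that] by simp
  have sumA: "(\<Sum>k\<in>insert b A. \<beta>' k c *s v' k) = \<beta>' b c *s u + (\<Sum>k\<in>A. \<beta>' k c *s v k)" for c
    using insert.hyps b onA onb by simp
  have span_b: "u \<in> vec.span (?col ` insert b A)"
  proof -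
    have "(\<Sum>j\<in>A. \<gamma> j *s v j) \<in> vec.span (?col ` insert b A)"
      using sumspan vec.span_mono[of "?col ` A" "?col ` insert b A"] by blast
    moreover have "?col b \<in> vec.span (?col ` insert b A)" by (intro vec.span_base) simp
    ultimately show ?thesis unfolding u_def w_def by (intro vec.span_scale vec.span_diff)
  qed
  show ?case
    unfolding echelon_columns_def
  proof (intro exI conjI ballI)
    show "inj_on \<pi>' (insert b A)"
      using inj pA b by (auto simp: \<pi>'_def intro!: inj_on_fun_updI)
    fix c assume "c \<in> insert b A"
    then consider "c = b" | "c \<in> A" by blast
    note cases = this
    show "v' c $ \<pi>' c = 1"
      using cases by cases (use p onA onb v1 in \<open>auto simp: u_def\<close>)
    show "\<forall>r. \<pi>' c < r \<longrightarrow> v' c $ r = 0"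
      using cases by cases (use pmax onA onb v2 in \<open>auto simp: u_def\<close>)
    show "k < c \<longrightarrow> v' c $ \<pi>' k = 0" if "k \<in> insert b A" for k
      using cases by cases (use that wA onA onb v3 nless in \<open>auto simp: u_def\<close>)
    show "v' c \<in> vec.span (?col ` insert b A)"
      using cases
    proof cases
      case 1
      then show ?thesis using span_b onb by simp
    next
      case 2
      then show ?thesis using v4[OF 2] vec.span_mono[of "?col ` A" "?col ` insert b A"] onA by auto
    qed
    show "?col c = (\<Sum>k\<in>insert b A. \<beta>' k c *s v' k)"
      using cases
    proof cases
      case 1
      have "(\<Sum>k\<in>A. \<beta>' k b *s v k) = (\<Sum>k\<in>A. \<gamma> k *s v k)"
        using b by (intro sum.cong) (auto simp: \<beta>'_def)
      then show ?thesis using 1 colb unfolding sumA by (simp add: \<beta>'_def)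
    next
      case 2
      have "(\<Sum>k\<in>A. \<beta>' k c *s v k) = (\<Sum>k\<in>A. \<beta> k c *s v k)"
        using b 2 by (intro sum.cong) (auto simp: \<beta>'_def)
      then show ?thesis using 2 v5[OF 2] onA(3)[OF 2] unfolding sumA by (simp add: \<beta>'_def)
    qed
    show "\<forall>k. c < k \<longrightarrow> \<beta>' k c = 0"
      using cases by cases (use v6 less onA(3) in \<open>auto simp: \<beta>'_def dest: less_asym\<close>)
  qed
qed

lemma normal_form_exists:
  fixes m :: "'n::{finite,linorder} cmat"
  assumes "invertible m"
  shows "\<exists>\<pi> m' b. bij \<pi> \<and> normal_form \<pi> m' \<and> upper_tri b \<and> m = m' ** b"
proof -
  from normal_form_columns[OF assms finite, of UNIV] obtain \<pi> v \<beta>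
    where *: "echelon_columns m UNIV \<pi> v \<beta>" by (elim exE)
  then have inj: "inj \<pi>" by (simp add: echelon_columns_def)
  have v: "\<And>c. v c $ \<pi> c = 1 \<and> (\<forall>r. \<pi> c < r \<longrightarrow> v c $ r = 0) \<and> (\<forall>k. k < c \<longrightarrow> v c $ \<pi> k = 0)"
    and col: "\<And>c. column c m = (\<Sum>k\<in>UNIV. \<beta> k c *s v k)"
    and \<beta>: "\<And>c k. c < k \<Longrightarrow> \<beta> k c = 0"
    using * unfolding echelon_columns_def by blast+
  define m' where "m' = (\<chi> r c. v c $ r)"
  define b where "b = (\<chi> k c. \<beta> k c)"
  have "m = m' ** b"
  proof (rule matrix_eqI)
    fix c
    have "column k m' = v k" for k by (simp add: m'_def column_def vec_eq_iff)
    moreover have "column c b $ k = \<beta> k c" for k by (simp add: b_def column_def)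
    ultimately show "column c m = column c (m' ** b)"
      unfolding column_mult col matrix_mult_sum by simp
  qed
  moreover have "normal_form \<pi> m'" using v by (simp add: normal_form_def m'_def)
  moreover have "upper_tri b" using \<beta> by (simp add: upper_tri_def b_def)
  moreover have "bij \<pi>" using inj finite_UNIV_inj_surj[of \<pi>] by (simp add: bij_def)
  ultimately show ?thesis by blast
qed

text \<open>Among the columns that occur in a combination, the one with the largest pivot row
  contributes the only nonzero entry in that row. Hence there is no cancellation, and membership in
  \<open>std_flag j\<close> can be read off the pivots.\<close>

lemma normal_form_std_flag_Int:
  fixes m :: "'n::{finite,linorder} cmat"
  assumes "inj \<pi>" "normal_form \<pi> m"
  shows "matrix_flag m i \<inter> std_flag j =
    (*v) m ` {a. \<forall>c. c \<notin> {c. pos c \<le> i \<and> pos (\<pi> c) \<le> j} \<longrightarrow> a $ c = 0}"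
proof (intro antisym subsetI)
  fix x assume "x \<in> matrix_flag m i \<inter> std_flag j"
  then obtain a where a: "a \<in> std_flag i" "x = m *v a" "m *v a \<in> std_flag j"
    unfolding matrix_flag_eq by auto
  have piv: "pos (\<pi> c) \<le> j" if "a $ c \<noteq> 0" for c
  proof (rule ccontr)
    assume gt: "\<not> pos (\<pi> c) \<le> j"
    define p where "p = Max (\<pi> ` {c. a $ c \<noteq> 0})"
    have "p \<in> \<pi> ` {c. a $ c \<noteq> 0}" unfolding p_def using that by (intro Max_in) auto
    then obtain d where d: "a $ d \<noteq> 0" "p = \<pi> d" by auto
    have le: "\<pi> k \<le> p" if "a $ k \<noteq> 0" for k using that by (simp add: p_def)
    have "m $ p $ k * a $ k = 0" if "k \<noteq> d" for k
    proof (cases "a $ k = 0")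
      case False
      then have "\<pi> k < p" using le that d(2) inj_eq[OF assms(1)] by (metis order.not_eq_order_implies_strict)
      then show ?thesis using assms(2) by (simp add: normal_form_def)
    qed simp
    then have "(m *v a) $ p = m $ p $ d * a $ d"
      unfolding matrix_vector_mult_def by (simp add: sum.remove[of UNIV d] sum.neutral)
    also have "\<dots> = a $ d" using assms(2) d(2) by (simp add: normal_form_def)
    finally have "(m *v a) $ p \<noteq> 0" using d(1) by simp
    moreover have "pos (\<pi> c) \<le> pos p" using le[OF that] by simp
    then have "j < pos p" using gt by linarith
    ultimately show False using a(3) by (simp add: std_flag_def)
  qed
  have "a $ c = 0" if "\<not> (pos c \<le> i \<and> pos (\<pi> c) \<le> j)" for c
    using that a(1) piv[of c] by (cases "a $ c = 0") (auto simp: std_flag_def not_le)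
  then have "a \<in> {a. \<forall>c. c \<notin> {c. pos c \<le> i \<and> pos (\<pi> c) \<le> j} \<longrightarrow> a $ c = 0}"
    by simp
  then show "x \<in> (*v) m ` {a. \<forall>c. c \<notin> {c. pos c \<le> i \<and> pos (\<pi> c) \<le> j} \<longrightarrow> a $ c = 0}"
    using a(2) by blast
next
  fix x assume "x \<in> (*v) m ` {a. \<forall>c. c \<notin> {c. pos c \<le> i \<and> pos (\<pi> c) \<le> j} \<longrightarrow> a $ c = 0}"
  then obtain a where a: "\<And>c. \<not> (pos c \<le> i \<and> pos (\<pi> c) \<le> j) \<Longrightarrow> a $ c = 0" "x = m *v a" by auto
  have "a \<in> std_flag i" using a(1) by (auto simp: std_flag_def)
  moreover have "(m *v a) $ r = 0" if "j < pos r" for r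
  proof -
    have "m $ r $ c * a $ c = 0" for c
    proof (cases "pos (\<pi> c) \<le> j")
      case True
      then have "\<pi> c < r" using that pos_less_iff[of "\<pi> c" r] by linarith
      then show ?thesis using assms(2) by (simp add: normal_form_def)
    next
      case False
      then show ?thesis using a(1) by simp
    qed
    then show ?thesis by (simp add: matrix_vector_mult_def sum.neutral)
  qed
  ultimately show "x \<in> matrix_flag m i \<inter> std_flag j"
    unfolding matrix_flag_eq using a(2) by (auto simp: std_flag_def)
qed

text \<open>Moving both flags by the inverse of \<open>h\<close> makes the second one standard, and
  \<open>b\<close> does not change the first. So the dimensions depend on the pivot permutation
  alone.\<close>

lemma dim_relative_position:
  fixes h m b :: "'n::{finite,linorder} cmat"
  assumes "inj \<pi>" "normal_form \<pi> m" "upper_tri b" "invertible (h ** m ** b)"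
  shows "vec.dim (matrix_flag (h ** m ** b) i \<inter> matrix_flag h j) =
    card {c. pos c \<le> i \<and> pos (\<pi> c) \<le> j}"
proof -
  have inv: "invertible h" "invertible m"
    using invertible_multD[OF assms(4)] invertible_multD[of h m] by auto
  have "matrix_flag (h ** m ** b) i \<inter> matrix_flag h j = (*v) h ` matrix_flag m i \<inter> (*v) h ` std_flag j"
    unfolding matrix_flag_upper_tri[OF assms(3,4)] matrix_flag_mult matrix_flag_eq[of h] ..
  also have "\<dots> = (*v) h ` (matrix_flag m i \<inter> std_flag j)"
    using image_Int[OF invertible_inj[OF inv(1)]] by auto
  finally show ?thesis
    unfolding normal_form_std_flag_Int[OF assms(1,2)]
    by (simp only: dim_image_invertible[OF inv(1)] dim_image_invertible[OF inv(2)] dim_substandard_cart)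
qed

section \<open>Bruhat order and length\<close>

definition inversions :: "('n::{finite,linorder} \<Rightarrow> 'n) \<Rightarrow> ('n \<times> 'n) set" where
  "inversions p = {(a, b). a < b \<and> p b < p a}"

text \<open>The rank function of a permutation matrix; its pointwise comparison is the Bruhat
  order.\<close>

definition block_count :: "('n::{finite,linorder} \<Rightarrow> 'n) \<Rightarrow> 'n \<Rightarrow> 'n \<Rightarrow> nat" where
  "block_count p i j = card {c. c \<le> j \<and> p c \<le> i}"

abbreviation (input) swap_values where
  "swap_values j k p \<equiv> p \<circ> Transposition.transpose j k"

text \<open>An injection on inversions: the transposition is applied to both members of the pair if
  the result is still increasing, and otherwise the pair is kept.\<close>

lemma card_inversions_transpose:
  fixes p :: "'n::{finite,linorder} \<Rightarrow> 'n"
  assumes "j < k" "p j < p k"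
  shows "card (inversions p) \<le> card (inversions (swap_values j k p))"
proof -
  define t where "t = Transposition.transpose j k"
  have t: "t j = k" "t k = j" "\<And>a. a \<noteq> j \<Longrightarrow> a \<noteq> k \<Longrightarrow> t a = a" "\<And>a. t (t a) = a"
    by (auto simp: t_def Transposition.transpose_def)
  define \<phi> where "\<phi> = (\<lambda>(a, b). if t a < t b then (t a, t b) else (a, b))"
  have "inj_on \<phi> (inversions p)"
  proof (rule inj_onI)
    fix x y assume xy: "x \<in> inversions p" "y \<in> inversions p" "\<phi> x = \<phi> y"
    obtain a b a' b' where ab: "x = (a, b)" "y = (a', b')" by force
    have "a < b" "a' < b'" using xy ab by (auto simp: inversions_def)
    then show "x = y" using xy(3) t(4) unfolding \<phi>_def ab
      by (auto split: if_splits) (metis less_asym)+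
  qed
  moreover have "\<phi> ` inversions p \<subseteq> inversions (p \<circ> t)"
  proof (rule image_subsetI)
    fix x assume "x \<in> inversions p"
    then obtain a b where x: "x = (a, b)" and ab: "a < b" "p b < p a" by (auto simp: inversions_def)
    show "\<phi> x \<in> inversions (p \<circ> t)"
    proof (cases "t a < t b")
      case True
      then show ?thesis using ab t(4) x by (simp add: \<phi>_def inversions_def)
    next
      case False
      have "p (t b) < p (t a)"
        using False ab assms by (auto simp: t_def Transposition.transpose_def split: if_splits)
      then show ?thesis using ab False x by (simp add: \<phi>_def inversions_def)
    qed
  qed
  ultimately show ?thesis
    unfolding t_def[symmetric] by (intro card_inj_on_le) auto
qed

text \<open>Here \<open>j\<close> is the first position where \<open>p\<close> and \<open>q\<close> differ, and \<open>k\<close> the first later one with a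
  value in the interval from \<open>p j\<close> to \<open>q j\<close>.\<close>

lemma block_count_step:
  fixes p q :: "'n::{finite,linorder} \<Rightarrow> 'n"
  assumes "bij p" "bij q" "p \<noteq> q" and dom: "\<And>i m. block_count q i m \<le> block_count p i m"
  shows "\<exists>j k. j < k \<and> p j < p k \<and>
    (\<forall>i m. block_count q i m \<le> block_count (swap_values j k p) i m) \<and>
    (\<forall>i m. block_count (swap_values j k p) i m \<le> block_count p i m) \<and>
    (\<exists>i m. block_count (swap_values j k p) i m < block_count p i m)"
proof -
  have "{c. p c \<noteq> q c} \<noteq> {}" using assms(3) by auto
  define j where "j = Min {c. p c \<noteq> q c}"
  have j: "p j \<noteq> q j" using Min_in[OF _ \<open>{c. p c \<noteq> q c} \<noteq> {}\<close>] by (simp add: j_def)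
  have below: "p c = q c" if "c < j" for c
  proof (rule ccontr)
    assume "p c \<noteq> q c"
    then have "j \<le> c" by (simp add: j_def)
    then show False using that by simp
  qed
  \<comment> \<open>Before \<open>j\<close> the permutations agree. If \<open>q j\<close> were the
    smaller value, then position \<open>j\<close> would count for \<open>q\<close> but not for
    \<open>p\<close> in the block of values up to \<open>q j\<close>, against domination.\<close>
  have "p j < q j"
  proof (rule ccontr)
    assume "\<not> p j < q j"
    then have "q j < p j" using j by simp
    have "{c. c \<le> j \<and> p c \<le> q j} \<subseteq> {c. c < j \<and> q c \<le> q j}"
      using \<open>q j < p j\<close> below by (auto simp: order.order_iff_strict)
    then have "block_count p (q j) j \<le> card {c. c < j \<and> q c \<le> q j}"
      unfolding block_count_def by (intro card_mono) auto
    also have "\<dots> < block_count q (q j) j"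
      unfolding block_count_def by (intro psubset_card_mono) (auto simp: psubset_eq)
    finally show False using dom[of "q j" j] by simp
  qed
  define K where "K = {c. j < c \<and> p j < p c \<and> p c \<le> q j}"
  have "K \<noteq> {}"
  proof -
    obtain c where c: "p c = q j" using assms(1) by (metis bij_pointE)
    have "\<not> c < j" using below[of c] c assms(2) by (metis bij_pointE less_irrefl)
    moreover have "c \<noteq> j" using c j by auto
    ultimately show ?thesis using c \<open>p j < q j\<close> unfolding K_def by (auto intro!: exI[of _ c])
  qed
  define k where "k = Min K"
  have k: "j < k" "p j < p k" "p k \<le> q j"
    using Min_in[OF _ \<open>K \<noteq> {}\<close>] by (auto simp: k_def K_def)
  have between: "\<not> (p j < p c \<and> p c \<le> q j)" if "j < c" "c < k" for c
  proof
    assume "p j < p c \<and> p c \<le> q j"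
    then have "c \<in> K" using that by (simp add: K_def)
    then have "k \<le> c" by (simp add: k_def)
    then show False using that by simp
  qed
  define p' where "p' = p \<circ> Transposition.transpose j k"
  have p': "p' j = p k" "p' k = p j" "\<And>c. c \<noteq> j \<Longrightarrow> c \<noteq> k \<Longrightarrow> p' c = p c"
    by (auto simp: p'_def Transposition.transpose_def)
  \<comment> \<open>A block that contains both positions is merely permuted, and for the remaining
    blocks outside the rectangle no membership changes.\<close>
  have outside: "block_count p' i m = block_count p i m"
    if "\<not> (j \<le> m \<and> m < k \<and> p j \<le> i \<and> i < p k)" for i m
  proof (cases "k \<le> m")
    case True
    have "{c. c \<le> m \<and> p' c \<le> i} = Transposition.transpose j k ` {c. c \<le> m \<and> p c \<le> i}"
    proof (intro antisym subsetI)
      fix c assume "c \<in> {c. c \<le> m \<and> p' c \<le> i}"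
      then have "Transposition.transpose j k c \<in> {c. c \<le> m \<and> p c \<le> i}"
        using True k(1) by (auto simp: p'_def Transposition.transpose_def split: if_splits)
      then show "c \<in> Transposition.transpose j k ` {c. c \<le> m \<and> p c \<le> i}"
        by (metis image_eqI transpose_involutory)
    next
      fix c assume "c \<in> Transposition.transpose j k ` {c. c \<le> m \<and> p c \<le> i}"
      then show "c \<in> {c. c \<le> m \<and> p' c \<le> i}"
        using True k(1) by (auto simp: p'_def Transposition.transpose_def split: if_splits)
    qed
    then show ?thesis unfolding block_count_def
      by (simp add: card_image inj_on_subset[OF inj_transpose])
  next
    case False
    have "{c. c \<le> m \<and> p' c \<le> i} = {c. c \<le> m \<and> p c \<le> i}"
    proof (rule Collect_cong)
      fix c
      show "(c \<le> m \<and> p' c \<le> i) = (c \<le> m \<and> p c \<le> i)"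
      proof (cases "c = j")
        case True
        then show ?thesis using p'(1) that False k(2) by auto
      next
        case cj: False
        then show ?thesis using p'(3)[of c] False by (cases "c = k") auto
      qed
    qed
    then show ?thesis by (simp add: block_count_def)
  qed
  have inside: "block_count p i m = Suc (block_count p' i m)" "block_count q i m < block_count p i m"
    if ij: "j \<le> m" "m < k" "p j \<le> i" "i < p k" for i m
  proof -
    have "{c. c \<le> m \<and> p c \<le> i} = insert j {c. c \<le> m \<and> p' c \<le> i}"
    proof (rule set_eqI)
      fix c
      show "c \<in> {c. c \<le> m \<and> p c \<le> i} \<longleftrightarrow> c \<in> insert j {c. c \<le> m \<and> p' c \<le> i}"
        using p'(3)[of c] ij by (cases "c = j"; cases "c = k") auto
    qed
    moreover have "j \<notin> {c. c \<le> m \<and> p' c \<le> i}" using p'(1) ij by auto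
    ultimately show "block_count p i m = Suc (block_count p' i m)"
      by (simp add: block_count_def)
    \<comment> \<open>From the bound \<open>i\<close> to the bound \<open>q j\<close> the count for
      \<open>p\<close> grows only by \<open>X\<close>, since by the choice of \<open>k\<close> no
      position after \<open>j\<close> and up to \<open>m\<close> has a value of \<open>p\<close>
      above \<open>p j\<close> and at most \<open>q j\<close>. The count for \<open>q\<close> grows
      by \<open>X\<close> and by position \<open>j\<close> itself. Domination at \<open>q j\<close>
      therefore is strict at \<open>i\<close>.\<close>
    define X where "X = {c. c < j \<and> i < q c \<and> q c \<le> q j}"
    have iq: "i < q j" using ij k(3) by simp
    have pX: "{c. c \<le> m \<and> p c \<le> q j} = {c. c \<le> m \<and> p c \<le> i} \<union> X"
    proof (rule set_eqI)
      fix c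
      show "c \<in> {c. c \<le> m \<and> p c \<le> q j} \<longleftrightarrow> c \<in> {c. c \<le> m \<and> p c \<le> i} \<union> X"
      proof (cases c j rule: linorder_cases)
        case less
        then show ?thesis using below[OF less] iq ij by (auto simp: X_def)
      next
        case equal
        then show ?thesis using iq ij \<open>p j < q j\<close> by (auto simp: X_def)
      next
        case greater
        have "p c \<le> i" if "c \<le> m" "p c \<le> q j"
        proof -
          have "p c \<le> p j" using between[OF greater] that ij(2) by (meson le_less_trans not_le)
          then show ?thesis using ij(3) by simp
        qed
        then show ?thesis using greater iq by (auto simp: X_def)
      qed
    qed
    have "{c. c \<le> m \<and> p c \<le> i} \<inter> X = {}" using below by (auto simp: X_def)
    then have "block_count p (q j) m = block_count p i m + card X"
      unfolding block_count_def pX by (intro card_Un_disjoint) auto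
    moreover have "block_count q i m + Suc (card X) \<le> block_count q (q j) m"
    proof -
      have "block_count q i m + Suc (card X) = card ({c. c \<le> m \<and> q c \<le> i} \<union> insert j X)"
        unfolding block_count_def using iq by (subst card_Un_disjoint) (auto simp: X_def)
      also have "\<dots> \<le> block_count q (q j) m"
        unfolding block_count_def using iq ij by (intro card_mono) (auto simp: X_def)
      finally show ?thesis .
    qed
    ultimately show "block_count q i m < block_count p i m" using dom[of "q j" m] by linarith
  qed
  have "block_count q i m \<le> block_count p' i m \<and> block_count p' i m \<le> block_count p i m" for i m
  proof (cases "j \<le> m \<and> m < k \<and> p j \<le> i \<and> i < p k")
    case True
    then show ?thesis using inside[of m i] by simp
  next
    case False
    then show ?thesis using outside[OF False] dom[of i m] by simp
  qed
  moreover have "block_count p' (p j) j < block_count p (p j) j"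
    using inside(1)[of j "p j"] k by simp
  ultimately show ?thesis using k unfolding p'_def by blast
qed

text \<open>Descent along a chain of transpositions from \<open>p\<close> to \<open>q\<close>; every
  step lowers the sum of all block counts and does not lose inversions.\<close>

lemma card_inversions_mono:
  fixes p q :: "'n::{finite,linorder} \<Rightarrow> 'n"
  assumes "bij p" "bij q" "\<And>i m. block_count q i m \<le> block_count p i m"
  shows "card (inversions p) \<le> card (inversions q)"
  using assms
proof (induction "\<Sum>(i, m)\<in>UNIV. block_count p i m" arbitrary: p rule: less_induct)
  case less
  show ?case
  proof (cases "p = q")
    case False
    obtain j k where jk: "j < k" "p j < p k"
      and 1: "\<forall>i m. block_count q i m \<le> block_count (swap_values j k p) i m"
      and 2: "\<forall>i m. block_count (swap_values j k p) i m \<le> block_count p i m"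
      and 3: "\<exists>i m. block_count (swap_values j k p) i m < block_count p i m"
      using block_count_step[OF less.prems(1,2) False less.prems(3)] by metis
    have "(\<Sum>(i, m)\<in>UNIV. block_count (swap_values j k p) i m) < (\<Sum>(i, m)\<in>UNIV. block_count p i m)"
      using 2 3 by (intro sum_strict_mono_ex1) auto
    then have "card (inversions (swap_values j k p)) \<le> card (inversions q)"
      using 1 less.prems(1,2) by (intro less.hyps bij_comp) auto
    then show ?thesis using card_inversions_transpose[OF jk] by linarith
  qed simp
qed

section \<open>Dimensions of Bruhat cells and lengths of permutations\<close>

lemma card_less_pairs: "card {(a, b :: 'n::{finite,linorder}). a < b} = CARD('n) choose 2"
proof -
  define A where "A = {(a, b :: 'n). a < b}"
  define B where "B = {(a, b :: 'n). b < a}"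
  have "B = prod.swap ` A" by (auto simp: A_def B_def image_iff)
  then have "card B = card A" by (simp add: card_image)
  moreover have "card (A \<union> B) = card A + card B"
    by (intro card_Un_disjoint) (auto simp: A_def B_def)
  moreover have "card ((A \<union> B) \<union> range (\<lambda>a. (a, a))) = card (A \<union> B) + card (range (\<lambda>a :: 'n. (a, a)))"
    by (intro card_Un_disjoint) (auto simp: A_def B_def)
  moreover have "(A \<union> B) \<union> range (\<lambda>a. (a, a)) = UNIV" by (auto simp: A_def B_def image_iff)
  moreover have "card (range (\<lambda>a :: 'n. (a, a))) = CARD('n)" by (simp add: card_image inj_on_def)
  moreover have "card (UNIV :: ('n \<times> 'n) set) = CARD('n) * CARD('n)" by (simp add: card_prod)
  ultimately have "2 * card A + CARD('n) = CARD('n) * CARD('n)" by simp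
  then have "card A = CARD('n) * (CARD('n) - 1) div 2" by (simp add: diff_mult_distrib2)
  then show ?thesis by (simp add: A_def choose_two)
qed

lemma card_inversions_le: "card (inversions p) \<le> CARD('n) choose 2"
  for p :: "'n::{finite,linorder} \<Rightarrow> 'n"
  unfolding card_less_pairs[symmetric, where 'n = 'n] inversions_def by (intro card_mono) auto

text \<open>A free entry in row \<open>r\<close> and column \<open>c\<close> corresponds to the
  inversion \<open>(r, \<pi> c)\<close>: its row lies above the pivot of its column and is the pivot
  row of a later column.\<close>

lemma card_free_entries:
  assumes "bij \<pi>"
  shows "card (free_entries \<pi>) = card (inversions (inv \<pi>))"
proof (rule bij_betw_same_card)
  have eq: "inv \<pi> (\<pi> c) = c" "\<pi> (inv \<pi> r) = r" for c r
    using assms by (simp_all add: bij_is_inj bij_is_surj surj_f_inv_f)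
  show "bij_betw (\<lambda>(r, c). (r, \<pi> c)) (free_entries \<pi>) (inversions (inv \<pi>))"
  proof (rule bij_betw_imageI)
    show "inj_on (\<lambda>(r, c). (r, \<pi> c)) (free_entries \<pi>)"
      using assms by (auto simp: inj_on_def bij_def)
    show "(\<lambda>(r, c). (r, \<pi> c)) ` free_entries \<pi> = inversions (inv \<pi>)"
    proof (intro antisym subsetI)
      fix x assume "x \<in> (\<lambda>(r, c). (r, \<pi> c)) ` free_entries \<pi>"
      then obtain r c where rc: "(r, c) \<in> free_entries \<pi>" "x = (r, \<pi> c)" by auto
      have "\<not> inv \<pi> r < c" using rc(1) eq(2)[of r] unfolding free_entries_def by force
      moreover have "inv \<pi> r \<noteq> c" using rc(1) eq(2)[of r] unfolding free_entries_def by force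
      ultimately show "x \<in> inversions (inv \<pi>)"
        using rc by (auto simp: free_entries_def inversions_def eq)
    next
      fix x assume "x \<in> inversions (inv \<pi>)"
      then obtain a b where ab: "x = (a, b)" "a < b" "inv \<pi> b < inv \<pi> a"
        unfolding inversions_def by auto
      have "a \<noteq> \<pi> k" if "k < inv \<pi> b" for k using ab(3) that eq(1)[of k] by auto
      then have "(a, inv \<pi> b) \<in> free_entries \<pi>" using ab(2) by (auto simp: free_entries_def eq)
      then show "x \<in> (\<lambda>(r, c). (r, \<pi> c)) ` free_entries \<pi>" using ab(1) eq(2)
        by (intro image_eqI[of _ _ "(a, inv \<pi> b)"]) simp_all
    qed
  qed
qed

text \<open>The rows of the truncated matrix are 0 or distinct unit vectors, so the rank is the
  number of ones in the block.\<close>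

lemma block_rank_schubert_matrix:
  assumes "w permutes {1..CARD('n)}"
  shows "block_rank (schubert_matrix w :: 'n::{finite,linorder} cmat) i j =
    card {c :: 'n. pos c \<le> j \<and> w (CARD('n) - pos c + 1) \<le> i}"
proof -
  define C where "C = {c :: 'n. pos c \<le> j \<and> w (CARD('n) - pos c + 1) \<le> i}"
  define M :: "'n cmat" where
    "M = (\<chi> r c. if pos r \<le> i \<and> pos c \<le> j then (schubert_matrix w :: 'n cmat) $ r $ c else 0)"
  define e where "e = (\<lambda>c :: 'n. axis c (1 :: complex))"
  have Mrc: "M $ r $ c = (if c \<in> C \<and> pos r = w (CARD('n) - pos c + 1) then 1 else 0)" for r c
    by (auto simp: M_def schubert_matrix_def C_def)
  have inj: "c = d" if "w (CARD('n) - pos c + 1) = w (CARD('n) - pos d + 1)" for c d :: 'n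
  proof -
    have "CARD('n) - pos c + 1 = CARD('n) - pos d + 1"
      using that permutes_inj[OF assms] by (auto simp: inj_eq)
    then have "pos c = pos d" using pos_le_card[of c] pos_le_card[of d] by linarith
    then show ?thesis by simp
  qed
  have row: "M $ r = e c" if "c \<in> C" "pos r = w (CARD('n) - pos c + 1)" for r c
    using that inj by (auto simp: vec_eq_iff Mrc e_def axis_def)
  have row0: "M $ r = 0" if "\<And>c. c \<in> C \<Longrightarrow> pos r \<noteq> w (CARD('n) - pos c + 1)" for r
    using that by (auto simp: vec_eq_iff Mrc)
  have "vec.span (rows M) = vec.span (e ` C)"
  proof (intro antisym vec.span_minimal vec.subspace_span subsetI)
    fix x assume "x \<in> rows M"
    then obtain r where "x = M $ r" by (auto simp: rows_def row_def)
    then have "x = 0 \<or> x \<in> e ` C" using row row0 by blast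
    then show "x \<in> vec.span (e ` C)" by (auto intro: vec.span_zero vec.span_base)
  next
    fix x assume "x \<in> e ` C"
    then obtain c where c: "c \<in> C" "x = e c" by auto
    have "CARD('n) - pos c + 1 \<in> {1..CARD('n)}" using pos_ge_1[of c] pos_le_card[of c] by auto
    then have "w (CARD('n) - pos c + 1) \<in> {1..CARD('n)}" using permutes_in_image[OF assms] by blast
    then obtain r :: 'n where "pos r = w (CARD('n) - pos c + 1)" using pos_surj by auto
    then have "x = M $ r" using row c by simp
    then show "x \<in> vec.span (rows M)" by (auto simp: rows_def row_def intro!: vec.span_base)
  qed
  moreover have "vec.independent (e ` C)"
    by (rule vec.independent_mono[OF independent_cart_basis]) (auto simp: cart_basis_def e_def)
  ultimately have "vec.dim (rows M) = card (e ` C)" by (metis vec.dim_eq_card)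
  also have "\<dots> = card C" by (intro card_image) (auto simp: inj_on_def e_def axis_eq_axis)
  finally show ?thesis unfolding block_rank_def row_rank_def_gen M_def C_def .
qed

text \<open>The pivot permutations whose Bruhat cells satisfy the rank conditions of
  \<open>w\<close>. They form a finite set, so a Schubert variety is a finite union of
  cells.\<close>

definition schubert_position :: "(nat \<Rightarrow> nat) \<Rightarrow> ('n::{finite,linorder} \<Rightarrow> 'n) \<Rightarrow> bool" where
  "schubert_position w \<pi> \<longleftrightarrow> bij \<pi> \<and> (\<forall>i\<in>{1..CARD('n)}. \<forall>j\<in>{1..CARD('n)}.
     card {c. pos c \<le> i \<and> pos (\<pi> c) \<le> j} \<ge> block_rank (schubert_matrix w :: 'n cmat) i j)"

text \<open>The codimension of a Schubert variety is at least the length of \<open>w\<close>. The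
  rank conditions say that the inverse of \<pi> has block counts at least those of the permutation
  of the Schubert matrix; so it has at most as many inversions, and the latter permutation has
  \<open>CARD('n) choose 2\<close> minus the length of \<open>w\<close> many.\<close>

lemma card_free_entries_schubert:
  fixes \<pi> :: "'n::{finite,linorder} \<Rightarrow> 'n"
  assumes "w permutes {1..CARD('n)}" "schubert_position w \<pi>"
  shows "card (free_entries \<pi>) + perm_length CARD('n) w \<le> CARD('n) choose 2"
proof -
  let ?n = "CARD('n)"
  have bij\<pi>: "bij \<pi>" using assms(2) by (simp add: schubert_position_def)
  have eq: "inv \<pi> (\<pi> c) = c" "\<pi> (inv \<pi> r) = r" for c r
    using bij\<pi> by (simp_all add: bij_is_inj bij_is_surj surj_f_inv_f)
  have rng: "w (?n - pos c + 1) \<in> {1..?n}" for c :: 'n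
    using permutes_in_image[OF assms(1)] pos_ge_1[of c] pos_le_card[of c] by auto
  have "\<forall>c :: 'n. \<exists>r :: 'n. pos r = w (?n - pos c + 1)"
    using rng pos_surj by (metis atLeastAtMost_iff)
  \<comment> \<open>The permutation of the Schubert matrix, read by columns: it is \<open>w\<close>
    after reversal of the positions.\<close>
  then obtain q :: "'n \<Rightarrow> 'n" where q: "\<And>c. pos (q c) = w (?n - pos c + 1)" by metis
  have "inj q"
  proof (rule injI)
    fix c d assume "q c = q d"
    then have "w (?n - pos c + 1) = w (?n - pos d + 1)" using q by metis
    then have "?n - pos c + 1 = ?n - pos d + 1" using permutes_inj[OF assms(1)] by (auto simp: inj_eq)
    then have "pos c = pos d" using pos_le_card[of c] pos_le_card[of d] by linarith
    then show "c = d" by simp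
  qed
  then have bijq: "bij q" by (simp add: bij_def finite_UNIV_inj_surj)
  have "block_count q i j \<le> block_count (inv \<pi>) i j" for i j
  proof -
    have "block_count q i j = block_rank (schubert_matrix w :: 'n cmat) (pos i) (pos j)"
      unfolding block_rank_schubert_matrix[OF assms(1)] q[symmetric] by (simp add: block_count_def)
    also have "\<dots> \<le> card {c. pos c \<le> pos i \<and> pos (\<pi> c) \<le> pos j}"
      using assms(2) pos_ge_1 pos_le_card unfolding schubert_position_def by (metis atLeastAtMost_iff)
    also have "\<dots> = card (\<pi> ` {c. c \<le> i \<and> \<pi> c \<le> j})"
      using bij\<pi> by (simp add: card_image inj_on_subset[OF bij_is_inj])
    also have "\<pi> ` {c. c \<le> i \<and> \<pi> c \<le> j} = {c. c \<le> j \<and> inv \<pi> c \<le> i}"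
      using eq by (auto simp: image_iff) metis
    finally show ?thesis by (simp add: block_count_def)
  qed
  then have "card (free_entries \<pi>) \<le> card (inversions q)"
    unfolding card_free_entries[OF bij\<pi>] by (intro card_inversions_mono bij_imp_bij_inv bij\<pi> bijq)
  moreover have "card (inversions q) + perm_length ?n w = ?n choose 2"
  proof -
    define D where "D = {(a, b). a < b \<and> q a < q b}"
    \<comment> \<open>Reversing positions exchanges the two members of a pair, so the increasing
      pairs of \<open>q\<close> become the inversions of \<open>w\<close>.\<close>
    define f where "f = (\<lambda>(a :: 'n, b :: 'n). (?n - pos b + 1, ?n - pos a + 1))"
    have "f ` D = {(i, j). 1 \<le> i \<and> i < j \<and> j \<le> ?n \<and> w i > w j}"
    proof (intro antisym subsetI)
      fix x assume "x \<in> f ` D"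
      then obtain a b where ab: "a < b" "q a < q b" "x = (?n - pos b + 1, ?n - pos a + 1)"
        by (auto simp: D_def f_def)
      have less: "pos a < pos b" "pos (q a) < pos (q b)" using ab by simp_all
      have "?n - pos b + 1 < ?n - pos a + 1" "?n - pos a + 1 \<le> ?n"
        using less(1) pos_ge_1[of a] pos_le_card[of b] by linarith+
      then show "x \<in> {(i, j). 1 \<le> i \<and> i < j \<and> j \<le> ?n \<and> w i > w j}"
        using ab(3) less(2) unfolding q by simp
    next
      fix x assume "x \<in> {(i, j). 1 \<le> i \<and> i < j \<and> j \<le> ?n \<and> w i > w j}"
      then obtain i j where ij: "x = (i, j)" "1 \<le> i" "i < j" "j \<le> ?n" "w j < w i" by auto
      have "1 \<le> ?n - j + 1" "?n - j + 1 \<le> ?n" "1 \<le> ?n - i + 1" "?n - i + 1 \<le> ?n"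
        using ij by linarith+
      then obtain a b :: 'n where ab: "pos a = ?n - j + 1" "pos b = ?n - i + 1"
        using pos_surj[where 'n = 'n] by meson
      have "pos a < pos b" using ab ij by linarith
      moreover have "?n - pos a + 1 = j" "?n - pos b + 1 = i" using ab ij by linarith+
      moreover have "pos (q a) < pos (q b)" unfolding q calculation(2,3) by (rule ij(5))
      ultimately show "x \<in> f ` D" using ij(1) by (force simp: D_def f_def)
    qed
    moreover have "inj_on f D"
    proof (rule inj_onI, clarsimp simp: f_def)
      fix a b a' b' :: 'n assume "?n - pos b = ?n - pos b'" "?n - pos a = ?n - pos a'"
      then have "pos b = pos b'" "pos a = pos a'"
        using pos_le_card[of a] pos_le_card[of a'] pos_le_card[of b] pos_le_card[of b'] by linarith+
      then show "a = a' \<and> b = b'" by simp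
    qed
    ultimately have "perm_length ?n w = card D" unfolding perm_length_def by (metis card_image)
    moreover have "card (inversions q \<union> D) = card (inversions q) + card D"
      by (intro card_Un_disjoint) (auto simp: inversions_def D_def)
    moreover have "inversions q \<union> D = {(a, b). a < b}"
    proof -
      have "q a < q b \<or> q b < q a" if "a < b" for a b
        using that \<open>inj q\<close> by (metis inj_eq less_irrefl linorder_neqE)
      then show ?thesis by (auto simp: inversions_def D_def)
    qed
    ultimately show ?thesis using card_less_pairs[where 'n = 'n] by simp
  qed
  ultimately show ?thesis by linarith
qed

section \<open>Formal polynomials and polynomial functions\<close>

definition monomial_value :: "('v \<Rightarrow>\<^sub>0 nat) \<Rightarrow> ('v \<Rightarrow> complex) \<Rightarrow> complex" where
  "monomial_value m x = (\<Prod>v\<in>Poly_Mapping.keys m. x v ^ Poly_Mapping.lookup m v)"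

lemma monomial_value_superset:
  "finite V \<Longrightarrow> Poly_Mapping.keys m \<subseteq> V \<Longrightarrow>
    monomial_value m x = (\<Prod>v\<in>V. x v ^ Poly_Mapping.lookup m v)"
  unfolding monomial_value_def by (rule prod.mono_neutral_left) (auto simp: in_keys_iff)

lemma monomial_value_add: "monomial_value (m + m') x = monomial_value m x * monomial_value m' x"
proof -
  let ?V = "Poly_Mapping.keys m \<union> Poly_Mapping.keys m'"
  have "Poly_Mapping.keys (m + m') \<subseteq> ?V" by (rule Poly_Mapping.keys_add)
  then show ?thesis
    by (simp add: monomial_value_superset[of ?V] Poly_Mapping.lookup_add power_add prod.distrib)
qed

lemma cpoly_value_eq:
  "cpoly_value p x = (\<Sum>m\<in>Poly_Mapping.keys p. Poly_Mapping.lookup p m * monomial_value m x)"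
  by (simp add: cpoly_value_def monomial_value_def)

lemma cpoly_value_superset:
  "finite M \<Longrightarrow> Poly_Mapping.keys p \<subseteq> M \<Longrightarrow>
    cpoly_value p x = (\<Sum>m\<in>M. Poly_Mapping.lookup p m * monomial_value m x)"
  unfolding cpoly_value_eq by (rule sum.mono_neutral_left) (auto simp: in_keys_iff)

lemma cpoly_value_add: "cpoly_value (p + q) x = cpoly_value p x + cpoly_value q x"
proof -
  let ?M = "Poly_Mapping.keys p \<union> Poly_Mapping.keys q"
  have "Poly_Mapping.keys (p + q) \<subseteq> ?M" by (rule Poly_Mapping.keys_add)
  then show ?thesis
    by (simp add: cpoly_value_superset[of ?M] Poly_Mapping.lookup_add distrib_right sum.distrib)
qed

lemma cpoly_value_0 [simp]: "cpoly_value 0 x = 0"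
  by (simp add: cpoly_value_def)

lemma cpoly_value_sum: "cpoly_value (\<Sum>i\<in>I. p i) x = (\<Sum>i\<in>I. cpoly_value (p i) x)"
  by (induction I rule: infinite_finite_induct) (auto simp: cpoly_value_add)

lemma cpoly_value_single: "cpoly_value (Poly_Mapping.single m c) x = c * monomial_value m x"
  by (simp add: cpoly_value_eq)

lemma poly_mapping_sum_single:
  "p = (\<Sum>m\<in>Poly_Mapping.keys p. Poly_Mapping.single m (Poly_Mapping.lookup p m))"
proof (rule poly_mapping_eqI)
  fix k
  have "Poly_Mapping.lookup (\<Sum>m\<in>Poly_Mapping.keys p. Poly_Mapping.single m (Poly_Mapping.lookup p m)) k =
      (\<Sum>m\<in>Poly_Mapping.keys p. if m = k then Poly_Mapping.lookup p m else 0)"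
    unfolding Poly_Mapping.lookup_sum by (intro sum.cong) (auto simp: lookup_single when_def)
  also have "\<dots> = Poly_Mapping.lookup p k"
    by (simp add: in_keys_iff)
  finally show "Poly_Mapping.lookup p k =
      Poly_Mapping.lookup (\<Sum>m\<in>Poly_Mapping.keys p. Poly_Mapping.single m (Poly_Mapping.lookup p m)) k" ..
qed

lemma cpoly_mult_eq:
  fixes p q :: "'v cpoly"
  shows "p * q = (\<Sum>m\<in>Poly_Mapping.keys p. \<Sum>m'\<in>Poly_Mapping.keys q.
    Poly_Mapping.single (m + m') (Poly_Mapping.lookup p m * Poly_Mapping.lookup q m'))"
  by (subst poly_mapping_sum_single[of p], subst poly_mapping_sum_single[of q])
    (simp add: sum_product mult_single)

lemma cpoly_value_mult: "cpoly_value (p * q) x = cpoly_value p x * cpoly_value q x"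
proof -
  have "cpoly_value (p * q) x = (\<Sum>m\<in>Poly_Mapping.keys p. \<Sum>m'\<in>Poly_Mapping.keys q.
    (Poly_Mapping.lookup p m * monomial_value m x) * (Poly_Mapping.lookup q m' * monomial_value m' x))"
    unfolding cpoly_mult_eq cpoly_value_sum cpoly_value_single monomial_value_add
    by (simp add: mult_ac)
  then show ?thesis unfolding cpoly_value_eq sum_product .
qed

lemma cpoly_value_polyfun: "cpoly_value p \<in> polyfun UNIV UNIV"
  unfolding cpoly_value_def
  by (intro polyfun_sum polyfun.mult polyfun_prod polyfun_power polyfun.const polyfun.var) auto

definition cpoly_over :: "complex set \<Rightarrow> 'v set \<Rightarrow> 'v cpoly \<Rightarrow> bool" where
  "cpoly_over K S p \<longleftrightarrow> (\<forall>m. Poly_Mapping.lookup p m \<in> K) \<and>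
    (\<forall>m\<in>Poly_Mapping.keys p. Poly_Mapping.keys m \<subseteq> S)"

text \<open>Serves two coefficient sets: \<open>\<rat>\<close> for algebraic independence, and all
  complex numbers for Zariski open sets.\<close>

lemma polyfun_imp_cpoly:
  assumes "f \<in> polyfun K S" "0 \<in> K" "1 \<in> K"
    and add: "\<And>a b. a \<in> K \<Longrightarrow> b \<in> K \<Longrightarrow> a + b \<in> K"
    and mult: "\<And>a b. a \<in> K \<Longrightarrow> b \<in> K \<Longrightarrow> a * b \<in> K"
  shows "\<exists>p. cpoly_over K S p \<and> cpoly_value p = f"
proof -
  have 0: "cpoly_over K S 0" using assms(2) by (simp add: cpoly_over_def)
  have single: "cpoly_over K S (Poly_Mapping.single m c)"
    if "c \<in> K" "Poly_Mapping.keys m \<subseteq> S" for m c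
    using that assms(2) by (auto simp: cpoly_over_def lookup_single when_def)
  have plus: "cpoly_over K S (p + q)" if "cpoly_over K S p" "cpoly_over K S q" for p q
    using that Poly_Mapping.keys_add[of p q] add
    unfolding cpoly_over_def Poly_Mapping.lookup_add by blast
  have sum: "cpoly_over K S (sum p I)" if "\<And>i. i \<in> I \<Longrightarrow> cpoly_over K S (p i)"
    for p :: "'i \<Rightarrow> 'a cpoly" and I
    using that by (induction I rule: infinite_finite_induct) (auto intro: 0 plus)
  have prod: "cpoly_over K S (p * q)" if p: "cpoly_over K S p" and q: "cpoly_over K S q" for p q
    unfolding cpoly_mult_eq
  proof (intro sum single)
    fix m m' assume "m \<in> Poly_Mapping.keys p" "m' \<in> Poly_Mapping.keys q"
    then show "Poly_Mapping.keys (m + m') \<subseteq> S"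
      using p q Poly_Mapping.keys_add[of m m'] unfolding cpoly_over_def by blast
  qed (use p q mult in \<open>auto simp: cpoly_over_def\<close>)
  show ?thesis
    using assms(1)
  proof induction
    case (const c)
    have "cpoly_value (Poly_Mapping.single 0 c) = (\<lambda>e. c)"
      by (rule ext) (simp add: cpoly_value_single monomial_value_def)
    then show ?case using single[OF const, of 0] by auto
  next
    case (var v)
    have "cpoly_value (Poly_Mapping.single (Poly_Mapping.single v 1) 1) = (\<lambda>e. e v)"
      by (rule ext) (simp add: cpoly_value_single monomial_value_def)
    then show ?case using single[OF assms(3), of "Poly_Mapping.single v 1"] var by force
  next
    case (add f g)
    then obtain p q where "cpoly_over K S p" "cpoly_value p = f" "cpoly_over K S q" "cpoly_value q = g"
      by blast
    moreover from this have "cpoly_value (p + q) = (\<lambda>e. f e + g e)" by (auto simp: cpoly_value_add)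
    ultimately show ?case using plus by blast
  next
    case (mult f g)
    then obtain p q where "cpoly_over K S p" "cpoly_value p = f" "cpoly_over K S q" "cpoly_value q = g"
      by blast
    moreover from this have "cpoly_value (p * q) = (\<lambda>e. f e * g e)" by (auto simp: cpoly_value_mult)
    ultimately show ?case using prod by blast
  qed
qed

lemma alg_independent_imp_generic_on:
  assumes "alg_independent_over_rats x S"
  shows "generic_on S x"
  unfolding generic_on_def
proof (intro ballI impI allI)
  fix f y assume f: "f \<in> polyfun \<rat> S" "f x = 0"
  then obtain p where p: "cpoly_over \<rat> S p" "cpoly_value p = f"
    using polyfun_imp_cpoly[of f \<rat> S] by auto
  then have "p = 0"
    using assms f(2) unfolding alg_independent_over_rats_def cpoly_over_def by blast
  then show "f y = 0" using p(2) by auto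
qed

section \<open>Definability of Schubert conditions\<close>

text \<open>Variables \<open>(Inl k, r, c)\<close> are the entries of the given triple of matrices, variables
  \<open>(Inr i, r, c)\<close> the entries of auxiliary matrices.\<close>

type_synonym 'n mat_env = "(3 + nat) \<times> 'n \<times> 'n \<Rightarrow> complex"

definition mvar :: "'n::finite mat_env \<Rightarrow> 3 + nat \<Rightarrow> 'n cmat" where
  "mvar e k = (\<chi> r c. e (k, r, c))"

definition set_mvar :: "'n::finite mat_env \<Rightarrow> 3 + nat \<Rightarrow> 'n cmat \<Rightarrow> 'n mat_env" where
  "set_mvar e k M = (\<lambda>(i, r, c). if i = k then M $ r $ c else e (i, r, c))"

lemma mvar_set_mvar [simp]: "mvar (set_mvar e k M) i = (if i = k then M else mvar e i)"
  by (simp add: mvar_def set_mvar_def vec_eq_iff)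

lemma set_mvar_apply: "set_mvar e k M (i, r, c) = (if i = k then M $ r $ c else e (i, r, c))"
  by (simp add: set_mvar_def)

lemma definable_ex_matrix:
  assumes "definable P"
  shows "definable (\<lambda>e. \<exists>M. P (set_mvar e k M))"
proof -
  let ?V = "{k} \<times> (UNIV :: ('a \<times> 'a) set)"
  have "(\<exists>e'. P (override_on e e' ?V)) = (\<exists>M. P (set_mvar e k M))" for e
  proof
    assume "\<exists>e'. P (override_on e e' ?V)"
    then obtain e' where "P (override_on e e' ?V)" by blast
    moreover have "override_on e e' ?V = set_mvar e k (mvar e' k)"
      by (auto simp: override_on_def set_mvar_def mvar_def)
    ultimately show "\<exists>M. P (set_mvar e k M)" by metis
  next
    assume "\<exists>M. P (set_mvar e k M)"
    then obtain M where "P (set_mvar e k M)" by blast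
    moreover have "override_on e (set_mvar e k M) ?V = set_mvar e k M"
      by (auto simp: override_on_def set_mvar_def)
    ultimately show "\<exists>e'. P (override_on e e' ?V)" by metis
  qed
  then show ?thesis using definable_ex_override[OF _ assms, of ?V] by simp
qed

definition matpoly :: "('n::finite mat_env \<Rightarrow> 'n cmat) \<Rightarrow> bool" where
  "matpoly A \<longleftrightarrow> (\<forall>r c. (\<lambda>e. A e $ r $ c) \<in> polyfun \<rat> UNIV)"

lemma matpoly_mvar: "matpoly (\<lambda>e. mvar e k)"
  unfolding matpoly_def mvar_def by (auto intro: polyfun.var)

lemma matpoly_mult: "matpoly A \<Longrightarrow> matpoly B \<Longrightarrow> matpoly (\<lambda>e. A e ** B e)"
  unfolding matpoly_def by (auto intro!: polyfun_matrix_mult)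

lemma definable_entry_eq: "matpoly A \<Longrightarrow> c0 \<in> \<rat> \<Longrightarrow> definable (\<lambda>e. A e $ r $ c = c0)"
  unfolding matpoly_def by (intro definable_eq) (auto intro: polyfun_rat)

lemma definable_matrix_eq:
  assumes "matpoly A" "matpoly B"
  shows "definable (\<lambda>e. A e = B e)"
proof -
  have "definable (\<lambda>e. \<forall>(r, c)\<in>UNIV. A e $ r $ c = B e $ r $ c)"
    unfolding split_def using assms
    by (intro definable_ball definable_eq) (auto simp: matpoly_def)
  then show ?thesis by (simp add: vec_eq_iff)
qed

lemma definable_invertible: "matpoly A \<Longrightarrow> definable (\<lambda>e. invertible (A e))"
  unfolding invertible_det_nz matpoly_def by (intro definable.neg definable.zero polyfun_det) auto

lemma definable_all_imp_entry:
  assumes "matpoly A" "c0 \<in> \<rat>"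
  shows "definable (\<lambda>e. \<forall>r c. Q r c \<longrightarrow> A e $ r $ c = c0)"
proof -
  have "definable (\<lambda>e. \<forall>x\<in>{(r, c). Q r c}. A e $ fst x $ snd x = c0)"
    by (intro definable_ball definable_entry_eq assms) auto
  then show ?thesis by simp
qed

lemma definable_upper_tri: "matpoly A \<Longrightarrow> definable (\<lambda>e. upper_tri (A e))"
  unfolding upper_tri_def by (intro definable_all_imp_entry) auto

lemma normal_form_iff:
  "normal_form \<pi> m \<longleftrightarrow> (\<forall>r c. r = \<pi> c \<longrightarrow> m $ r $ c = 1) \<and>
    (\<forall>r c. \<pi> c < r \<or> (\<exists>k<c. r = \<pi> k) \<longrightarrow> m $ r $ c = 0)"
  unfolding normal_form_def by auto

lemma definable_normal_form: "matpoly A \<Longrightarrow> definable (\<lambda>e. normal_form \<pi> (A e))"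
  unfolding normal_form_iff by (intro definable.conj definable_all_imp_entry) auto

text \<open>The Schubert condition in terms of matrices. For fixed \<pi> it is a system of
  polynomial equations with quantified \<open>m\<close> and \<open>b\<close>, and \<pi> ranges over
  a finite set. The same factorization supplies the parameters that are counted later.\<close>

definition in_position :: "(nat \<Rightarrow> nat) \<Rightarrow> 'n::{finite,linorder} cmat \<Rightarrow> 'n cmat \<Rightarrow> bool" where
  "in_position w x h \<longleftrightarrow> (\<exists>\<pi>\<in>{\<pi>. schubert_position w \<pi>}. \<exists>m b.
     normal_form \<pi> m \<and> upper_tri b \<and> x = h ** m ** b)"

text \<open>The normal form of \<open>x\<close> relative to \<open>h\<close> determines all
  dimensions of intersections, so membership is a condition on its pivots only.\<close>

lemma schubert_variety_iff:
  fixes x h :: "'n::{finite,linorder} cmat"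
  assumes "invertible x" "invertible h"
  shows "matrix_flag h \<in> schubert_variety w (matrix_flag x) \<longleftrightarrow> in_position w x h"
proof
  assume L: "matrix_flag h \<in> schubert_variety w (matrix_flag x)"
  obtain h' where h': "h ** h' = mat 1" "h' ** h = mat 1" using assms(2) unfolding invertible_def by blast
  have "invertible (h' ** x)" using h' assms(1) by (intro invertible_mult) (auto simp: invertible_def)
  then obtain \<pi> m b where mb: "bij \<pi>" "normal_form \<pi> m" "upper_tri b" "h' ** x = m ** b"
    using normal_form_exists by blast
  have "x = (h ** h') ** x" by (simp add: h')
  also have "\<dots> = h ** (m ** b)" unfolding mb(4)[symmetric] by (simp only: matrix_mul_assoc)
  also have "\<dots> = h ** m ** b" by (rule matrix_mul_assoc)
  finally have x: "x = h ** m ** b" .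
  have "vec.dim (matrix_flag x i \<inter> matrix_flag h j) = card {c. pos c \<le> i \<and> pos (\<pi> c) \<le> j}" for i j
    using dim_relative_position[OF bij_is_inj[OF mb(1)] mb(2,3), of h] assms(1) x by simp
  then have "schubert_position w \<pi>"
    using L mb(1) by (simp add: schubert_variety_def schubert_position_def)
  then show "in_position w x h" unfolding in_position_def using mb x by blast
next
  assume "in_position w x h"
  then obtain \<pi> m b where mb: "schubert_position w \<pi>" "normal_form \<pi> m" "upper_tri b" "x = h ** m ** b"
    unfolding in_position_def by blast
  have "bij \<pi>" using mb(1) by (simp add: schubert_position_def)
  then have "vec.dim (matrix_flag x i \<inter> matrix_flag h j) = card {c. pos c \<le> i \<and> pos (\<pi> c) \<le> j}" for i j
    using dim_relative_position[OF bij_is_inj mb(2,3), of h] assms(1) mb(4) by simp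
  then show "matrix_flag h \<in> schubert_variety w (matrix_flag x)"
    using mb(1) complete_flag_matrix_flag[OF assms(2)]
    by (simp add: schubert_variety_def schubert_position_def)
qed

lemma definable_in_position:
  "definable (\<lambda>e :: 'n::{finite,linorder} mat_env. in_position w (mvar e (Inl l)) (mvar e (Inr k)))"
proof -
  \<comment> \<open>The two slots after \<open>k\<close> hold the matrices to be quantified; they
    differ from slot \<open>k\<close>, so quantification leaves the matrix of the flag
    alone.\<close>
  have "definable (\<lambda>e :: 'n mat_env. normal_form \<pi> (mvar e (Inr (k + 1))) \<and> upper_tri (mvar e (Inr (k + 2))) \<and>
      mvar e (Inl l) = mvar e (Inr k) ** mvar e (Inr (k + 1)) ** mvar e (Inr (k + 2)))" for \<pi>
    by (intro definable.conj definable_normal_form definable_upper_tri definable_matrix_eq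
        matpoly_mult matpoly_mvar)
  from definable_ex_matrix[OF definable_ex_matrix[OF this, where k = "Inr (k + 2)"],
      where k = "Inr (k + 1)"]
  have "definable (\<lambda>e :: 'n mat_env. \<exists>m b. normal_form \<pi> m \<and> upper_tri b \<and>
      mvar e (Inl l) = mvar e (Inr k) ** m ** b)" for \<pi>
    by simp
  then show ?thesis unfolding in_position_def by (intro definable_bex finite)
qed

text \<open>Matrices rather than flags, because formulas speak about entries. A solution may be
  replaced by any other matrix of the same flag, so the number of interest is that of the image
  under \<open>matrix_flag\<close>.\<close>

definition solutions :: "(3 \<Rightarrow> nat \<Rightarrow> nat) \<Rightarrow> (3 \<Rightarrow> 'n::{finite,linorder} cmat) \<Rightarrow> 'n cmat set" where
  "solutions W X = {h. invertible h \<and> (\<forall>l. in_position (W l) (X l) h)}"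

lemma definable_solutions:
  "definable (\<lambda>e :: 'n::{finite,linorder} mat_env. mvar e (Inr k) \<in> solutions W (\<lambda>l. mvar e (Inl l)))"
proof -
  have "definable (\<lambda>e :: 'n mat_env. invertible (mvar e (Inr k)) \<and>
      (\<forall>l\<in>UNIV. in_position (W l) (mvar e (Inl l)) (mvar e (Inr k))))"
    by (intro definable.conj definable_invertible definable_ball definable_in_position matpoly_mvar finite)
  then show ?thesis by (simp add: solutions_def)
qed

definition triple :: "'a \<Rightarrow> 'a \<Rightarrow> 'a \<Rightarrow> 3 \<Rightarrow> 'a" where
  "triple u v w l = (if l = 1 then u else if l = 2 then v else w)"

lemma schubert_intersection_eq:
  fixes X :: "3 \<Rightarrow> 'n::{finite,linorder} cmat"
  assumes "\<And>l. invertible (X l)"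
  shows "schubert_intersection u v w (\<lambda>l. matrix_flag (X l)) = matrix_flag ` solutions (triple u v w) X"
proof -
  have tr: "triple u v w 1 = u" "triple u v w 2 = v" "triple u v w 3 = w"
    by (simp_all add: triple_def)
  have iff: "matrix_flag h \<in> schubert_intersection u v w (\<lambda>l. matrix_flag (X l)) \<longleftrightarrow>
      h \<in> solutions (triple u v w) X" if "invertible h" for h
    unfolding schubert_intersection_def solutions_def forall_3 tr
    using that by (simp add: schubert_variety_iff[OF assms that])
  show ?thesis
  proof (intro antisym subsetI)
    fix F assume F: "F \<in> schubert_intersection u v w (\<lambda>l. matrix_flag (X l))"
    then have "complete_flag F" by (simp add: schubert_intersection_def schubert_variety_def)
    then obtain h where "invertible h" "F = matrix_flag h" using complete_flag_exists_matrix by blast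
    then show "F \<in> matrix_flag ` solutions (triple u v w) X" using F iff by blast
  next
    fix F assume "F \<in> matrix_flag ` solutions (triple u v w) X"
    then obtain h where "h \<in> solutions (triple u v w) X" "F = matrix_flag h" by blast
    moreover from this have "invertible h" by (simp add: solutions_def)
    ultimately show "F \<in> schubert_intersection u v w (\<lambda>l. matrix_flag (X l))" using iff by blast
  qed
qed

section \<open>Definability of the number of solutions\<close>

lemma definable_matrix_flag_eq:
  assumes "definable (\<lambda>e :: 'n::{finite,linorder} mat_env. P e)"
    and "\<And>e. P e \<Longrightarrow> invertible (mvar e (Inr i)) \<and> invertible (mvar e (Inr j))"
  shows "definable (\<lambda>e. P e \<and> matrix_flag (mvar e (Inr i)) = matrix_flag (mvar e (Inr j)))"
proof -
  \<comment> \<open>Larger than both \<open>i\<close> and \<open>j\<close>, hence a fresh slot for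
    the triangular matrix.\<close>
  let ?k = "Inr (i + j + 1) :: 3 + nat"
  have "definable (\<lambda>e :: 'n mat_env. upper_tri (mvar e ?k) \<and> mvar e (Inr i) = mvar e (Inr j) ** mvar e ?k)"
    by (intro definable.conj definable_upper_tri definable_matrix_eq matpoly_mult matpoly_mvar)
  from definable.conj[OF assms(1) definable_ex_matrix[OF this, of ?k]]
  have "definable (\<lambda>e :: 'n mat_env. P e \<and> (\<exists>b. upper_tri b \<and> mvar e (Inr i) = mvar e (Inr j) ** b))"
    by simp
  moreover have "(P e \<and> (\<exists>b. upper_tri b \<and> mvar e (Inr i) = mvar e (Inr j) ** b)) =
      (P e \<and> matrix_flag (mvar e (Inr i)) = matrix_flag (mvar e (Inr j)))" for e
    using assms(2)[of e] matrix_flag_eq_imp[of "mvar e (Inr j)" "mvar e (Inr i)"]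
    by (metis matrix_flag_upper_tri)
  ultimately show ?thesis by simp
qed

text \<open>For fixed \<open>c\<close> this is first-order: there are \<open>c\<close>
  representatives with distinct images, and they exhaust all images.\<close>

lemma finite_card_image_iff:
  "finite (f ` H) \<and> card (f ` H) = c \<longleftrightarrow>
    (\<exists>g. (\<forall>i<c. g i \<in> H) \<and> (\<forall>i<c. \<forall>j<i. f (g i) \<noteq> f (g j)) \<and> (\<forall>h\<in>H. \<exists>i<c. f h = f (g i)))"
    (is "?L \<longleftrightarrow> ?R")
proof
  assume ?L
  then obtain k where k: "bij_betw k {..<c} (f ` H)"
    using ex_bij_betw_nat_finite[of "f ` H"] by (auto simp: lessThan_atLeast0)
  then have "\<forall>i\<in>{..<c}. \<exists>h\<in>H. k i = f h" by (auto simp: bij_betw_def)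
  then obtain g where g: "\<forall>i\<in>{..<c}. g i \<in> H \<and> k i = f (g i)" by metis
  have "f (g i) \<noteq> f (g j)" if "i < c" "j < i" for i j
    using that k g by (metis bij_betw_def inj_onD lessThan_iff less_irrefl less_trans)
  moreover have "\<exists>i<c. f h = f (g i)" if "h \<in> H" for h
    using that k g by (metis bij_betw_def imageE imageI lessThan_iff)
  ultimately show ?R
    using g by (intro exI[of _ g]) auto
next
  assume ?R
  then obtain g where g: "\<forall>i<c. g i \<in> H" "\<forall>i<c. \<forall>j<i. f (g i) \<noteq> f (g j)"
    "\<forall>h\<in>H. \<exists>i<c. f h = f (g i)" by blast
  have "f ` H = (\<lambda>i. f (g i)) ` {..<c}" using g(1,3) by force
  moreover have "inj_on (\<lambda>i. f (g i)) {..<c}"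
    using g(2) by (intro linorder_inj_onI') (metis lessThan_iff)
  ultimately show ?L by (simp add: card_image)
qed

lemma definable_card_solutions:
  "definable (\<lambda>e :: 'n::{finite,linorder} mat_env.
    finite (matrix_flag ` solutions W (\<lambda>l. mvar e (Inl l))) \<and>
    card (matrix_flag ` solutions W (\<lambda>l. mvar e (Inl l))) = c)"
proof -
  define H where "H = (\<lambda>e :: 'n mat_env. solutions W (\<lambda>l. mvar e (Inl l)))"
  have inv: "invertible h" if "h \<in> H e" for h e using that by (simp add: H_def solutions_def)
  have Hset: "H (set_mvar e (Inr k) M) = H e" for e k M by (simp add: H_def)
  have sol: "definable (\<lambda>e. mvar e (Inr k) \<in> H e)" for k
    unfolding H_def by (rule definable_solutions)
  define same where "same = (\<lambda>i j (e :: 'n mat_env). (mvar e (Inr i) \<in> H e \<and> mvar e (Inr j) \<in> H e) \<and>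
     matrix_flag (mvar e (Inr i)) = matrix_flag (mvar e (Inr j)))"
  have same: "definable (same i j)" for i j
    unfolding same_def by (intro definable_matrix_flag_eq definable.conj sol) (auto intro: inv)
  \<comment> \<open>Slots below \<open>c\<close> hold the representatives, and slot \<open>c\<close>
    the arbitrary further solution that has to agree with one of them.\<close>
  define Q where "Q = (\<lambda>e. (\<forall>i\<in>{..<c}. mvar e (Inr i) \<in> H e) \<and>
     (\<forall>i\<in>{..<c}. \<forall>j\<in>{..<i}. \<not> same i j e) \<and>
     \<not> (\<exists>M. mvar (set_mvar e (Inr c) M) (Inr c) \<in> H (set_mvar e (Inr c) M) \<and>
         \<not> (\<exists>i\<in>{..<c}. same c i (set_mvar e (Inr c) M))))"
  have defQ: "definable Q"
    unfolding Q_def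
    by (intro definable.conj definable.neg definable_ball definable_bex sol same definable_ex_matrix[where
        P = "\<lambda>e. mvar e (Inr c) \<in> H e \<and> \<not> (\<exists>i\<in>{..<c}. same c i e)"]) auto
  have Q: "Q e \<longleftrightarrow> (\<forall>i<c. mvar e (Inr i) \<in> H e) \<and>
     (\<forall>i<c. \<forall>j<i. matrix_flag (mvar e (Inr i)) \<noteq> matrix_flag (mvar e (Inr j))) \<and>
     (\<forall>h\<in>H e. \<exists>i<c. matrix_flag h = matrix_flag (mvar e (Inr i)))" for e
    unfolding Q_def same_def Hset by fastforce
  define V where "V = (Inr ` {..<c} :: (3 + nat) set) \<times> (UNIV :: ('n \<times> 'n) set)"
  have "finite V" by (simp add: V_def)
  have HV: "H (override_on e e' V) = H e" for e e'
  proof -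
    have "mvar (override_on e e' V) (Inl l) = mvar e (Inl l)" for l
      by (auto simp: mvar_def override_on_def V_def vec_eq_iff)
    then show ?thesis by (simp add: H_def)
  qed
  have mV: "mvar (override_on e e' V) (Inr i) = mvar e' (Inr i)" if "i < c" for e e' i
    using that by (auto simp: mvar_def override_on_def V_def)
  have "(\<exists>e'. Q (override_on e e' V)) \<longleftrightarrow>
      (\<exists>g. (\<forall>i<c. g i \<in> H e) \<and> (\<forall>i<c. \<forall>j<i. matrix_flag (g i) \<noteq> matrix_flag (g j)) \<and>
        (\<forall>h\<in>H e. \<exists>i<c. matrix_flag h = matrix_flag (g i)))" (is "?L \<longleftrightarrow> ?R") for e
  proof
    assume ?L
    then obtain e' where "Q (override_on e e' V)" by blast
    then show ?R
      unfolding Q HV by (intro exI[of _ "\<lambda>i. mvar (override_on e e' V) (Inr i)"])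
  next
    assume ?R
    then obtain g where g: "\<forall>i<c. g i \<in> H e" "\<forall>i<c. \<forall>j<i. matrix_flag (g i) \<noteq> matrix_flag (g j)"
      "\<forall>h\<in>H e. \<exists>i<c. matrix_flag h = matrix_flag (g i)" by blast
    define e' :: "'n mat_env" where
      "e' = (\<lambda>(k, r, c). case k of Inl _ \<Rightarrow> 0 | Inr i \<Rightarrow> g i $ r $ c)"
    have "mvar e' (Inr i) = g i" for i by (simp add: mvar_def e'_def vec_eq_iff)
    then have "mvar (override_on e e' V) (Inr i) = g i" if "i < c" for i using mV[OF that] by simp
    then have "Q (override_on e e' V)" unfolding Q HV using g by (simp, metis)
    then show ?L by blast
  qed
  then show ?thesis
    using definable_ex_override[OF \<open>finite V\<close> defQ] unfolding H_def finite_card_image_iff by simp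
qed

section \<open>Generic triples of flags\<close>

type_synonym 'n mat_triple = "3 \<times> 'n \<times> 'n \<Rightarrow> complex"

text \<open>Auxiliary slots receive 0, the default value for variables outside \<open>S\<close> in
  \<open>generic_definable_nbhd\<close>.\<close>

definition embed :: "'n mat_triple \<Rightarrow> 'n mat_env" where
  "embed x = (\<lambda>(k, r, c). case k of Inl l \<Rightarrow> x (l, r, c) | Inr _ \<Rightarrow> 0)"

definition triple_vars :: "((3 + nat) \<times> 'n \<times> 'n) set" where
  "triple_vars = range Inl \<times> UNIV"

lemma embed_Inl [simp]: "embed x (Inl l, r, c) = x (l, r, c)"
  by (simp add: embed_def)

lemma embed_outside: "v \<notin> triple_vars \<Longrightarrow> embed x v = 0"
  by (cases v) (auto simp: embed_def triple_vars_def split: sum.splits)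

lemma mvar_embed: "mvar (embed x) (Inl l) = entry_matrix x l"
  by (simp add: mvar_def entry_matrix_def)

lemma triple_vars_alt: "triple_vars = (\<lambda>(l, r, c). (Inl l, r, c)) ` UNIV"
  by (auto simp: triple_vars_def image_iff)

lemma finite_triple_vars: "finite (triple_vars :: ((3 + nat) \<times> 'n::finite \<times> 'n) set)"
  by (simp add: triple_vars_alt)

lemma card_triple_vars: "card (triple_vars :: ((3 + nat) \<times> 'n::finite \<times> 'n) set) = 3 * CARD('n)\<^sup>2"
  unfolding triple_vars_alt by (subst card_image) (auto simp: inj_on_def power2_eq_square)

lemma polyfun_embed:
  assumes "f \<in> polyfun K triple_vars"
  shows "(\<lambda>x. f (embed x)) \<in> polyfun K UNIV"
  using assms
proof (rule polyfun_compose)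
  fix v :: "(3 + nat) \<times> 'b \<times> 'b" assume "v \<in> triple_vars"
  then obtain l r c where "v = (Inl l, r, c)" by (auto simp: triple_vars_def)
  then show "(\<lambda>x. embed x v) \<in> polyfun K UNIV" by (simp add: polyfun.var)
qed

lemma generic_on_embed:
  assumes "generic_on UNIV x"
  shows "generic_on triple_vars (embed x)"
  unfolding generic_on_def
proof (intro ballI impI allI)
  fix f and e :: "'a mat_env" assume f: "f \<in> polyfun \<rat> triple_vars" "f (embed x) = 0"
  have "f (embed (\<lambda>(l, r, c). e (Inl l, r, c))) = 0"
    using generic_onD[OF assms polyfun_embed[OF f(1)] f(2)] .
  moreover have "f (embed (\<lambda>(l, r, c). e (Inl l, r, c))) = f e"
    by (rule polyfun_cong[OF f(1)]) (auto simp: triple_vars_def)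
  ultimately show "f e = 0" by simp
qed

lemma polyfun_entry_matrix: "(\<lambda>x. entry_matrix x l $ r $ c) \<in> polyfun K UNIV"
  by (simp add: entry_matrix_def polyfun.var)

lemma generic_invertible:
  assumes "generic_on UNIV x"
  shows "invertible (entry_matrix x l :: 'n::finite cmat)"
proof -
  have poly: "(\<lambda>x. det (entry_matrix x l :: 'n cmat)) \<in> polyfun \<rat> UNIV"
    by (intro polyfun_det polyfun_entry_matrix) auto
  have "entry_matrix (\<lambda>(l, r, c). if r = c then 1 else 0) l = (mat 1 :: 'n cmat)"
    by (simp add: entry_matrix_def mat_def)
  then have "det (entry_matrix (\<lambda>(l, r, c). if r = c then 1 else 0) l :: 'n cmat) \<noteq> 0" by simp
  then have "det (entry_matrix x l :: 'n cmat) \<noteq> 0" using generic_onD[OF assms poly] by blast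
  then show ?thesis by (simp add: invertible_det_nz)
qed

lemma finite_if_finite_entries:
  fixes N :: "'n::finite cmat set"
  assumes "\<And>r c. finite ((\<lambda>m. m $ r $ c) ` N)"
  shows "finite N"
proof (rule finite_imageD)
  let ?\<phi> = "\<lambda>m :: 'n cmat. \<lambda>(r, c). m $ r $ c"
  have "?\<phi> ` N \<subseteq> (\<Pi>\<^sub>E (r, c)\<in>UNIV. (\<lambda>m. m $ r $ c) ` N)" by (auto simp: PiE_iff)
  moreover have "finite (\<Pi>\<^sub>E (r, c)\<in>UNIV. (\<lambda>m. m $ r $ c) ` N)"
    using assms by (intro finite_PiE) auto
  ultimately show "finite (?\<phi> ` N)" by (rule finite_subset)
  show "inj_on ?\<phi> N" by (auto simp: inj_on_def vec_eq_iff fun_eq_iff)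
qed

lemma solutions_cong_flag:
  assumes "\<And>l. invertible (X l)" "h \<in> solutions W X" "invertible h'" "matrix_flag h' = matrix_flag h"
  shows "h' \<in> solutions W X"
proof -
  have h: "invertible h" "\<And>l. in_position (W l) (X l) h" using assms(2) by (auto simp: solutions_def)
  have "in_position (W l) (X l) h'" for l
    using h(2)[of l] unfolding schubert_variety_iff[OF assms(1) h(1), symmetric]
      schubert_variety_iff[OF assms(1,3), symmetric] assms(4) .
  then show ?thesis using assms(3) by (simp add: solutions_def)
qed

lemma card_upper_entries: "card {(r, c :: 'n::{finite,linorder}). \<not> c < r} + (CARD('n) choose 2) = CARD('n)\<^sup>2"
proof -
  have "{(r, c :: 'n). c < r} = prod.swap ` {(r, c). r < c}" by (auto simp: image_iff)
  then have "card {(r, c :: 'n). c < r} = CARD('n) choose 2"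
    by (simp add: card_image card_less_pairs)
  moreover have "card ({(r, c :: 'n). \<not> c < r} \<union> {(r, c). c < r}) =
      card {(r, c :: 'n). \<not> c < r} + card {(r, c :: 'n). c < r}"
    by (intro card_Un_disjoint) auto
  moreover have "{(r, c :: 'n). \<not> c < r} \<union> {(r, c). c < r} = UNIV" by auto
  ultimately show ?thesis by (simp add: power2_eq_square)
qed

text \<open>With N for \<open>CARD('n) choose 2\<close> and n for the dimension, the parameters are
  at most N for a matrix of the solution flag in normal form, N minus the length for each of the
  three relative positions, and n^2 - N for each triangular factor. As the lengths add up to N, the
  total is at most N + 2 N + 3 (n^2 - N) = 3 n^2. An infinite set of solution flags would give 3 n^2
  + 1 independent numbers in the ring of these parameters.\<close>

lemma finite_generic_solutions:
  fixes x :: "'n::{finite,linorder} mat_triple"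
  assumes gen: "generic_on UNIV x"
    and W: "\<And>l. W l permutes {1..CARD('n)}"
    and len: "(\<Sum>l\<in>UNIV. perm_length CARD('n) (W l)) = CARD('n) choose 2"
  shows "finite (matrix_flag ` solutions W (entry_matrix x))"
proof -
  let ?X = "entry_matrix x" and ?n = "CARD('n)"
  let ?H = "solutions W ?X" and ?N = "?n choose 2"
  note inv = generic_invertible[OF gen]
  have "finite {m \<in> ?H. normal_form \<pi> m}" if "bij \<pi>" for \<pi> :: "'n \<Rightarrow> 'n"
  proof (rule finite_if_finite_entries, rule ccontr)
    fix r0 c0 assume inf: "infinite ((\<lambda>m. m $ r0 $ c0) ` {m \<in> ?H. normal_form \<pi> m})"
    \<comment> \<open>One extra variable in slot \<open>Inr 0\<close>, standing for the value of the
      entry that takes infinitely many values; the quantified matrix uses slot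
      \<open>Inr 1\<close>.\<close>
    define v :: "(3 + nat) \<times> 'n \<times> 'n" where "v = (Inr 0, r0, c0)"
    define P where "P = (\<lambda>e :: 'n mat_env. \<exists>m. m \<in> solutions W (\<lambda>l. mvar e (Inl l)) \<and> normal_form \<pi> m \<and>
      m $ r0 $ c0 = e v)"
    have "definable (\<lambda>e :: 'n mat_env. mvar e (Inr 1) \<in> solutions W (\<lambda>l. mvar e (Inl l)) \<and>
        normal_form \<pi> (mvar e (Inr 1)) \<and> mvar e (Inr 1) $ r0 $ c0 = e v)"
      using matpoly_mvar unfolding matpoly_def
      by (intro definable.conj definable_solutions definable_normal_form matpoly_mvar definable_eq
          polyfun.var) auto
    from definable_ex_matrix[OF this, of "Inr 1"] have defP: "definable P"
      by (simp add: P_def v_def set_mvar_apply)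
    have mv: "mvar ((embed x)(v := t)) (Inl l) = ?X l" for t l
      by (simp add: mvar_def entry_matrix_def v_def)
    have Pt: "P ((embed x)(v := t)) \<longleftrightarrow> t \<in> (\<lambda>m. m $ r0 $ c0) ` {m \<in> ?H. normal_form \<pi> m}" for t
      unfolding P_def mv by auto
    have "v \<notin> triple_vars" by (auto simp: v_def triple_vars_def)
    moreover have "infinite {t. P ((embed x)(v := t))}" using inf by (simp add: Pt)
    \<comment> \<open>\<open>t\<close> is an entry of some solution in normal form and yet
      independent of all entries of the triple.\<close>
    ultimately obtain t where t: "P ((embed x)(v := t))"
      "generic_on (insert v triple_vars) ((embed x)(v := t))"
      using generic_on_extend[OF generic_on_embed[OF gen], of v "\<lambda>t. P ((embed x)(v := t))"]
        definable_finite_or_cofinite[OF defP] countable_finite[OF finite_triple_vars] by blast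
    obtain m where m: "m \<in> ?H" "normal_form \<pi> m" "m $ r0 $ c0 = t" using t(1) unfolding Pt by blast
    have "\<forall>l. \<exists>\<pi>' m' b. schubert_position (W l) \<pi>' \<and> normal_form \<pi>' m' \<and> upper_tri b \<and> ?X l = m ** m' ** b"
      using m(1) unfolding solutions_def in_position_def by blast
    then obtain \<sigma> M B where XM: "\<And>l. schubert_position (W l) (\<sigma> l)" "\<And>l. normal_form (\<sigma> l) (M l)"
      "\<And>l. upper_tri (B l)" "\<And>l. ?X l = m ** M l ** B l" by metis
    define U where "U = {(r, c :: 'n). \<not> c < r}"
    define ent where "ent = (\<lambda>(a :: 'n cmat) (r, c). a $ r $ c)"
    \<comment> \<open>The parameters: free entries of the solution and of the three relative
      positions, and the upper triangular entries. They generate the triple and \<open>t\<close>,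
      which is an entry of \<open>m\<close>.\<close>
    define A where "A = ent m ` free_entries \<pi> \<union> (\<Union>l\<in>UNIV. ent (M l) ` free_entries (\<sigma> l)) \<union>
      (\<Union>l\<in>UNIV. ent (B l) ` U)"
    have nf: "a $ r $ c \<in> ratring A" if "normal_form \<rho> a" "ent a ` free_entries \<rho> \<subseteq> A" for \<rho> a r c
    proof -
      have "a $ r $ c \<in> \<rat> \<or> a $ r $ c \<in> A"
        using normal_form_entry[OF that(1), of r c] that(2) by (force simp: ent_def)
      then show ?thesis by (auto intro: ratring.rat ratring.gen)
    qed
    have mA: "m $ r $ c \<in> ratring A" for r c by (rule nf[OF m(2)]) (auto simp: A_def)
    have MA: "M l $ r $ c \<in> ratring A" for l r c by (rule nf[OF XM(2)]) (auto simp: A_def)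
    have BA: "B l $ r $ c \<in> ratring A" for l r c
    proof (cases "c < r")
      case True
      then show ?thesis using XM(3)[of l] by (auto simp: upper_tri_def intro: ratring.rat)
    next
      case False
      then have "B l $ r $ c \<in> ent (B l) ` U" by (force simp: ent_def U_def)
      then have "B l $ r $ c \<in> A" unfolding A_def by blast
      then show ?thesis by (rule ratring.gen)
    qed
    have XA: "?X l $ r $ c \<in> ratring A" for l r c
      unfolding XM(4) by (intro ratring_matrix_mult mA MA BA)
    have "card (insert v triple_vars) \<le> card A"
    proof (rule generic_on_card_le[OF _ t(2)])
      show "finite (insert v triple_vars)" by (simp add: finite_triple_vars)
      show "finite A" by (simp add: A_def)
      fix w assume "w \<in> insert v triple_vars"
      then consider "w = v" | l r c where "w = (Inl l, r, c)" by (auto simp: triple_vars_def)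
      then show "((embed x)(v := t)) w \<in> ratring A"
      proof cases
        case 1
        then show ?thesis using mA[of r0 c0] m(3) by simp
      next
        case 2
        then show ?thesis using XA[of l r c] by (simp add: v_def entry_matrix_def)
      qed
    qed
    moreover have "card A \<le> 3 * ?n\<^sup>2"
    proof -
      have "card A \<le> card (ent m ` free_entries \<pi>) + card (\<Union>l\<in>UNIV. ent (M l) ` free_entries (\<sigma> l)) +
          card (\<Union>l\<in>UNIV. ent (B l) ` U)"
        unfolding A_def by (meson add_le_mono1 card_Un_le le_trans)
      also have "\<dots> \<le> card (free_entries \<pi>) + (\<Sum>l\<in>UNIV. card (free_entries (\<sigma> l))) + (\<Sum>l\<in>(UNIV :: 3 set). card U)"
        by (intro add_mono card_image_le order_trans[OF card_UN_le] sum_mono) auto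
      finally have "card A \<le> card (free_entries \<pi>) + (\<Sum>l\<in>UNIV. card (free_entries (\<sigma> l))) + 3 * card U"
        by simp
      moreover have "card (free_entries \<pi>) \<le> ?N"
        using card_inversions_le by (simp add: card_free_entries[OF \<open>bij \<pi>\<close>])
      moreover have "(\<Sum>l\<in>UNIV. card (free_entries (\<sigma> l)) + perm_length ?n (W l)) \<le> (\<Sum>l\<in>(UNIV :: 3 set). ?N)"
        by (intro sum_mono card_free_entries_schubert W XM(1))
      then have "(\<Sum>l\<in>UNIV. card (free_entries (\<sigma> l))) + ?N \<le> 3 * ?N"
        by (simp add: sum.distrib len)
      moreover have "card U + ?N = ?n\<^sup>2" unfolding U_def by (rule card_upper_entries)
      ultimately show ?thesis by linarith
    qed
    ultimately show False
      using \<open>v \<notin> triple_vars\<close> finite_triple_vars[where 'n = 'n] card_triple_vars[where 'n = 'n] by simp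
  qed
  then have "finite (\<Union>\<pi>\<in>{\<pi>. bij \<pi>}. matrix_flag ` {m \<in> ?H. normal_form \<pi> m})" by auto
  moreover have "matrix_flag ` ?H \<subseteq> (\<Union>\<pi>\<in>{\<pi>. bij \<pi>}. matrix_flag ` {m \<in> ?H. normal_form \<pi> m})"
  proof (rule image_subsetI)
    fix h assume h: "h \<in> ?H"
    then have "invertible h" by (simp add: solutions_def)
    then obtain \<pi> m b where mb: "bij \<pi>" "normal_form \<pi> m" "upper_tri b" "h = m ** b"
      using normal_form_exists by blast
    have eq: "matrix_flag m = matrix_flag h"
      using matrix_flag_upper_tri[OF mb(3), of m] \<open>invertible h\<close> mb(4) by simp
    have "invertible m" using \<open>invertible h\<close> mb(4) invertible_multD by blast
    then have "m \<in> ?H" using solutions_cong_flag[OF inv h _ eq] by blast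
    then show "matrix_flag h \<in> (\<Union>\<pi>\<in>{\<pi>. bij \<pi>}. matrix_flag ` {m \<in> ?H. normal_form \<pi> m})"
      using mb(1,2) eq[symmetric] by blast
  qed
  ultimately show ?thesis by (rule finite_subset[rotated])
qed

definition flags_of :: "'n::{finite,linorder} mat_triple \<Rightarrow> 3 \<Rightarrow> 'n flag" where
  "flags_of x = (\<lambda>k. matrix_flag (entry_matrix x k))"

abbreviation (input) has_count where
  "has_count u v w E c \<equiv>
    finite (schubert_intersection u v w E) \<and> card (schubert_intersection u v w E) = c"

lemma GL_triples_iff: "x \<in> GL_triples \<longleftrightarrow> (\<forall>l. invertible (entry_matrix x l))"
  by (simp add: GL_triples_def)

text \<open>The formula expresses that the count is the one at \<open>x\<close> and that the triple
  is invertible; it is true at \<open>x\<close>, hence on an open set given by a rational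
  polynomial.\<close>

lemma generic_count_nbhd:
  fixes x :: "'n::{finite,linorder} mat_triple"
  assumes gen: "generic_on UNIV x"
    and perm: "u permutes {1..CARD('n)}" "v permutes {1..CARD('n)}" "w permutes {1..CARD('n)}"
    and len: "perm_length CARD('n) u + perm_length CARD('n) v + perm_length CARD('n) w = CARD('n) choose 2"
  shows "\<exists>q\<in>polyfun \<rat> UNIV. q x \<noteq> 0 \<and> (\<forall>y. q y \<noteq> 0 \<longrightarrow> y \<in> GL_triples \<and>
    has_count u v w (flags_of y) (card (schubert_intersection u v w (flags_of x))))"
proof -
  let ?W = "triple u v w"
  have tr: "triple u v w 1 = u" "triple u v w 2 = v" "triple u v w 3 = w"
    by (simp_all add: triple_def)
  have eq: "schubert_intersection u v w (flags_of y) = matrix_flag ` solutions ?W (entry_matrix y)"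
    if "y \<in> GL_triples" for y :: "'n mat_triple"
    using that schubert_intersection_eq[of "entry_matrix y"] by (simp add: GL_triples_iff flags_of_def)
  have x: "x \<in> GL_triples" using generic_invertible[OF gen] by (simp add: GL_triples_iff)
  define c where "c = card (schubert_intersection u v w (flags_of x))"
  have "?W l permutes {1..CARD('n)}" for l using perm by (simp add: triple_def)
  moreover have "(\<Sum>l\<in>UNIV. perm_length CARD('n) (?W l)) = CARD('n) choose 2"
    using len by (simp add: sum_3 tr)
  \<comment> \<open>Needed before the formula: for an infinite set \<open>card\<close> is 0, and the
    formula for \<open>c\<close> would be false at \<open>x\<close>.\<close>
  ultimately have fin: "finite (matrix_flag ` solutions ?W (entry_matrix x))"
    using finite_generic_solutions[OF gen] by blast
  define P where "P = (\<lambda>e :: 'n mat_env. (\<forall>l\<in>UNIV. invertible (mvar e (Inl l))) \<and>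
    finite (matrix_flag ` solutions ?W (\<lambda>l. mvar e (Inl l))) \<and>
    card (matrix_flag ` solutions ?W (\<lambda>l. mvar e (Inl l))) = c)"
  have "definable P"
    unfolding P_def
    by (intro definable.conj[OF _ definable_card_solutions] definable_ball definable_invertible
        matpoly_mvar finite)
  from generic_definable_nbhd[OF this generic_on_embed[OF gen]] obtain q
    where q: "q \<in> polyfun \<rat> triple_vars" "q (embed x) \<noteq> 0"
      "\<forall>y. (\<forall>v. v \<notin> triple_vars \<longrightarrow> y v = 0) \<longrightarrow> q y \<noteq> 0 \<longrightarrow> P y = P (embed x)"
    using embed_outside by blast
  have Px: "P (embed x)"
    using x fin eq[OF x] by (simp add: P_def mvar_embed c_def GL_triples_iff)
  have main: "y \<in> GL_triples \<and> has_count u v w (flags_of y) c" if "q (embed y) \<noteq> 0" for y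
  proof -
    have "P (embed y)" using q(3) that Px embed_outside by blast
    then have "y \<in> GL_triples" by (simp add: P_def mvar_embed GL_triples_iff)
    with \<open>P (embed y)\<close> show ?thesis by (simp add: P_def mvar_embed eq)
  qed
  show ?thesis unfolding c_def[symmetric]
    using q(2) main by (intro bexI[where x = "\<lambda>x. q (embed x)", OF _ polyfun_embed[OF q(1)]]) simp
qed

text \<open>The flags of the triples with \<open>q\<close> nonzero form an open set with constant
  count. Any other count given by a nonempty open set is the same, because the two open sets of
  matrices share a point.\<close>

lemma schubert_number_eq:
  fixes x :: "'n::{finite,linorder} mat_triple"
  assumes q: "q \<in> polyfun UNIV UNIV" "q x \<noteq> 0"
    and count: "\<And>y. q y \<noteq> 0 \<Longrightarrow> y \<in> GL_triples \<and>
      has_count u v w (flags_of y) c"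
  shows "schubert_number TYPE('n) u v w = c"
proof -
  let ?open = "\<lambda>c. \<exists>U :: (3 \<Rightarrow> 'n flag) set. U \<noteq> {} \<and> zariski_open_flag_triples U \<and>
    (\<forall>E\<in>U. has_count u v w E c)"
  have "(THE c. ?open c) = c"
  proof (rule the_equality)
    \<comment> \<open>The preimage of \<open>U\<close> in the matrices is larger than the set where
      \<open>q\<close> does not vanish: it also contains the other matrices of the same flags, so
      openness has to be checked at these.\<close>
    define U where "U = flags_of ` {y. q y \<noteq> 0}"
    have "zariski_open_flag_triples U"
      unfolding zariski_open_flag_triples_def
    proof
      show "U \<subseteq> {E. \<forall>k. complete_flag (E k)}"
        using count by (auto simp: U_def flags_of_def GL_triples_iff intro: complete_flag_matrix_flag)
      show "zariski_open_in GL_triples {x \<in> GL_triples. (\<lambda>k. matrix_flag (entry_matrix x k)) \<in> U}"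
        unfolding zariski_open_in_def flags_of_def[symmetric]
      proof (intro conjI ballI)
        fix y assume "y \<in> {x \<in> GL_triples. flags_of x \<in> U}"
        then obtain z where y: "y \<in> GL_triples" and z: "q z \<noteq> 0" "flags_of y = flags_of z"
          by (auto simp: U_def)
        have zGL: "z \<in> GL_triples" using count[OF z(1)] by blast
        have "\<exists>b. upper_tri b \<and> entry_matrix z k = entry_matrix y k ** b" for k
          using y z(2) matrix_flag_eq_imp[of "entry_matrix y k" "entry_matrix z k"]
          by (auto simp: GL_triples_iff flags_of_def fun_eq_iff)
        then obtain b where b: "\<And>k. upper_tri (b k)" "\<And>k. entry_matrix z k = entry_matrix y k ** b k"
          by metis
        \<comment> \<open>Right multiplication by the fixed matrices \<open>b\<close> carries
          \<open>y\<close> to \<open>z\<close>, where \<open>q\<close> is nonzero. So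
          \<open>q\<close> after this translation is a polynomial that is nonzero at
          \<open>y\<close> and whose nonvanishing guarantees flags in \<open>U\<close>.\<close>
        define \<Phi> where "\<Phi> = (\<lambda>y (k, r, c). (entry_matrix y k ** b k) $ r $ c)"
        have \<Phi>: "entry_matrix (\<Phi> y) k = entry_matrix y k ** b k" for y k
          by (simp add: \<Phi>_def entry_matrix_def vec_eq_iff)
        have "\<Phi> y = z"
        proof
          fix i :: "3 \<times> 'n \<times> 'n"
          obtain k r c where i: "i = (k, r, c)" by (cases i) auto
          have "\<Phi> y i = entry_matrix z k $ r $ c" by (simp add: i \<Phi>_def b(2))
          then show "\<Phi> y i = z i" by (simp add: i entry_matrix_def)
        qed
        have "(\<lambda>y. q (\<Phi> y)) \<in> polyfun UNIV UNIV"
          using q(1)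
        proof (rule polyfun_compose)
          fix i :: "3 \<times> 'n \<times> 'n"
          show "(\<lambda>y. \<Phi> y i) \<in> polyfun UNIV UNIV"
            by (cases i) (auto simp: \<Phi>_def intro!: polyfun_matrix_mult polyfun_entry_matrix polyfun.const)
        qed
        then obtain p where p: "cpoly_value p = (\<lambda>y. q (\<Phi> y))"
          using polyfun_imp_cpoly[of _ UNIV UNIV] by auto
        have "flags_of y' \<in> U" if "y' \<in> GL_triples" "q (\<Phi> y') \<noteq> 0" for y'
        proof -
          have "\<Phi> y' \<in> GL_triples" using count[OF that(2)] by blast
          then have "invertible (entry_matrix y' k ** b k)" for k unfolding GL_triples_iff \<Phi> by blast
          then have "matrix_flag (entry_matrix (\<Phi> y') k) = matrix_flag (entry_matrix y' k)" for k
            unfolding \<Phi> by (rule matrix_flag_upper_tri[OF b(1)])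
          then have "flags_of (\<Phi> y') = flags_of y'" by (simp add: flags_of_def)
          then show ?thesis using that(2) unfolding U_def by (metis (mono_tags, lifting) imageI mem_Collect_eq)
        qed
        then show "\<exists>p. cpoly_value p y \<noteq> 0 \<and>
            (\<forall>y'\<in>GL_triples. cpoly_value p y' \<noteq> 0 \<longrightarrow> y' \<in> {x \<in> GL_triples. flags_of x \<in> U})"
          using p z(1) \<open>\<Phi> y = z\<close> by (intro exI[of _ p]) auto
      qed auto
    qed
    moreover have "U \<noteq> {}" using q(2) by (auto simp: U_def)
    moreover have "\<forall>E\<in>U. has_count u v w E c"
      using count by (auto simp: U_def)
    ultimately show "?open c"
      by blast
  next
    fix c' assume "?open c'"
    then obtain U :: "(3 \<Rightarrow> 'n flag) set" where U: "U \<noteq> {}" "zariski_open_flag_triples U"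
      "\<forall>E\<in>U. card (schubert_intersection u v w E) = c'" by blast
    then obtain E where E: "E \<in> U" "\<And>k. complete_flag (E k)"
      unfolding zariski_open_flag_triples_def by blast
    have "\<forall>k. \<exists>h. invertible h \<and> E k = matrix_flag h" using complete_flag_exists_matrix E(2) by blast
    then obtain h where h: "\<And>k. invertible (h k)" "\<And>k. E k = matrix_flag (h k)" by metis
    define y where "y = (\<lambda>(k, r, c). h k $ r $ c)"
    have yh: "entry_matrix y k = h k" for k by (simp add: y_def entry_matrix_def vec_eq_iff)
    have "flags_of y = E" by (simp add: flags_of_def yh h(2)[symmetric])
    then have y: "y \<in> {x \<in> GL_triples. flags_of x \<in> U}"
      using h(1) E(1) by (simp add: GL_triples_iff yh)
    have "zariski_open_in GL_triples {x \<in> GL_triples. flags_of x \<in> U}"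
      using U(2) by (simp add: zariski_open_flag_triples_def flags_of_def)
    from bspec[OF conjunct2[OF this[unfolded zariski_open_in_def]] y] obtain p
      where p: "cpoly_value p y \<noteq> 0"
        and nbhd: "\<forall>z\<in>GL_triples. cpoly_value p z \<noteq> 0 \<longrightarrow> z \<in> {x \<in> GL_triples. flags_of x \<in> U}"
      by (elim exE conjE)
    have "\<exists>z. q z \<noteq> 0 \<and> cpoly_value p z \<noteq> 0"
      by (rule polyfun_prod_nonzero[where g = "cpoly_value p", OF q(1) cpoly_value_polyfun q(2) p])
    then obtain z where z: "q z \<noteq> 0" "cpoly_value p z \<noteq> 0" by (elim exE conjE)
    then have "flags_of z \<in> U" using nbhd count[OF z(1)] by simp
    then show "c' = c" using U(3) count[OF z(1)] by simp
  qed
  then show ?thesis unfolding schubert_number_def .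
qed

section \<open>Path vectors\<close>

abbreviation (input) edges :: "nat \<Rightarrow> ((nat ^ 3) \<times> (nat ^ 3)) set" where
  "edges n \<equiv> parcs (triangle_graph n)"

abbreviation (input) walk where
  "walk n \<equiv> pre_digraph.cas (with_proj (triangle_graph n))"

abbreviation (input) walk_verts where
  "walk_verts n \<equiv> pre_digraph.awalk_verts (with_proj (triangle_graph n))"

definition step :: "3 \<Rightarrow> nat ^ 3 \<Rightarrow> nat ^ 3" where
  "step m x = x - axis 1 1 + axis m 1"

lemma step_nth: "step m x $ k = x $ k - (if k = 1 then 1 else 0) + (if k = m then 1 else 0)"
  by (simp add: step_def axis_def)

lemma step_2 [simp]: "step 2 x $ 1 = x $ 1 - 1" "step 2 x $ 2 = x $ 2 + 1" "step 2 x $ 3 = x $ 3"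
  by (simp_all add: step_nth)

lemma step_3 [simp]: "step 3 x $ 1 = x $ 1 - 1" "step 3 x $ 2 = x $ 2" "step 3 x $ 3 = x $ 3 + 1"
  by (simp_all add: step_nth)

lemma step_2_neq_3: "step 2 x \<noteq> step 3 x"
  by (metis Suc_eq_plus1 n_not_Suc_n step_2(2) step_3(2))

lemma step_triangle: "D \<in> triangle n \<Longrightarrow> 1 \<le> D $ 1 \<Longrightarrow> step 2 D \<in> triangle n \<and> step 3 D \<in> triangle n"
  by (auto simp: triangle_def)

lemma parcs_triangle_graph:
  "edges n = {(x, y). x \<in> triangle n \<and> 1 \<le> x $ 1 \<and> (y = step 2 x \<or> y = step 3 x)}"
  by (simp add: triangle_graph_def step_def)

definition paths :: "nat \<Rightarrow> nat ^ 3 \<Rightarrow> nat ^ 3 \<Rightarrow> ((nat ^ 3) \<times> (nat ^ 3)) list set" where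
  "paths n D t = {p. pre_digraph.apath (with_proj (triangle_graph n)) D p t}"

lemma paths_iff:
  "p \<in> paths n D t \<longleftrightarrow> D \<in> triangle n \<and> set p \<subseteq> edges n \<and>
     walk n D p t \<and>
     distinct (walk_verts n D p)"
  by (simp add: paths_def pre_digraph.apath_def pre_digraph.awalk_def triangle_graph_def)

text \<open>Every edge lowers the first coordinate. Hence a walk never returns to its start, and
  prefixing an edge to a path keeps the vertices distinct.\<close>

lemma walk_verts_descend:
  assumes "set p \<subseteq> edges n" "walk n D p t"
    and "z \<in> set (walk_verts n D p)"
  shows "z $ 1 \<le> D $ 1"
  using assms
proof (induction p arbitrary: D)
  case Nil
  then show ?case by (simp add: pre_digraph.awalk_verts.simps)
next
  case (Cons e p)
  have e: "fst e = D" "snd e $ 1 \<le> D $ 1"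
    using Cons.prems by (auto simp: pre_digraph.cas.simps parcs_triangle_graph)
  have "z = D \<or> z \<in> set (walk_verts n (snd e) p)"
    using Cons.prems(3) e(1) by (simp add: pre_digraph.awalk_verts.simps)
  then show ?case
    using Cons.IH[of "snd e"] Cons.prems(1,2) e(2) by (auto simp: pre_digraph.cas.simps)
qed

lemma paths_bottom:
  assumes "D \<in> triangle n" "D $ 1 = 0"
  shows "paths n D t = (if D = t then {[]} else {})"
proof -
  have "p \<in> paths n D t \<longleftrightarrow> p = [] \<and> D = t" for p
    using assms
    by (cases p) (auto simp: paths_iff pre_digraph.cas.simps pre_digraph.awalk_verts.simps parcs_triangle_graph)
  then show ?thesis by auto
qed

lemma paths_step:
  assumes "D \<in> triangle n" "1 \<le> D $ 1" "t $ 1 = 0"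
  shows "paths n D t =
    (\<lambda>p. (D, step 2 D) # p) ` paths n (step 2 D) t \<union>
    (\<lambda>p. (D, step 3 D) # p) ` paths n (step 3 D) t" (is "_ = ?R")
proof (intro antisym subsetI)
  fix p assume p: "p \<in> paths n D t"
  have "p \<noteq> []" using p assms by (auto simp: paths_iff pre_digraph.cas.simps)
  then obtain e q where eq: "p = e # q" by (cases p) auto
  have e: "e = (D, step 2 D) \<or> e = (D, step 3 D)"
    using p by (cases e) (auto simp: eq paths_iff pre_digraph.cas.simps parcs_triangle_graph)
  then have "snd e \<in> triangle n" using step_triangle[OF assms(1,2)] by auto
  then have "q \<in> paths n (snd e) t"
    using p by (auto simp: eq paths_iff pre_digraph.cas.simps pre_digraph.awalk_verts.simps)
  then show "p \<in> ?R"
    unfolding eq using e by auto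
next
  fix p assume "p \<in> ?R"
  then obtain y q where y: "y = step 2 D \<or> y = step 3 D" "p = (D, y) # q" "q \<in> paths n y t" by blast
  have "y $ 1 < D $ 1" using y(1) assms(2) by auto
  then have "D \<notin> set (walk_verts n y q)"
    using y(3) walk_verts_descend[of q n y t D] by (auto simp: paths_iff)
  then show "p \<in> paths n D t"
    using y assms
    by (auto simp: paths_iff pre_digraph.cas.simps pre_digraph.awalk_verts.simps parcs_triangle_graph)
qed

lemma finite_paths:
  assumes "D \<in> triangle n" "t $ 1 = 0"
  shows "finite (paths n D t)"
  using assms(1)
proof (induction "D $ 1" arbitrary: D)
  case 0
  then show ?case using paths_bottom[of D n t] by simp
next
  case (Suc k)
  then have "1 \<le> D $ 1" by simp
  then show ?case
    using Suc paths_step[OF Suc.prems _ assms(2)] step_triangle[OF Suc.prems] by simp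
qed

lemma bottom_dot_nth [simp]:
  "bottom_dot n i $ 1 = 0" "bottom_dot n i $ 2 = n - i" "bottom_dot n i $ 3 = i - 1"
  by (simp_all add: bottom_dot_def)

lemma path_vector_nth:
  "path_vector wt D $ i =
    (\<Sum>p\<in>paths CARD('n) D (bottom_dot CARD('n) (pos i)). prod_list (map wt p))"
  for i :: "'n::{finite,linorder}"
  by (simp add: path_vector_def paths_def)

text \<open>Paths are sorted by their first edge. Together with the unit vectors on the bottom row
  this recursion determines all path vectors, and it is the only access to paths from here
  on.\<close>

lemma path_vector_step:
  assumes "D \<in> triangle CARD('n)" "1 \<le> D $ 1"
  shows "(path_vector wt D :: 'n::{finite,linorder} cvec) =
    wt (D, step 2 D) *s path_vector wt (step 2 D) + wt (D, step 3 D) *s path_vector wt (step 3 D)"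
proof -
  let ?n = "CARD('n)"
  have "path_vector wt D $ i = wt (D, step 2 D) * path_vector wt (step 2 D) $ i +
      wt (D, step 3 D) * path_vector wt (step 3 D) $ i" for i :: 'n
  proof -
    let ?t = "bottom_dot ?n (pos i)"
    have fin: "finite (paths ?n (step 2 D) ?t)" "finite (paths ?n (step 3 D) ?t)"
      using step_triangle[OF assms] by (auto intro: finite_paths)
    have inj: "inj_on (\<lambda>p. e # p) A" for e :: "(nat ^ 3) \<times> (nat ^ 3)" and A
      by (simp add: inj_on_def)
    have "path_vector wt D $ i =
      (\<Sum>p\<in>(\<lambda>p. (D, step 2 D) # p) ` paths ?n (step 2 D) ?t. prod_list (map wt p)) +
      (\<Sum>p\<in>(\<lambda>p. (D, step 3 D) # p) ` paths ?n (step 3 D) ?t. prod_list (map wt p))"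
      unfolding path_vector_nth
      by (subst paths_step[OF assms])
        (auto intro!: sum.union_disjoint simp: fin step_2_neq_3)
    then show ?thesis
      unfolding path_vector_nth by (simp add: sum.reindex[OF inj] o_def sum_distrib_left)
  qed
  then show ?thesis by (simp add: vec_eq_iff)
qed

lemma pos_minus_1_inj: "pos c - 1 = pos d - 1 \<Longrightarrow> c = (d :: 'n::{finite,linorder})"
  using pos_ge_1[of c] pos_ge_1[of d] pos_eq_iff[of c d] by linarith

lemma bottom_dot_triangle: "bottom_dot CARD('n) (pos (c :: 'n::{finite,linorder})) \<in> triangle CARD('n)"
  using pos_ge_1[of c] pos_le_card[of c] by (auto simp: triangle_def)

lemma path_vector_bottom:
  "path_vector wt (bottom_dot CARD('n) (pos c)) = axis (c :: 'n::{finite,linorder}) 1"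
proof -
  have "bottom_dot CARD('n) (pos c) = bottom_dot CARD('n) (pos i) \<longleftrightarrow> i = c" for i :: 'n
    using pos_minus_1_inj[of c i] by (metis bottom_dot_nth(3))
  then show ?thesis
    using paths_bottom[OF bottom_dot_triangle[of c]]
    by (simp add: vec_eq_iff path_vector_nth axis_def)
qed

lemma bottom_cases:
  assumes "D \<in> triangle CARD('n)" "D $ 1 = 0"
  shows "\<exists>c :: 'n::{finite,linorder}. D = bottom_dot CARD('n) (pos c)"
proof -
  have eq: "D $ 2 + D $ 3 = CARD('n) - 1" using assms by (simp add: triangle_def)
  then have "D $ 3 + 1 \<le> CARD('n)" using zero_less_card_finite[where 'a = 'n] by linarith
  then obtain c :: 'n where "pos c = D $ 3 + 1" using pos_surj[of "D $ 3 + 1", where 'n = 'n] by auto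
  then have "D = bottom_dot CARD('n) (pos c)"
    unfolding vec_eq_iff forall_3 using assms(2) eq by simp
  then show ?thesis by blast
qed

lemma triangle_induct [consumes 1, case_names bottom step]:
  assumes "D \<in> triangle CARD('n)"
    and "\<And>c :: 'n::{finite,linorder}. P (bottom_dot CARD('n) (pos c))"
    and "\<And>D. D \<in> triangle CARD('n) \<Longrightarrow> 1 \<le> D $ 1 \<Longrightarrow> P (step 2 D) \<Longrightarrow> P (step 3 D) \<Longrightarrow> P D"
  shows "P D"
  using assms(1)
proof (induction "D $ 1" arbitrary: D)
  case 0
  then show ?case using bottom_cases[where 'n = 'n] assms(2) by (metis (full_types))
next
  case (Suc k)
  then have D: "1 \<le> D $ 1" "k = step 2 D $ 1" "k = step 3 D $ 1" by simp_all
  note tri = step_triangle[OF Suc.prems D(1)]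
  show ?case
    by (rule assms(3)[OF Suc.prems D(1) Suc.hyps(1)[OF D(2) conjunct1[OF tri]]
          Suc.hyps(1)[OF D(3) conjunct2[OF tri]]])
qed

lemma polyfun_path_vector:
  assumes "D \<in> triangle CARD('n)" "\<rat> \<subseteq> K"
  shows "(\<lambda>wt. path_vector wt D $ (i :: 'n::{finite,linorder})) \<in> polyfun K (edges CARD('n))"
  using assms(1)
proof (induction D rule: triangle_induct)
  case (bottom c)
  show ?case unfolding path_vector_bottom using assms(2) by (auto simp: axis_def intro: polyfun_rat)
next
  case (step D)
  have "(D, step 2 D) \<in> edges CARD('n)" "(D, step 3 D) \<in> edges CARD('n)"
    using step by (auto simp: parcs_triangle_graph)
  then show ?case
    unfolding path_vector_step[OF step(1,2)] vector_add_component vector_smult_component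
    by (intro polyfun.add polyfun.mult polyfun.var step(3,4))
qed

text \<open>For each corner \<open>k\<close> one side of the triangle that starts there;
  \<open>j\<close> counts its dots from 1 at the corner. The path vectors of these dots will be the
  columns of a matrix of the flag.\<close>

definition edge_dot :: "nat \<Rightarrow> 3 \<Rightarrow> nat \<Rightarrow> nat ^ 3" where
  "edge_dot n k j = (if k = 1 then vector [n - j, j - 1, 0]
     else if k = 2 then vector [j - 1, n - j, 0] else vector [j - 1, 0, n - j])"

lemma edge_dot_nth:
  "edge_dot n 1 j $ 1 = n - j" "edge_dot n 1 j $ 2 = j - 1" "edge_dot n 1 j $ 3 = 0"
  "edge_dot n 2 j $ 1 = j - 1" "edge_dot n 2 j $ 2 = n - j" "edge_dot n 2 j $ 3 = 0"
  "edge_dot n 3 j $ 1 = j - 1" "edge_dot n 3 j $ 2 = 0" "edge_dot n 3 j $ 3 = n - j"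
  by (simp_all add: edge_dot_def)

lemma edge_dot_triangle: "1 \<le> j \<Longrightarrow> j \<le> n \<Longrightarrow> edge_dot n k j \<in> triangle n"
  unfolding triangle_def using exhaust_3[of k] by (auto simp: edge_dot_nth)

lemma edge_dot_self: "edge_dot n k j $ k = n - j"
  using exhaust_3[of k] by (auto simp: edge_dot_nth)

definition path_matrix :: "((nat ^ 3) \<times> (nat ^ 3) \<Rightarrow> complex) \<Rightarrow> 3 \<Rightarrow> 'n::{finite,linorder} cmat" where
  "path_matrix wt k = (\<chi> r c. path_vector wt (edge_dot CARD('n) k (pos c)) $ r)"

lemma column_path_matrix:
  "column c (path_matrix wt k) = path_vector wt (edge_dot CARD('n) k (pos (c :: 'n::{finite,linorder})))"
  by (simp add: path_matrix_def column_def vec_eq_iff)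

text \<open>A relation \<open>v\<^sub>x = a v\<^sub>y + b v\<^sub>z\<close> with \<open>b \<noteq> 0\<close> expresses \<open>v\<^sub>z\<close> by dots further
  away from the side \<open>z\<close> moves towards, so every path vector is spanned by the dots of one side
  of the triangle.\<close>

lemma path_vector_in_side_span:
  assumes D: "D \<in> triangle CARD('n)" and m: "m = 2 \<and> m' = 3 \<or> m = 3 \<and> m' = 2"
    and nz: "\<And>e. e \<in> edges CARD('n) \<Longrightarrow> wt e \<noteq> 0"
  shows "(path_vector wt D :: 'n::{finite,linorder} cvec) \<in>
    vec.span {path_vector wt D' |D'. D' \<in> triangle CARD('n) \<and> D' $ m = 0 \<and> D $ 1 \<le> D' $ 1 \<and> D $ m' \<le> D' $ m'}"
  using D
proof (induction "D $ m" arbitrary: D)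
  case 0
  then show ?case by (intro vec.span_base) auto
next
  case (Suc l)
  let ?S = "\<lambda>D. {path_vector wt D' :: 'n cvec |D'. D' \<in> triangle CARD('n) \<and> D' $ m = 0 \<and> D $ 1 \<le> D' $ 1 \<and> D $ m' \<le> D' $ m'}"
  \<comment> \<open>The dot from which the edge in direction \<open>m\<close> leads to
    \<open>D\<close>. Both \<open>x\<close> and the other end \<open>step m' x\<close> are one step
    closer to the side where coordinate \<open>m\<close> is 0, and neither their first coordinate
    nor coordinate \<open>m'\<close> is smaller than that of \<open>D\<close>.\<close>
  define x where "x = D + axis 1 1 - axis m 1"
  have xn: "x $ k = D $ k + (if k = 1 then 1 else 0) - (if k = m then 1 else 0)" for k
    by (simp add: x_def axis_def)
  have x: "x \<in> triangle CARD('n)" "1 \<le> x $ 1"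
    using m Suc.prems Suc.hyps(2) by (auto simp: triangle_def xn)
  have Dx: "step m x = D"
    unfolding vec_eq_iff forall_3 using m Suc.hyps(2) by (auto simp: step_nth xn)
  have xm: "x $ m = l" "x $ m' = D $ m'" "D $ 1 \<le> x $ 1"
    using m Suc.hyps(2) by (auto simp: xn)
  have ym: "step m' x $ m = l" "D $ 1 \<le> step m' x $ 1" "D $ m' \<le> step m' x $ m'"
    using m Suc.hyps(2) by (auto simp: step_nth xn)
  have y: "step m' x \<in> triangle CARD('n)" using m step_triangle[OF x] by auto
  have mono: "vec.span (?S z) \<subseteq> vec.span (?S D)" if "D $ 1 \<le> z $ 1" "D $ m' \<le> z $ m'" for z
    using that by (intro vec.span_mono) (blast intro: le_trans)
  have vx: "path_vector wt x \<in> vec.span (?S D)"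
    using Suc.hyps(1)[of x] x(1) xm mono[of x] by auto
  have vy: "path_vector wt (step m' x) \<in> vec.span (?S D)"
    using Suc.hyps(1)[of "step m' x"] y ym mono[of "step m' x"] by auto
  have b: "wt (x, D) \<noteq> 0"
    using m x Dx by (intro nz) (auto simp: parcs_triangle_graph)
  have "path_vector wt x = wt (x, step m' x) *s path_vector wt (step m' x) + wt (x, D) *s (path_vector wt D :: 'n cvec)"
    using m path_vector_step[OF x, of wt] Dx by (auto simp: add.commute)
  then have "wt (x, D) *s path_vector wt D = path_vector wt x - wt (x, step m' x) *s (path_vector wt (step m' x) :: 'n cvec)"
    by simp
  then have "wt (x, D) *s path_vector wt D \<in> vec.span (?S D)"
    using vx vy by (simp add: vec.span_diff vec.span_scale)
  then have "inverse (wt (x, D)) *s (wt (x, D) *s path_vector wt D) \<in> vec.span (?S D)"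
    by (rule vec.span_scale)
  then show ?case using b by (simp add: vector_smult_assoc)
qed

text \<open>Rewriting a path vector through dots of the chosen side does not decrease coordinate
  \<open>k\<close>, so these dots remain within the set that spans the same flag member. Nonzero
  weights are what allows solving the relations for a lower dot.\<close>

lemma path_flag_eq_matrix_flag:
  assumes nz: "\<And>e. e \<in> edges CARD('n) \<Longrightarrow> wt e \<noteq> 0"
  shows "path_flag wt k = (matrix_flag (path_matrix wt k) :: 'n::{finite,linorder} flag)"
proof
  fix i
  let ?n = "CARD('n)"
  let ?E = "{path_vector wt (edge_dot ?n k (pos c)) :: 'n cvec |c :: 'n. pos c \<le> i}"
  let ?P = "{path_vector wt D :: 'n cvec |D. D \<in> triangle ?n \<and> ?n - i \<le> D $ k}"
  \<comment> \<open>\<open>m\<close> is the coordinate to be reduced to 0; \<open>k\<close> is 1 or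
    \<open>m'\<close>, one of the two coordinates that do not decrease.\<close>
  define m :: 3 where "m = (if k = 3 then 2 else 3)"
  define m' :: 3 where "m' = (if k = 3 then 3 else 2)"
  have m: "m = 2 \<and> m' = 3 \<or> m = 3 \<and> m' = 2" by (simp add: m_def m'_def)
  have k: "k = 1 \<or> k = m'" using exhaust_3[of k] by (auto simp: m'_def)
  have side: "\<exists>c :: 'n. pos c \<le> i \<and> D = edge_dot ?n k (pos c)"
    if D: "D \<in> triangle ?n" "D $ m = 0" "?n - i \<le> D $ k" for D
  proof -
    have sum: "D $ 1 + D $ 2 + D $ 3 = ?n - 1" using D(1) by (simp add: triangle_def)
    have pos: "1 \<le> ?n" using zero_less_card_finite[where 'a = 'n] by linarith
    have "D $ k \<le> ?n - 1" using sum exhaust_3[of k] by auto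
    then have "1 \<le> ?n - D $ k" "?n - D $ k \<le> ?n" using pos by linarith+
    then obtain c :: 'n where c: "pos c = ?n - D $ k" using pos_surj[where 'n = 'n] by blast
    have "D = edge_dot ?n k (pos c)"
      unfolding vec_eq_iff forall_3 c
      using exhaust_3[of k] D(2) sum pos by (auto simp: edge_dot_nth m_def)
    then show ?thesis using c D(3) by (intro exI[of _ c]) auto
  qed
  show "path_flag wt k i = matrix_flag (path_matrix wt k :: 'n cmat) i"
  proof (intro antisym)
    show "path_flag wt k i \<subseteq> matrix_flag (path_matrix wt k :: 'n cmat) i"
      unfolding path_flag_def matrix_flag_def column_path_matrix
    proof (rule vec.span_minimal[OF subsetI vec.subspace_span])
      fix x :: "'n cvec" assume "x \<in> ?P"
      then obtain D where D: "x = path_vector wt D" "D \<in> triangle ?n" "?n - i \<le> D $ k" by blast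
      let ?S = "{path_vector wt D' :: 'n cvec |D'. D' \<in> triangle ?n \<and> D' $ m = 0 \<and> D $ 1 \<le> D' $ 1 \<and> D $ m' \<le> D' $ m'}"
      have sub: "?S \<subseteq> ?E"
      proof
        fix y assume "y \<in> ?S"
        then obtain D' where D': "y = path_vector wt D'" "D' \<in> triangle ?n" "D' $ m = 0"
          "D $ 1 \<le> D' $ 1" "D $ m' \<le> D' $ m'" by blast
        have "?n - i \<le> D' $ k" using k D'(4,5) D(3) by auto
        then obtain c :: 'n where "pos c \<le> i" "D' = edge_dot ?n k (pos c)"
          using side[OF D'(2,3)] by blast
        then show "y \<in> ?E"
          using D'(1) by blast
      qed
      show "x \<in> vec.span ?E"
        unfolding D(1)
        by (rule subsetD[OF vec.span_mono[OF sub] path_vector_in_side_span[OF D(2) m nz]])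
    qed
    show "matrix_flag (path_matrix wt k :: 'n cmat) i \<subseteq> path_flag wt k i"
      unfolding path_flag_def matrix_flag_def column_path_matrix
    proof (intro vec.span_mono subsetI)
      fix x :: "'n cvec" assume "x \<in> ?E"
      then obtain c :: 'n where c: "x = path_vector wt (edge_dot ?n k (pos c))" "pos c \<le> i" by blast
      have "edge_dot ?n k (pos c) \<in> triangle ?n" by (rule edge_dot_triangle[OF pos_ge_1 pos_le_card])
      moreover have "?n - i \<le> edge_dot ?n k (pos c) $ k" using c(2) by (simp add: edge_dot_self)
      ultimately show "x \<in> ?P" using c(1) by blast
    qed
  qed
qed

section \<open>Generic triples of flags come from path vectors\<close>

text \<open>A parameter count, with n for the dimension. A normalized \<open>v\<close> has n - 1
  further coordinates. In each matrix the column \<open>j l\<close> can be solved from the equation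
  that puts \<open>v\<close> into the flag member, which leaves n (n - 1) entries, and the
  coefficients in this equation cost \<open>i l\<close> numbers. The total is (n - 1) + 3 n (n - 1)
  + 2 n = 3 n^2 - 1; the normalization saves the decisive parameter.\<close>

lemma generic_transverse_normalized:
  fixes x :: "'n::{finite,linorder} mat_triple"
  assumes gen: "generic_on UNIV x" and i: "i 1 + i 2 + i 3 = 2 * CARD('n)"
    and v: "\<And>l. v \<in> flags_of x l (i l)"
  shows "v $ r0 \<noteq> 1"
proof
  assume r0: "v $ r0 = 1"
  let ?n = "CARD('n)" and ?X = "entry_matrix x"
  have "\<forall>l. \<exists>a. a \<in> std_flag (i l) \<and> v = ?X l *v a"
    using v by (auto simp: flags_of_def matrix_flag_eq)
  from choice[OF this] obtain a where a: "\<And>l. a l \<in> std_flag (i l)" "\<And>l. v = ?X l *v a l" by blast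
  have "\<exists>j. a l $ j \<noteq> 0" for l
  proof (rule ccontr)
    assume "\<nexists>j. a l $ j \<noteq> 0"
    then have "a l = 0" by (simp add: vec_eq_iff)
    then have "v = 0" using a(2)[of l] by simp
    then show False using r0 by simp
  qed
  then obtain j where j: "\<And>l. a l $ j l \<noteq> 0" by metis
  have ji: "pos (j l) \<le> i l" for l using a(1)[of l] j[of l] by (auto simp: std_flag_def not_less[symmetric])
  define J where "J l = {c. c \<noteq> j l \<and> pos c \<le> i l}" for l
  define A where "A = (\<lambda>r. v $ r) ` (UNIV - {r0}) \<union>
    (\<Union>l\<in>UNIV. (\<lambda>(r, c). ?X l $ r $ c) ` (UNIV \<times> (UNIV - {j l}))) \<union>
    (\<Union>l\<in>UNIV. insert (inverse (a l $ j l)) ((\<lambda>c. a l $ c / a l $ j l) ` J l))"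
  have vA: "v $ r \<in> ratring A" for r
  proof (cases "r = r0")
    case True
    then show ?thesis using r0 by (auto intro: ratring.rat)
  next
    case False
    then show ?thesis by (intro ratring.gen) (auto simp: A_def)
  qed
  have XA: "?X l $ r $ c \<in> ratring A" if "c \<noteq> j l" for l r c
  proof (rule ratring.gen)
    have "?X l $ r $ c \<in> (\<lambda>(r, c). ?X l $ r $ c) ` (UNIV \<times> (UNIV - {j l}))" using that by force
    then show "?X l $ r $ c \<in> A" unfolding A_def by blast
  qed
  have XA': "?X l $ r $ j l \<in> ratring A" for l r
  proof -
    have "v $ r = (\<Sum>c\<in>UNIV. ?X l $ r $ c * a l $ c)"
      using a(2)[of l] by (simp add: matrix_vector_mult_def)
    also have "\<dots> = ?X l $ r $ j l * a l $ j l + (\<Sum>c\<in>UNIV - {j l}. ?X l $ r $ c * a l $ c)"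
      by (simp add: sum.remove[of UNIV "j l"])
    also have "(\<Sum>c\<in>UNIV - {j l}. ?X l $ r $ c * a l $ c) = (\<Sum>c\<in>J l. ?X l $ r $ c * a l $ c)"
    proof (rule sum.mono_neutral_right)
      have "a l $ c = 0" if "c \<noteq> j l" "c \<notin> J l" for c
        using a(1)[of l] that by (simp add: J_def std_flag_def not_le)
      then show "\<forall>c\<in>UNIV - {j l} - J l. ?X l $ r $ c * a l $ c = 0" by simp
    qed (auto simp: J_def)
    finally have "?X l $ r $ j l = (v $ r - (\<Sum>c\<in>J l. ?X l $ r $ c * a l $ c)) * inverse (a l $ j l)"
      using j[of l] by (simp add: field_simps)
    also have "\<dots> = v $ r * inverse (a l $ j l) - (\<Sum>c\<in>J l. ?X l $ r $ c * (a l $ c / a l $ j l))"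
      by (simp add: left_diff_distrib sum_distrib_right divide_inverse mult.assoc)
    also have "\<dots> \<in> ratring A"
    proof (intro ratring_diff ratring.mult ratring_sum vA)
      show "inverse (a l $ j l) \<in> ratring A" by (rule ratring.gen) (auto simp: A_def)
      fix c assume c: "c \<in> J l"
      then show "?X l $ r $ c \<in> ratring A" by (intro XA) (simp add: J_def)
      show "a l $ c / a l $ j l \<in> ratring A" using c by (intro ratring.gen) (auto simp: A_def)
    qed
    finally show ?thesis .
  qed
  have "card (UNIV :: (3 \<times> 'n \<times> 'n) set) \<le> card A"
  proof (rule generic_on_card_le[OF _ gen])
    show "finite A" by (simp add: A_def)
    fix w :: "3 \<times> 'n \<times> 'n"
    obtain l r c where w: "w = (l, r, c)" by (cases w) auto
    have "?X l $ r $ c \<in> ratring A" using XA XA' by (cases "c = j l") auto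
    then show "x w \<in> ratring A" by (simp add: w entry_matrix_def)
  qed simp
  moreover have "card A < 3 * ?n\<^sup>2"
  proof -
    have n: "1 \<le> ?n" using zero_less_card_finite[where 'a = 'n] by linarith
    have cJ: "Suc (card (J l)) \<le> i l" for l
    proof -
      have "insert (j l) (J l) = {c. pos c \<le> i l}" using ji[of l] by (auto simp: J_def)
      then have "card (insert (j l) (J l)) \<le> i l" using card_pos_le[of "i l", where 'n = 'n] by simp
      then show ?thesis by (simp add: J_def)
    qed
    have "card (insert (inverse (a l $ j l)) ((\<lambda>c. a l $ c / a l $ j l) ` J l)) \<le> i l" for l
    proof -
      have "card (insert (inverse (a l $ j l)) ((\<lambda>c. a l $ c / a l $ j l) ` J l)) \<le>
          Suc (card ((\<lambda>c. a l $ c / a l $ j l) ` J l))" by (rule card_insert_le_m1) auto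
      also have "\<dots> \<le> Suc (card (J l))" by (simp add: card_image_le)
      finally show ?thesis using cJ[of l] by linarith
    qed
    then have 3: "card (\<Union>l\<in>UNIV. insert (inverse (a l $ j l)) ((\<lambda>c. a l $ c / a l $ j l) ` J l)) \<le> (\<Sum>l\<in>UNIV. i l)"
      by (intro order_trans[OF card_UN_le] sum_mono) auto
    have "card ((\<lambda>(r, c). ?X l $ r $ c) ` (UNIV \<times> (UNIV - {j l}))) \<le> ?n * (?n - 1)" for l
      by (rule order_trans[OF card_image_le]) (simp_all add: card_cartesian_product)
    then have 2: "card (\<Union>l\<in>UNIV. (\<lambda>(r, c). ?X l $ r $ c) ` (UNIV \<times> (UNIV - {j l}))) \<le> (\<Sum>l\<in>(UNIV :: 3 set). ?n * (?n - 1))"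
      by (intro order_trans[OF card_UN_le] sum_mono) auto
    have 1: "card ((\<lambda>r. v $ r) ` (UNIV - {r0})) \<le> ?n - 1"
      by (rule order_trans[OF card_image_le]) simp_all
    have "card A \<le> card ((\<lambda>r. v $ r) ` (UNIV - {r0})) +
        card (\<Union>l\<in>UNIV. (\<lambda>(r, c). ?X l $ r $ c) ` (UNIV \<times> (UNIV - {j l}))) +
        card (\<Union>l\<in>UNIV. insert (inverse (a l $ j l)) ((\<lambda>c. a l $ c / a l $ j l) ` J l))"
      unfolding A_def by (meson add_le_mono1 card_Un_le le_trans)
    also have "\<dots> \<le> (?n - 1) + 3 * (?n * (?n - 1)) + 2 * ?n"
      using 1 2 3 i by (simp add: sum_3)
    also have "?n * (?n - 1) = ?n\<^sup>2 - ?n" by (simp add: power2_eq_square diff_mult_distrib2)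
    also have "(?n - 1) + 3 * (?n\<^sup>2 - ?n) + 2 * ?n < 3 * ?n\<^sup>2"
    proof -
      have "?n \<le> ?n\<^sup>2" by (simp add: power2_eq_square)
      then show ?thesis using n by linarith
    qed
    finally show ?thesis .
  qed
  ultimately show False by (simp add: power2_eq_square)
qed

lemma generic_transverse:
  fixes x :: "'n::{finite,linorder} mat_triple"
  assumes gen: "generic_on UNIV x" and i: "i 1 + i 2 + i 3 = 2 * CARD('n)"
    and v: "\<And>l. v \<in> flags_of x l (i l)"
  shows "v = 0"
proof (rule ccontr)
  assume "v \<noteq> 0"
  then obtain r where r: "v $ r \<noteq> 0" by (auto simp: vec_eq_iff)
  have "inverse (v $ r) *s v \<in> flags_of x l (i l)" for l
    using v[of l] subspace_matrix_flag vec.subspace_scale unfolding flags_of_def by blast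
  then show False using generic_transverse_normalized[OF gen i, of "inverse (v $ r) *s v" r] r by simp
qed

lemma dim_Int_ge:
  fixes U V :: "'n::finite cvec set"
  assumes "vec.subspace U" "vec.subspace V"
  shows "vec.dim U + vec.dim V \<le> vec.dim (U \<inter> V) + CARD('n)"
proof -
  have "vec.dim {x + y |x y. x \<in> U \<and> y \<in> V} \<le> CARD('n)"
    by (rule dim_subset_UNIV_cart_gen)
  then show ?thesis using vec.dim_sums_Int[OF assms] by linarith
qed

text \<open>The lines \<open>F\<^sub>1 \<inter> F\<^sub>2 \<inter> F\<^sub>3\<close> of a generic triple, one for each dot, satisfy the relations of
  path vectors, because three neighbouring ones lie in a plane.\<close>

lemma generic_path_matrices:
  fixes x :: "'n::{finite,linorder} mat_triple"
  assumes gen: "generic_on UNIV x"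
  shows "\<exists>wt g b. \<forall>k. upper_tri (b k) \<and> entry_matrix x k = g ** path_matrix wt k ** b k"
proof -
  let ?n = "CARD('n)" and ?F = "flags_of x"
  have inv: "invertible (entry_matrix x k)" for k by (rule generic_invertible[OF gen])
  have n: "1 \<le> ?n" using zero_less_card_finite[where 'a = 'n] by linarith
  have sub: "vec.subspace (?F k i)" for k i by (simp add: flags_of_def subspace_matrix_flag)
  have dim: "vec.dim (?F k i) = i" if "i \<le> ?n" for k i
    using that by (simp add: flags_of_def dim_matrix_flag[OF inv])
  have Fmono: "?F k i \<subseteq> ?F k j" if "i \<le> j" for k i j
    using that by (simp add: flags_of_def matrix_flag_mono)
  have transverse: "v = 0"
    if "i1 + i2 + i3 = 2 * ?n" "v \<in> ?F 1 i1" "v \<in> ?F 2 i2" "v \<in> ?F 3 i3" for v i1 i2 i3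
  proof (rule generic_transverse[OF gen, of "triple i1 i2 i3"])
    show "v \<in> ?F l (triple i1 i2 i3 l)" for l
      using that exhaust_3[of l] by (auto simp: triple_def)
  qed (use that in \<open>simp add: triple_def\<close>)
  have sum: "D $ 1 + D $ 2 + D $ 3 = ?n - 1" if "D \<in> triangle ?n" for D
    using that by (simp add: triangle_def)
  define I where "I D = ?F 1 (?n - D $ 1) \<inter> ?F 2 (?n - D $ 2) \<inter> ?F 3 (?n - D $ 3)" for D :: "nat ^ 3"
  have "\<exists>v. v \<in> I D \<and> v \<noteq> 0" if "D \<in> triangle ?n" for D
  proof -
    have "vec.subspace (?F 1 (?n - D $ 1) \<inter> ?F 2 (?n - D $ 2))"
      by (rule vec.subspace_inter[OF sub sub])
    \<comment> \<open>The three indices add up to one more than twice the dimension, so the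
      intersection has dimension at least 1.\<close>
    from dim_Int_ge[OF this sub, of 3 "?n - D $ 3"] dim_Int_ge[OF sub sub, of 1 "?n - D $ 1" 2 "?n - D $ 2"]
    have "vec.dim (I D) \<noteq> 0"
      using sum[OF that] n unfolding I_def dim[OF diff_le_self] by linarith
    then have "\<not> I D \<subseteq> {0}" by simp
    then show ?thesis by auto
  qed
  then obtain L where L: "\<And>D. D \<in> triangle ?n \<Longrightarrow> L D \<in> I D \<and> L D \<noteq> 0" by metis
  \<comment> \<open>Lowering one index by 1 brings the sum down to twice the dimension, where
    generic members meet in 0.\<close>
  have L_notin: "L D \<notin> ?F k (?n - D $ k - 1)" if D: "D \<in> triangle ?n" for D k
  proof
    assume k: "L D \<in> ?F k (?n - D $ k - 1)"
    note s = sum[OF D] n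
    have "L D \<in> ?F 1 (?n - D $ 1)" "L D \<in> ?F 2 (?n - D $ 2)" "L D \<in> ?F 3 (?n - D $ 3)"
      using L[OF D] by (auto simp: I_def)
    note mem = this
    consider "k = 1" | "k = 2" | "k = 3" using exhaust_3[of k] by blast
    then have "L D = 0"
    proof cases
      case 1
      show ?thesis by (rule transverse[OF _ k[unfolded 1] mem(2,3)]) (use s in linarith)
    next
      case 2
      show ?thesis by (rule transverse[OF _ mem(1) k[unfolded 2] mem(3)]) (use s in linarith)
    next
      case 3
      show ?thesis by (rule transverse[OF _ mem(1,2) k[unfolded 3]]) (use s in linarith)
    qed
    then show False using L[OF D] by blast
  qed
  \<comment> \<open>A linear functional that cuts the preceding member out of a flag member: a
    coordinate with respect to the columns of the matrix.\<close>
  have drop: "\<exists>\<phi>. (\<forall>u v. \<phi> (u - v) = \<phi> u - \<phi> v) \<and> (\<forall>a u. \<phi> (a *s u) = a * \<phi> u) \<and>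
      (\<forall>u\<in>?F k i. \<phi> u = 0 \<longleftrightarrow> u \<in> ?F k (i - 1))" if i: "1 \<le> i" "i \<le> ?n" for k i
  proof -
    obtain B where B: "entry_matrix x k ** B = mat 1" "B ** entry_matrix x k = mat 1"
      using inv unfolding invertible_def by blast
    obtain c :: 'n where c: "pos c = i" using pos_surj[OF i] by blast
    have mem: "u \<in> ?F k j \<longleftrightarrow> B *v u \<in> std_flag j" for u j
    proof
      show "B *v u \<in> std_flag j" if "u \<in> ?F k j"
        using that by (auto simp: flags_of_def matrix_flag_eq matrix_vector_mul_assoc B)
    next
      assume "B *v u \<in> std_flag j"
      then have "entry_matrix x k *v (B *v u) \<in> ?F k j"
        unfolding flags_of_def matrix_flag_eq by (rule imageI)
      then show "u \<in> ?F k j" by (simp add: matrix_vector_mul_assoc B)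
    qed
    show ?thesis
      unfolding c[symmetric] Ball_def mem
      by (intro exI[of _ "\<lambda>u. (B *v u) $ c"])
        (simp add: matrix_vector_mult_diff_distrib vector_scalar_commute
          std_flag_pred_iff[unfolded One_nat_def])
  qed
  have rel: "\<exists>a b. L D = a *s L (step 2 D) + b *s L (step 3 D)"
    if D: "D \<in> triangle ?n" "1 \<le> D $ 1" for D
  proof -
    note s = sum[OF D(1)] n
    have tri: "step 2 D \<in> triangle ?n" "step 3 D \<in> triangle ?n" using step_triangle[OF D] by auto
    \<comment> \<open>These indices add up to two more than twice the dimension; the three members
      meet in the plane of the neighbouring lines. Lowering both \<open>i2\<close> and
      \<open>i3\<close> leaves 0, so the two functionals below are coordinates on that plane, and
      each of the lower dots lies on one coordinate axis.\<close>
    define i1 where "i1 = ?n - D $ 1 + 1"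
    define i2 where "i2 = ?n - D $ 2"
    define i3 where "i3 = ?n - D $ 3"
    have i: "1 \<le> i2" "i2 \<le> ?n" "1 \<le> i3" "i3 \<le> ?n" "i1 + (i2 - 1) + (i3 - 1) = 2 * ?n"
      using s D(2) unfolding i1_def i2_def i3_def by linarith+
    have LD: "L D \<in> ?F 1 i1" "L D \<in> ?F 2 i2" "L D \<in> ?F 3 i3"
      using L[OF D(1)] Fmono[of "?n - D $ 1" i1 1] by (auto simp: I_def i1_def i2_def i3_def)
    have eq1: "?n - (D $ 1 - 1) = i1" using s D(2) by (simp add: i1_def)
    have LY: "L (step 2 D) \<in> ?F 1 i1" "L (step 2 D) \<in> ?F 2 (i2 - 1)" "L (step 2 D) \<in> ?F 3 i3"
      using L[OF tri(1)] eq1 by (auto simp: I_def i2_def i3_def)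
    have LZ: "L (step 3 D) \<in> ?F 1 i1" "L (step 3 D) \<in> ?F 2 i2" "L (step 3 D) \<in> ?F 3 (i3 - 1)"
      using L[OF tri(2)] eq1 by (auto simp: I_def i2_def i3_def)
    have LY2: "L (step 2 D) \<in> ?F 2 i2" and LZ3: "L (step 3 D) \<in> ?F 3 i3"
      using LY(2) LZ(3) Fmono[of "i2 - 1" i2 2] Fmono[of "i3 - 1" i3 3] by auto
    obtain \<phi> where \<phi>: "\<And>u v. \<phi> (u - v) = \<phi> u - \<phi> v" "\<And>a u. \<phi> (a *s u) = a * \<phi> u"
      "\<And>u. u \<in> ?F 2 i2 \<Longrightarrow> \<phi> u = 0 \<longleftrightarrow> u \<in> ?F 2 (i2 - 1)" using drop[OF i(1,2), of 2] by metis
    obtain \<psi> where \<psi>: "\<And>u v. \<psi> (u - v) = \<psi> u - \<psi> v" "\<And>a u. \<psi> (a *s u) = a * \<psi> u"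
      "\<And>u. u \<in> ?F 3 i3 \<Longrightarrow> \<psi> u = 0 \<longleftrightarrow> u \<in> ?F 3 (i3 - 1)" using drop[OF i(3,4), of 3] by metis
    have zero: "u = 0" if "u \<in> ?F 1 i1" "u \<in> ?F 2 i2" "u \<in> ?F 3 i3" "\<phi> u = 0" "\<psi> u = 0" for u
      using transverse[OF i(5) that(1)] \<phi>(3)[OF that(2)] \<psi>(3)[OF that(3)] that(4,5) by blast
    have Y: "\<phi> (L (step 2 D)) = 0" "\<psi> (L (step 2 D)) \<noteq> 0"
      using \<phi>(3)[OF LY2] LY zero[OF LY(1) LY2 LY(3)] L[OF tri(1)] by auto
    have Z: "\<psi> (L (step 3 D)) = 0" "\<phi> (L (step 3 D)) \<noteq> 0"
      using \<psi>(3)[OF LZ3] LZ zero[OF LZ(1,2) LZ3] L[OF tri(2)] by auto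
    define a where "a = \<psi> (L D) / \<psi> (L (step 2 D))"
    define b where "b = \<phi> (L D) / \<phi> (L (step 3 D))"
    define u where "u = L D - a *s L (step 2 D) - b *s L (step 3 D)"
    have "u \<in> ?F k i" if "L D \<in> ?F k i" "L (step 2 D) \<in> ?F k i" "L (step 3 D) \<in> ?F k i" for k i
      unfolding u_def using that by (intro vec.subspace_diff[OF sub] vec.subspace_scale[OF sub])
    note mem = this[OF LD(1) LY(1) LZ(1)] this[OF LD(2) LY2 LZ(2)] this[OF LD(3) LY(3) LZ3]
    have "\<phi> u = 0" "\<psi> u = 0"
      using Y Z by (simp_all add: u_def \<phi>(1,2) \<psi>(1,2) a_def b_def)
    then have "u = 0" by (rule zero[OF mem])
    then show ?thesis unfolding u_def by (intro exI[of _ a] exI[of _ b]) (simp add: algebra_simps)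
  qed
  then obtain \<alpha> \<beta> where \<alpha>\<beta>: "\<And>D. D \<in> triangle ?n \<Longrightarrow> 1 \<le> D $ 1 \<Longrightarrow>
      L D = \<alpha> D *s L (step 2 D) + \<beta> D *s L (step 3 D)" by metis
  \<comment> \<open>The coefficients of the relations are taken as edge weights; on an edge, the
    second case means \<open>y = step 3 D\<close>.\<close>
  define wt where "wt = (\<lambda>(D, y). if y = step 2 D then \<alpha> D else \<beta> D)"
  \<comment> \<open>Sends the path vectors of the bottom row, which are unit vectors, to the chosen
    vectors on the corresponding lines; the recursion carries the equality upwards.\<close>
  define g :: "'n cmat" where "g = (\<chi> r c. L (bottom_dot ?n (pos c)) $ r)"
  have Lg: "L D = g *v path_vector wt D" if "D \<in> triangle ?n" for D
    using that
  proof (induction D rule: triangle_induct[where 'n = 'n])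
    case (bottom c)
    have "g *v axis c 1 = column c g" by (simp add: column_eq_mult)
    then show ?case by (simp add: path_vector_bottom g_def column_def vec_eq_iff)
  next
    case (step D)
    have wt: "wt (D, step 2 D) = \<alpha> D" "wt (D, step 3 D) = \<beta> D"
      using step_2_neq_3[of D] by (auto simp: wt_def)
    show ?case
      unfolding path_vector_step[OF step(1,2)] wt
      by (simp only: matrix_vector_right_distrib vector_scalar_commute step(3,4)[symmetric]
          \<alpha>\<beta>[OF step(1,2), symmetric])
  qed
  have "\<exists>b. upper_tri b \<and> entry_matrix x k = g ** path_matrix wt k ** b" for k
  proof -
    define h where "h = g ** path_matrix wt k"
    have col: "column c h = L (edge_dot ?n k (pos c))" for c
      unfolding h_def column_mult column_path_matrix
      by (rule Lg[symmetric, OF edge_dot_triangle[OF pos_ge_1 pos_le_card]])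
    have tri: "edge_dot ?n k (pos c) \<in> triangle ?n" for c :: 'n
      by (rule edge_dot_triangle[OF pos_ge_1 pos_le_card])
    have pk: "?n - edge_dot ?n k (pos c) $ k = pos c" for c :: 'n
      using pos_le_card[of c] by (simp add: edge_dot_self)
    have "L D \<in> ?F k (?n - D $ k)" if "D \<in> triangle ?n" for D
      using L[OF that] exhaust_3[of k] by (auto simp: I_def)
    then have "column c h \<in> ?F k (pos c)" "column c h \<notin> ?F k (pos c - 1)" for c
      using L_notin[OF tri, of c k] tri[of c] unfolding col by (metis pk)+
    \<comment> \<open>The columns of \<open>h\<close> are adapted to the flag, so \<open>h\<close>
      and the given matrix differ by a triangular factor.\<close>
    moreover have "complete_flag (?F k)"
      unfolding flags_of_def by (rule complete_flag_matrix_flag[OF inv])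
    ultimately have "invertible h" "matrix_flag (entry_matrix x k) = matrix_flag h"
      using adapted_matrix_flag[of "?F k" h] by (auto simp: flags_of_def)
    then show ?thesis using matrix_flag_eq_imp h_def by blast
  qed
  then show ?thesis by metis
qed

lemma upper_tri_entry: "upper_tri b \<Longrightarrow> b = (\<chi> r c. if c < r then 0 else b $ r $ c)"
  by (auto simp: upper_tri_def vec_eq_iff)

text \<open>The weights \<open>wt0\<close> that belong to \<open>x\<close> are unrelated to
  \<open>wt\<close>. They only show that \<open>q\<close>, composed with the map from weights and
  auxiliary matrices to triples, is not identically zero. Once the auxiliary matrices are rational,
  this is a nonzero rational polynomial in the weights, hence nonzero at \<open>wt\<close>.\<close>

lemma generic_path_matrices_dominant:
  fixes x :: "'n::{finite,linorder} mat_triple"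
  assumes gen: "generic_on UNIV x" and q: "q \<in> polyfun \<rat> UNIV" "q x \<noteq> 0"
    and wt: "generic_on (edges CARD('n)) wt"
  shows "\<exists>y g b. q y \<noteq> 0 \<and> (\<forall>k. upper_tri (b k) \<and> entry_matrix y k = g ** path_matrix wt k ** b k)"
proof -
  obtain wt0 g0 b0 where 0: "\<And>k. upper_tri (b0 k)" "\<And>k. entry_matrix x k = g0 ** path_matrix wt0 k ** b0 k"
    using generic_path_matrices[OF gen] by metis
  define G :: "(('n \<times> 'n) + (3 \<times> 'n \<times> 'n) \<Rightarrow> complex) \<Rightarrow> 'n cmat" where
    "G e = (\<chi> r c. e (Inl (r, c)))" for e
  define B :: "(('n \<times> 'n) + (3 \<times> 'n \<times> 'n) \<Rightarrow> complex) \<Rightarrow> 3 \<Rightarrow> 'n cmat" where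
    "B e k = (\<chi> r c. if c < r then 0 else e (Inr (k, r, c)))" for e k
  define \<Phi> where "\<Phi> e wt = (\<lambda>(k, r, c). (G e ** path_matrix wt k ** B e k) $ r $ c)" for e wt
  have \<Phi>: "entry_matrix (\<Phi> e wt) k = G e ** path_matrix wt k ** B e k" for e wt k
    by (simp add: \<Phi>_def entry_matrix_def vec_eq_iff)
  define e0 where "e0 = case_sum (\<lambda>(r, c). g0 $ r $ c) (\<lambda>(k, r, c). b0 k $ r $ c)"
  have "G e0 = g0" by (simp add: G_def e0_def vec_eq_iff)
  moreover have "B e0 k = b0 k" for k
  proof -
    have "B e0 k = (\<chi> r c. if c < r then 0 else b0 k $ r $ c)" by (simp add: B_def e0_def vec_eq_iff)
    then show ?thesis using upper_tri_entry[OF 0(1)] by simp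
  qed
  ultimately have "entry_matrix (\<Phi> e0 wt0) k = entry_matrix x k" for k using 0(2) \<Phi> by simp
  then have "\<Phi> e0 wt0 = x" by (auto simp: fun_eq_iff entry_matrix_def vec_eq_iff)
  have "(\<lambda>e. q (\<Phi> e wt0)) \<in> polyfun UNIV UNIV"
  proof (rule polyfun_compose[where \<Phi> = "\<lambda>e. \<Phi> e wt0"])
    show "q \<in> polyfun UNIV UNIV" using polyfun_mono[OF q(1)] by blast
    fix i :: "3 \<times> 'n \<times> 'n"
    obtain k r c where i: "i = (k, r, c)" by (cases i) auto
    show "(\<lambda>e. \<Phi> e wt0 i) \<in> polyfun UNIV UNIV"
      unfolding \<Phi>_def i prod.case
    proof (intro polyfun_matrix_mult)
      show "(\<lambda>e. B e k $ r $ c) \<in> polyfun UNIV UNIV" for r c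
        by (cases "c < r") (auto simp: B_def intro: polyfun.var polyfun.const)
    qed (auto simp: G_def intro: polyfun.var polyfun.const)
  qed
  from polyfun_rational_nonzero[OF finite subset_UNIV this, where V = UNIV and e = e0] obtain e
    where e: "q (\<Phi> e wt0) \<noteq> 0" "\<And>i. e i \<in> \<rat>"
    using q(2) \<open>\<Phi> e0 wt0 = x\<close> by auto
  have "(\<lambda>wt. q (\<Phi> e wt)) \<in> polyfun \<rat> (edges CARD('n))"
  proof (rule polyfun_compose[where \<Phi> = "\<Phi> e", OF q(1)])
    fix i :: "3 \<times> 'n \<times> 'n"
    obtain k r c where i: "i = (k, r, c)" by (cases i) auto
    show "(\<lambda>wt. \<Phi> e wt i) \<in> polyfun \<rat> (edges CARD('n))"
      unfolding \<Phi>_def i prod.case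
    proof (intro polyfun_matrix_mult)
      show "(\<lambda>wt. (path_matrix wt k :: 'n cmat) $ r $ c) \<in> polyfun \<rat> (edges CARD('n))" for r c
        by (simp add: path_matrix_def)
          (rule polyfun_path_vector[OF edge_dot_triangle[OF pos_ge_1 pos_le_card] order.refl])
    qed (use e(2) in \<open>auto simp: G_def B_def intro: polyfun_rat\<close>)
  qed
  then have "q (\<Phi> e wt) \<noteq> 0" using generic_onD[OF wt] e(1) by blast
  moreover have "upper_tri (B e k)" for k by (simp add: B_def upper_tri_def)
  ultimately show ?thesis using \<Phi> by blast
qed

section \<open>Invariance of the count under the general linear group\<close>

lemma schubert_intersection_image:
  fixes E :: "3 \<Rightarrow> 'n::{finite,linorder} flag" and g :: "'n cmat"
  assumes g: "invertible g" and F: "F \<in> schubert_intersection u v w E"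
  shows "(\<lambda>i. (*v) g ` F i) \<in> schubert_intersection u v w (\<lambda>k i. (*v) g ` E k i)"
proof -
  have dim: "vec.dim ((*v) g ` X \<inter> (*v) g ` Y) = vec.dim (X \<inter> Y)" for X Y
    using image_Int[OF invertible_inj[OF g], of X Y] dim_image_invertible[OF g] by metis
  have "complete_flag F" using F by (simp add: schubert_intersection_def schubert_variety_def)
  then have "complete_flag (\<lambda>i. (*v) g ` F i)"
    unfolding complete_flag_def dim_image_invertible[OF g]
    using vec.linear_subspace_image[OF linear_matrix] by blast
  then show ?thesis using F by (simp add: schubert_intersection_def schubert_variety_def dim)
qed

lemma card_schubert_intersection_image:
  fixes E :: "3 \<Rightarrow> 'n::{finite,linorder} flag" and g :: "'n cmat"
  assumes g: "invertible g"
    and fin: "finite (schubert_intersection u v w (\<lambda>k i. (*v) g ` E k i))"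
  shows "finite (schubert_intersection u v w E)"
    "card (schubert_intersection u v w E) = card (schubert_intersection u v w (\<lambda>k i. (*v) g ` E k i))"
proof -
  let ?S = "schubert_intersection u v w E"
  let ?S' = "schubert_intersection u v w (\<lambda>k i. (*v) g ` E k i)"
  obtain g' where g': "g ** g' = mat 1" "g' ** g = mat 1" using g unfolding invertible_def by blast
  then have "invertible g'" unfolding invertible_def by blast
  have gg: "(*v) g' ` (*v) g ` X = X" "(*v) g ` (*v) g' ` X = X" for X :: "'n cvec set"
    by (simp_all add: image_image matrix_vector_mul_assoc g')
  have "bij_betw (\<lambda>F i. (*v) g ` F i) ?S ?S'"
  proof (rule bij_betw_byWitness[where f' = "\<lambda>F i. (*v) g' ` F i"])
    show "(\<lambda>F i. (*v) g ` F i) ` ?S \<subseteq> ?S'" using schubert_intersection_image[OF g] by blast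
    show "(\<lambda>F i. (*v) g' ` F i) ` ?S' \<subseteq> ?S"
      using schubert_intersection_image[OF \<open>invertible g'\<close>, where E = "\<lambda>k i. (*v) g ` E k i"]
      by (auto simp: gg)
  qed (simp_all add: gg)
  then show "finite ?S" "card ?S = card ?S'" using fin bij_betw_finite bij_betw_same_card by blast+
qed

theorem proposition9p2:
  fixes wt :: "(nat ^ 3) \<times> (nat ^ 3) \<Rightarrow> complex"
  assumes "alg_independent_over_rats wt (parcs (triangle_graph CARD('n::{finite,linorder})))"
  shows "schubert_generic (path_flag wt :: 3 \<Rightarrow> 'n flag)"
proof -
  have wt: "generic_on (parcs (triangle_graph CARD('n))) wt"
    by (rule alg_independent_imp_generic_on[OF assms])
  \<comment> \<open>Evaluation at the constant function 1 shows that the variable \<open>e\<close>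
    is not the zero polynomial.\<close>
  have "wt e \<noteq> 0" if "e \<in> parcs (triangle_graph CARD('n))" for e
    using generic_onD[OF wt polyfun.var[OF that], of "\<lambda>_. 1"] by auto
  from path_flag_eq_matrix_flag[OF this]
  have flag: "path_flag wt k = (matrix_flag (path_matrix wt k) :: 'n flag)" for k .
  obtain x :: "'n mat_triple" where gen: "generic_on UNIV x"
    using exists_generic_on[OF finite] by blast
  have complete: "complete_flag (path_flag wt k :: 'n flag)" for k
  proof -
    \<comment> \<open>Applied to the determinant, dominance gives an invertible product with the
      path matrix as a factor, so the path matrix is invertible.\<close>
    have "(\<lambda>y. det (entry_matrix y k :: 'n cmat)) \<in> polyfun \<rat> UNIV"
      by (intro polyfun_det polyfun_entry_matrix) auto
    moreover have "det (entry_matrix x k) \<noteq> 0"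
      using generic_invertible[OF gen] by (simp add: invertible_det_nz)
    ultimately obtain y and g :: "'n cmat" and b :: "3 \<Rightarrow> 'n cmat"
      where "det (entry_matrix y k :: 'n cmat) \<noteq> 0" "entry_matrix y k = g ** path_matrix wt k ** b k"
      using generic_path_matrices_dominant[OF gen _ _ wt, of "\<lambda>y. det (entry_matrix y k)"] by blast
    then have "invertible (path_matrix wt k :: 'n cmat)" by (simp add: invertible_det_nz det_mul)
    then show ?thesis unfolding flag by (rule complete_flag_matrix_flag)
  qed
  moreover have "has_count u v w (path_flag wt :: 3 \<Rightarrow> 'n flag) (schubert_number TYPE('n) u v w)"
    if perm: "u permutes {1..CARD('n)}" "v permutes {1..CARD('n)}" "w permutes {1..CARD('n)}"
      and len: "perm_length CARD('n) u + perm_length CARD('n) v + perm_length CARD('n) w = CARD('n) choose 2"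
    for u v w
  proof -
    define c where "c = card (schubert_intersection u v w (flags_of x))"
    obtain q where q: "q \<in> polyfun \<rat> UNIV" "q x \<noteq> 0" and
      count: "\<And>y. q y \<noteq> 0 \<Longrightarrow> y \<in> GL_triples \<and> has_count u v w (flags_of y) c"
      using generic_count_nbhd[OF gen perm len] unfolding c_def by blast
    have "schubert_number TYPE('n) u v w = c"
      using schubert_number_eq[OF polyfun_mono[OF q(1)] q(2) count] by simp
    moreover obtain y g b where y: "q y \<noteq> 0" "\<And>k. upper_tri (b k)"
      "\<And>k. entry_matrix y k = g ** path_matrix wt k ** b k"
      using generic_path_matrices_dominant[OF gen q wt] by blast
    have inv: "invertible (g ** path_matrix wt k ** b k)" for k
      using count[OF y(1)] by (simp add: GL_triples_iff y(3))
    then have g: "invertible g" using invertible_multD by blast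
    \<comment> \<open>The triangular factors do not change flags, so only the common factor
      \<open>g\<close> remains, and it preserves the count.\<close>
    have "flags_of y = (\<lambda>k i. (*v) g ` path_flag wt k i)"
      by (intro ext) (simp add: flags_of_def y(3) matrix_flag_upper_tri[OF y(2) inv] matrix_flag_mult flag)
    then show ?thesis
      using card_schubert_intersection_image[OF g, of u v w "path_flag wt"] count[OF y(1)] calculation
      by simp
  qed
  ultimately show ?thesis unfolding schubert_generic_def by blast
qed

end
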